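(* Let $\mathcal{M}$ be the space of bounded multiplicative Hankel operators on $\ell^2(\mathbb{N})$ and $\mathcal{M}_0\subset\mathcal{M}$ the subspace of compact ones, both equipped with the operator norm. Then there is a unique isometric isomorphism $U\colon\mathcal{M}_0^{**}\to\mathcal{M}$ such that $U\iota_{\mathcal{M}_0}m=m$ for every $m\in\mathcal{M}_0$, where $\iota_{\mathcal{M}_0}\colon\mathcal{M}_0\to\mathcal{M}_0^{**}$ is the canonical embedding. Furthermore, $\mathcal{M}_0$ is an M-ideal in $\mathcal{M}$.
   Context: For a sequence $\alpha\colon\mathbb{N}\to\mathbb{C}$, the multiplicative Hankel operator $M(\alpha)$ is defined by the form $\langle M(\alpha)a,b\rangle_{\ell^2(\mathbb{N})}=\sum_{n,m=1}^\infty a(n)\overline{b(m)}\alpha(nm)$ for finitely supported $a,b$; it is bounded if this form is bounded by $C\|a\|_{\ell^2}\|b\|_{\ell^2}$, in which case it extends to a bounded operator on $\ell^2(\mathbb{N})$ with matrix $\{\alpha(nm)\}_{n,m\ge1}$. $\mathcal{M}=\{M(\alpha): M(\alpha)\text{ bounded}\}$ and $\mathcal{M}_0=\{M(\alpha): M(\alpha)\text{ compact}\}$ are closed subspaces of the bounded operators, with the operator norm. For a Banach space $Y$, $\iota_Y\colon Y\to Y^{**}$ is $\iota_Y y(y^* )=y^*(y)$. A closed subspace $Z$ of a Banach space $W$ is an M-ideal in $W$ if there is a projection $P$ of $W^*$ onto the annihilator $Z^\perp=\{w^*\in W^*: w^*|_Z=0\}$ such that $\|w^*\|=\|Pw^*\|+\|w^*-Pw^*\|$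 for all $w^*\in W^*$. *)

theory Defs
  imports "HOL-Analysis.Analysis"
begin

text \<open>Elements of ell^2(N) are represented as functions nat => complex that vanish
  at 0 (index 0 is not used; N = {1,2,3,...}) and are square summable.\<close>

definition l2 :: "(nat \<Rightarrow> complex) set" where
  "l2 = {a. a 0 = 0 \<and> summable (\<lambda>n. (cmod (a n))\<^sup>2)}"

definition l2norm :: "(nat \<Rightarrow> complex) \<Rightarrow> real" where
  "l2norm a = sqrt (\<Sum>n. (cmod (a n))\<^sup>2)"

definition finsupp :: "(nat \<Rightarrow> complex) \<Rightarrow> bool" where
  "finsupp a \<longleftrightarrow> a 0 = 0 \<and> finite {n. a n \<noteq> 0}"

definition mh_form :: "(nat \<Rightarrow> complex) \<Rightarrow> (nat \<Rightarrow> complex) \<Rightarrow> (nat \<Rightarrow> complex) \<Rightarrow> complex" where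
  "mh_form \<alpha> a b = (\<Sum>n\<in>{n. a n \<noteq> 0}. \<Sum>m\<in>{m. b m \<noteq> 0}. a n * cnj (b m) * \<alpha> (n * m))"

definition mh_bounded :: "(nat \<Rightarrow> complex) \<Rightarrow> bool" where
  "mh_bounded \<alpha> \<longleftrightarrow> (\<exists>C. \<forall>a b. finsupp a \<longrightarrow> finsupp b \<longrightarrow>
      cmod (mh_form \<alpha> a b) \<le> C * l2norm a * l2norm b)"

type_synonym op = "(nat \<Rightarrow> complex) \<Rightarrow> (nat \<Rightarrow> complex)"

text \<open>The operator M(alpha) on ell^2 with matrix alpha(nm): (M(alpha) a)(m) = sum_n alpha(nm) a(n).
  For bounded M(alpha) this is exactly the bounded extension of the form.  Outside ell^2 the
  function is set to 0, so that operators are determined by their action on ell^2.\<close>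
definition Mop :: "(nat \<Rightarrow> complex) \<Rightarrow> op" where
  "Mop \<alpha> = (\<lambda>a. if a \<in> l2 then (\<lambda>m. if m = 0 then 0 else (\<Sum>n. \<alpha> (n * m) * a n))
                  else (\<lambda>_. 0))"

definition opnorm :: "op \<Rightarrow> real" where
  "opnorm T = Sup {l2norm (T a) | a. a \<in> l2 \<and> l2norm a \<le> 1}"

definition op_add :: "op \<Rightarrow> op \<Rightarrow> op" where
  "op_add T S = (\<lambda>a n. T a n + S a n)"

definition op_scale :: "complex \<Rightarrow> op \<Rightarrow> op" where
  "op_scale c T = (\<lambda>a n. c * T a n)"

definition compact_op :: "op \<Rightarrow> bool" where
  "compact_op T \<longleftrightarrow> (\<forall>x :: nat \<Rightarrow> nat \<Rightarrow> complex. (\<forall>k. x k \<in> l2) \<and> bounded (range (\<lambda>k. l2norm (x k))) \<longrightarrow>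
      (\<exists>r y. strict_mono r \<and> y \<in> l2 \<and>
         (\<lambda>k. l2norm (\<lambda>n. T (x (r k)) n - y n)) \<longlonglongrightarrow> 0))"

definition Mspace :: "op set" where
  "Mspace = {Mop \<alpha> | \<alpha>. mh_bounded \<alpha>}"

definition M0space :: "op set" where
  "M0space = {T \<in> Mspace. compact_op T}"

text \<open>A complex normed space is given by a carrier V, addition, scalar multiplication and norm.
  Its dual consists of the bounded complex-linear functionals on V, normalised to vanish
  outside V (so that functionals are determined by their values on V).\<close>

definition dual_space :: "'v set \<Rightarrow> ('v \<Rightarrow> 'v \<Rightarrow> 'v) \<Rightarrow> (complex \<Rightarrow> 'v \<Rightarrow> 'v) \<Rightarrow> ('v \<Rightarrow> real)
    \<Rightarrow> ('v \<Rightarrow> complex) set" where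
  "dual_space V add sc nrm = {f.
      (\<forall>x\<in>V. \<forall>y\<in>V. f (add x y) = f x + f y) \<and>
      (\<forall>c. \<forall>x\<in>V. f (sc c x) = c * f x) \<and>
      (\<exists>C. \<forall>x\<in>V. cmod (f x) \<le> C * nrm x) \<and>
      (\<forall>x. x \<notin> V \<longrightarrow> f x = 0)}"

definition dual_norm :: "'v set \<Rightarrow> ('v \<Rightarrow> real) \<Rightarrow> ('v \<Rightarrow> complex) \<Rightarrow> real" where
  "dual_norm V nrm f = Sup {cmod (f x) | x. x \<in> V \<and> nrm x \<le> 1}"

definition fun_add :: "('v \<Rightarrow> complex) \<Rightarrow> ('v \<Rightarrow> complex) \<Rightarrow> ('v \<Rightarrow> complex)" where
  "fun_add f g = (\<lambda>x. f x + g x)"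

definition fun_scale :: "complex \<Rightarrow> ('v \<Rightarrow> complex) \<Rightarrow> ('v \<Rightarrow> complex)" where
  "fun_scale c f = (\<lambda>x. c * f x)"

definition fun_diff :: "('v \<Rightarrow> complex) \<Rightarrow> ('v \<Rightarrow> complex) \<Rightarrow> ('v \<Rightarrow> complex)" where
  "fun_diff f g = (\<lambda>x. f x - g x)"

definition canon_emb :: "'v set \<Rightarrow> ('v \<Rightarrow> 'v \<Rightarrow> 'v) \<Rightarrow> (complex \<Rightarrow> 'v \<Rightarrow> 'v) \<Rightarrow> ('v \<Rightarrow> real)
    \<Rightarrow> 'v \<Rightarrow> (('v \<Rightarrow> complex) \<Rightarrow> complex)" where
  "canon_emb V add sc nrm y = (\<lambda>f. if f \<in> dual_space V add sc nrm then f y else 0)"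

definition M0dual :: "(op \<Rightarrow> complex) set" where
  "M0dual = dual_space M0space op_add op_scale opnorm"

definition M0dual_norm :: "(op \<Rightarrow> complex) \<Rightarrow> real" where
  "M0dual_norm = dual_norm M0space opnorm"

definition M0bidual :: "((op \<Rightarrow> complex) \<Rightarrow> complex) set" where
  "M0bidual = dual_space M0dual fun_add fun_scale M0dual_norm"

definition M0bidual_norm :: "((op \<Rightarrow> complex) \<Rightarrow> complex) \<Rightarrow> real" where
  "M0bidual_norm = dual_norm M0dual M0dual_norm"

definition iota_M0 :: "op \<Rightarrow> ((op \<Rightarrow> complex) \<Rightarrow> complex)" where
  "iota_M0 = canon_emb M0space op_add op_scale opnorm"

definition M_ideal :: "'v set \<Rightarrow> 'v set \<Rightarrow> ('v \<Rightarrow> 'v \<Rightarrow> 'v) \<Rightarrow> (complex \<Rightarrow> 'v \<Rightarrow> 'v)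
    \<Rightarrow> ('v \<Rightarrow> real) \<Rightarrow> bool" where
  "M_ideal Z W add sc nrm \<longleftrightarrow>
     Z \<subseteq> W \<and>
     (\<forall>x\<in>Z. \<forall>y\<in>Z. add x y \<in> Z) \<and> (\<forall>c. \<forall>x\<in>Z. sc c x \<in> Z) \<and>
     (\<forall>s w. (\<forall>k. s k \<in> Z) \<and> w \<in> W \<and>
        (\<lambda>k. nrm (add (s k) (sc (-1) w))) \<longlonglongrightarrow> 0 \<longrightarrow> w \<in> Z) \<and>
     (let D = dual_space W add sc nrm;
          Ann = {f \<in> D. \<forall>z\<in>Z. f z = 0}
      in \<exists>P. (\<forall>f\<in>D. P f \<in> D) \<and>
             (\<forall>f\<in>D. \<forall>g\<in>D. P (fun_add f g) = fun_add (P f) (P g)) \<and>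
             (\<forall>c. \<forall>f\<in>D. P (fun_scale c f) = fun_scale c (P f)) \<and>
             (\<forall>f\<in>D. P (P f) = P f) \<and>
             P ` D = Ann \<and>
             (\<forall>f\<in>D. dual_norm W nrm f =
                dual_norm W nrm (P f) + dual_norm W nrm (fun_diff f (P f))))"

end

theory Submission
  imports Defs "HOL-Library.Diagonal_Subsequence"
begin

text \<open>
  A functional on a space of Hankel operators extends, by Hahn--Banach and with the same norm, to a
  functional \<open>F\<close> on all bounded matrices. A gliding hump argument shows that \<open>F (P_n A P_n)\<close>, for the
  coordinate projections \<open>P_n\<close>, converges uniformly on the unit ball. The limit is the normal part of
  \<open>F\<close>; the remaining singular part vanishes on compact matrices, and testing \<open>F\<close> on
  \<open>P_n A P_n + (1 - P_n) B (1 - P_n)\<close> shows that the norms of both parts add up to at most the norm of \<open>F\<close>.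

  The projections do not preserve the Hankel structure, but the diagonal operators \<open>D\<close> with entries
  \<open>n powr -\<epsilon>\<close> do, because these entries are completely multiplicative in \<open>n\<close>: \<open>D M(\<alpha>) D\<close> is the compact
  Hankel operator with symbol \<open>\<alpha>(n) n powr -\<epsilon>\<close>. Hence the normal part of \<open>F\<close> on a Hankel operator is the
  limit for \<open>\<epsilon> \<rightarrow> 0\<close> of the given functional, and is independent of the extension \<open>F\<close>. This gives the
  M-ideal projection. It also gives the isomorphism with the bidual, since functionals on the compact Hankel
  operators are norm limits of finite combinations of the coefficients \<open>\<alpha> \<mapsto> \<alpha>(n)\<close>. Uniqueness follows
  from the additivity of the norms.
\<close>

section \<open>The Hahn--Banach theorem\<close>

text \<open>The functionals are extended to all bounded matrices because the norm estimates glue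
  blocks living on disjoint coordinate sets, and this leaves the Hankel class. On the larger space
  the argument is the one showing that the compact operators are an M-ideal in all bounded
  operators. As the extension depends on choices, results are transferred back through
  \<open>hat f\<close>, which mentions only values of \<open>f\<close> on dilated operators. This
  serves two purposes. For \<open>f\<close> on \<open>Mspace\<close>, the M-ideal projection is the
  singular part \<open>f - hat f\<close>, because it is the singular parts that annihilate
  \<open>M0space\<close>. For \<open>f\<close> on \<open>M0space\<close>, \<open>hat f\<close> has
  values on all of \<open>Mspace\<close>, so that \<open>T\<close> acts on \<open>f\<close> by
  \<open>hat f T\<close>; this inverts the map sending \<Phi> in the bidual to the operator with
  symbol \<open>n \<mapsto> \<Phi> (ev n)\<close>. The norm of a matrix is defined by bilinear forms
  on finite sections, without conjugation: transposition is then a symmetry that interchanges rows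
  and columns and fixes Hankel matrices.\<close>

definition sublinear :: "('v::real_vector \<Rightarrow> real) \<Rightarrow> bool" where
  "sublinear p \<longleftrightarrow> (\<forall>x y. p (x + y) \<le> p x + p y) \<and> (\<forall>c\<ge>0. \<forall>x. p (c *\<^sub>R x) \<le> c * p x)"

lemma sublinear_zero: "sublinear p \<Longrightarrow> p 0 = 0"
proof -
  assume p: "sublinear p"
  have "p (0 + 0) \<le> p 0 + p 0" "p (0 *\<^sub>R 0) \<le> 0 * p 0" using p unfolding sublinear_def by blast+
  then show ?thesis by simp
qed

lemma sublinear_scale: assumes "sublinear p" "c \<ge> 0" shows "p (c *\<^sub>R x) = c * p x"
proof (cases "c = 0")
  case False
  have "p ((1/c) *\<^sub>R (c *\<^sub>R x)) \<le> (1/c) * p (c *\<^sub>R x)"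
    using assms unfolding sublinear_def by (meson divide_nonneg_nonneg zero_le_one)
  then have "c * p x \<le> p (c *\<^sub>R x)" using False assms(2) by (simp add: field_simps)
  moreover have "p (c *\<^sub>R x) \<le> c * p x" using assms unfolding sublinear_def by blast
  ultimately show ?thesis by linarith
qed (use sublinear_zero[OF assms(1)] in simp)

lemma sublinear_lower: assumes "sublinear p" shows "- p (- x) \<le> p x"
proof -
  have "p (x + - x) \<le> p x + p (- x)" using assms unfolding sublinear_def by blast
  then show ?thesis using sublinear_zero[OF assms] by simp
qed

text \<open>Zorn's lemma for the reversed pointwise order: the lower bound of a chain is its
  pointwise infimum. Subadditivity survives because of any two members of a chain the smaller one
  can be used for both arguments.\<close>

lemma minimal_sublinear_exists:
  assumes p: "sublinear p"
  shows "\<exists>q. sublinear q \<and> q \<le> p \<and> (\<forall>r. sublinear r \<longrightarrow> r \<le> q \<longrightarrow> r = q)"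
proof -
  let ?A = "{q. sublinear q \<and> q \<le> p}"
  let ?R = "\<lambda>q r :: 'a \<Rightarrow> real. r \<le> q"
  have "\<exists>m\<in>?A. \<forall>a\<in>?A. ?R m a \<longrightarrow> a = m"
  proof (rule predicate_Zorn)
    show "partial_order_on ?A (relation_of ?R ?A)"
      by (rule partial_order_on_relation_ofI) auto
    fix C assume C: "C \<in> Chains (relation_of ?R ?A)"
    then have CA: "C \<subseteq> ?A" unfolding Chains_def relation_of_def by blast
    have tot: "q \<le> r \<or> r \<le> q" if "q \<in> C" "r \<in> C" for q r
      using C that unfolding Chains_def relation_of_def by blast
    show "\<exists>u\<in>?A. \<forall>a\<in>C. ?R a u"
    proof (cases "C = {}")
      case True then show ?thesis using p by auto
    next
      case ne: False
      define u where "u x = (INF q\<in>C. q x)" for x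
      \<comment> \<open>This keeps the infimum finite; it combines
        \<open>0 \<le> q x + q (- x)\<close> with \<open>q \<le> p\<close>.\<close>
      have lb: "- p (- x) \<le> q x" if "q \<in> C" for q x
      proof -
        have "sublinear q" "q (- x) \<le> p (- x)" using that CA by (auto simp: le_fun_def)
        then show ?thesis using sublinear_lower[of q x] by linarith
      qed
      have bb: "bdd_below ((\<lambda>q. q x) ` C)" for x
        using lb[of _ x] by (intro bdd_belowI2[where m = "- p (- x)"]) blast
      have uq: "u x \<le> q x" if "q \<in> C" for q x
        unfolding u_def using bb that by (rule cINF_lower)
      have ug: "b \<le> u x" if "\<And>q. q \<in> C \<Longrightarrow> b \<le> q x" for b x
        unfolding u_def using ne that by (rule cINF_greatest)
      have "u (x + y) \<le> u x + u y" for x y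
      proof -
        have *: "u (x + y) \<le> q x + r y" if qr: "q \<in> C" "r \<in> C" for q r
        proof -
          obtain s where s: "s \<in> C" "s \<le> q" "s \<le> r" using tot[OF qr] qr by blast
          have "u (x + y) \<le> s (x + y)" using uq s by blast
          also have "\<dots> \<le> s x + s y" using s CA unfolding sublinear_def by blast
          also have "\<dots> \<le> q x + r y" using s by (simp add: le_fun_def add_mono)
          finally show ?thesis .
        qed
        have "u (x + y) - r y \<le> u x" if "r \<in> C" for r
          by (rule ug) (use *[OF _ that] in \<open>simp add: algebra_simps\<close>)
        then have "u (x + y) - u x \<le> u y"
          by (intro ug) (simp add: algebra_simps)
        then show ?thesis by simp
      qed
      moreover have "u (c *\<^sub>R x) \<le> c * u x" if "c \<ge> 0" for c x
      proof (cases "c = 0")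
        case True
        obtain q where "q \<in> C" using ne by blast
        then have "u 0 \<le> q 0" "q 0 = 0" using uq CA sublinear_zero by auto
        then show ?thesis using True by simp
      next
        case False
        then have c: "c > 0" using that by simp
        have "u (c *\<^sub>R x) / c \<le> u x"
        proof (rule ug)
          fix q assume q: "q \<in> C"
          have "u (c *\<^sub>R x) \<le> q (c *\<^sub>R x)" using uq q by blast
          also have "\<dots> = c * q x" using sublinear_scale[of q c x] q CA c by auto
          finally show "u (c *\<^sub>R x) / c \<le> q x" using c by (simp add: field_simps)
        qed
        then show ?thesis using c by (simp add: field_simps)
      qed
      ultimately have "sublinear u" unfolding sublinear_def by blast
      moreover obtain q where qC: "q \<in> C" using ne by blast
      then have "q \<le> p" using CA by blast
      moreover have "u \<le> q" using uq[OF qC] by (simp add: le_fun_def)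
      ultimately have "u \<in> ?A" by (auto intro: order_trans)
      then show ?thesis using uq by (auto simp: le_fun_def)
    qed
  qed
  then obtain q where q: "sublinear q" "q \<le> p" and min: "\<And>r. sublinear r \<Longrightarrow> r \<le> p \<Longrightarrow> r \<le> q \<Longrightarrow> r = q" by blast
  have "r = q" if "sublinear r" "r \<le> q" for r
    using min[OF that(1) order_trans[OF that(2) q(2)] that(2)] .
  with q show ?thesis by blast
qed

text \<open>For fixed \<open>y\<close>, the function \<open>r\<close> below is again sublinear and
  lies below \<open>q\<close> (take \<open>t = 0\<close>), so minimality gives \<open>r = q\<close>.
  The competitor \<open>t = 1\<close> in the infimum then yields superadditivity.\<close>

lemma minimal_sublinear_linear:
  assumes q: "sublinear q" and min: "\<And>r. sublinear r \<Longrightarrow> r \<le> q \<Longrightarrow> r = q"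
  shows "linear q"
proof -
  have sup: "q x + q y \<le> q (x + y)" for x y
  proof -
    define r where "r x = (INF t\<in>{0..}. q (x + t *\<^sub>R y) - t * q y)" for x
    have lb: "- q (- x) \<le> q (x + t *\<^sub>R y) - t * q y" if "t \<ge> 0" for x t
    proof -
      have "q ((x + t *\<^sub>R y) + (- x)) \<le> q (x + t *\<^sub>R y) + q (- x)"
        using q unfolding sublinear_def by blast
      then show ?thesis using sublinear_scale[OF q that] by simp
    qed
    have bb: "bdd_below ((\<lambda>t. q (x + t *\<^sub>R y) - t * q y) ` {0..})" for x
      using lb[of _ x] by (intro bdd_belowI2[where m = "- q (- x)"]) auto
    have rq: "r x \<le> q (x + t *\<^sub>R y) - t * q y" if "t \<ge> 0" for x t
      unfolding r_def using bb that by (intro cINF_lower) auto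
    have rg: "b \<le> r x" if "\<And>t. t \<ge> 0 \<Longrightarrow> b \<le> q (x + t *\<^sub>R y) - t * q y" for b x
      unfolding r_def using that by (intro cINF_greatest) auto
    have "r (x + x') \<le> r x + r x'" for x x'
    proof -
      have *: "r (x + x') \<le> (q (x + t *\<^sub>R y) - t * q y) + (q (x' + s *\<^sub>R y) - s * q y)"
        if "t \<ge> 0" "s \<ge> 0" for s t
      proof -
        have "r (x + x') \<le> q ((x + x') + (t + s) *\<^sub>R y) - (t + s) * q y"
          using that by (intro rq) auto
        moreover have "q ((x + x') + (t + s) *\<^sub>R y) = q ((x + t *\<^sub>R y) + (x' + s *\<^sub>R y))"
          by (simp add: algebra_simps)
        moreover have "\<dots> \<le> q (x + t *\<^sub>R y) + q (x' + s *\<^sub>R y)"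
          using q unfolding sublinear_def by blast
        ultimately show ?thesis by (simp add: algebra_simps)
      qed
      have "r (x + x') - (q (x' + s *\<^sub>R y) - s * q y) \<le> r x" if "s \<ge> 0" for s
        by (rule rg) (use *[OF _ that] in \<open>simp add: algebra_simps\<close>)
      then have "r (x + x') - r x \<le> r x'"
        by (intro rg) (simp add: algebra_simps)
      then show ?thesis by simp
    qed
    moreover have "r (c *\<^sub>R x) \<le> c * r x" if "c \<ge> 0" for c x
    proof (cases "c = 0")
      case True
      then show ?thesis using rq[of 0 0] sublinear_zero[OF q] by simp
    next
      case False
      then have c: "c > 0" using that by simp
      have "r (c *\<^sub>R x) / c \<le> r x"
      proof (rule rg)
        fix t :: real assume t: "t \<ge> 0"
        have "r (c *\<^sub>R x) \<le> q (c *\<^sub>R x + (c * t) *\<^sub>R y) - (c * t) * q y"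
          using c t by (intro rq) auto
        also have "c *\<^sub>R x + (c * t) *\<^sub>R y = c *\<^sub>R (x + t *\<^sub>R y)" by (simp add: algebra_simps)
        also have "q \<dots> = c * q (x + t *\<^sub>R y)" using sublinear_scale[OF q that] .
        finally show "r (c *\<^sub>R x) / c \<le> q (x + t *\<^sub>R y) - t * q y" using c by (simp add: field_simps)
      qed
      then show ?thesis using c by (simp add: field_simps)
    qed
    ultimately have "sublinear r" unfolding sublinear_def by blast
    moreover have "r \<le> q" using rq[of 0] by (simp add: le_fun_def)
    ultimately have "r = q" by (rule min)
    then show ?thesis using rq[of 1 x] by simp
  qed
  have add: "q (x + y) = q x + q y" for x y
    using sup[of x y] q unfolding sublinear_def by (simp add: antisym)
  have neg: "q (- x) = - q x" for x
    using add[of x "- x"] sublinear_zero[OF q] by simp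
  show ?thesis
  proof (rule linearI)
    fix c x
    show "q (c *\<^sub>R x) = c *\<^sub>R q x"
    proof (cases "c \<ge> 0")
      case True then show ?thesis using sublinear_scale[OF q] by simp
    next
      case False
      then have "q ((- c) *\<^sub>R x) = (- c) * q x" by (intro sublinear_scale[OF q]) simp
      then show ?thesis using neg[of "c *\<^sub>R x"] by simp
    qed
  qed (rule add)
qed

text \<open>The extension is a minimal sublinear functional below \<open>x \<mapsto> INF s\<in>S. p (x - s) + f s\<close>, which is
  dominated both by \<open>p\<close> and, on \<open>S\<close>, by \<open>f\<close>.\<close>
theorem Hahn_Banach_real:
  fixes p :: "'v::real_vector \<Rightarrow> real"
  assumes p: "sublinear p" and S: "subspace S"
    and fadd: "\<And>x y. x \<in> S \<Longrightarrow> y \<in> S \<Longrightarrow> f (x + y) = f x + f y"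
    and fsc: "\<And>c x. x \<in> S \<Longrightarrow> f (c *\<^sub>R x) = c * f x"
    and fp: "\<And>x. x \<in> S \<Longrightarrow> f x \<le> p x"
  obtains g where "linear g" "\<And>x. g x \<le> p x" "\<And>x. x \<in> S \<Longrightarrow> g x = f x"
proof -
  define p' where "p' x = (INF s\<in>S. p (x - s) + f s)" for x
  have z: "0 \<in> S" using S by (rule subspace_0)
  have f0: "f 0 = 0" using fsc[OF z, of 0] by simp
  have lb: "- p (- x) \<le> p (x - s) + f s" if "s \<in> S" for s x
  proof -
    have "- f s = f (- s)" using fsc[OF that, of "-1"] by simp
    also have "\<dots> \<le> p (- s)" using fp subspace_neg[OF S that] by blast
    also have "- s = (x - s) + (- x)" by simp
    also have "p \<dots> \<le> p (x - s) + p (- x)"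
      using p unfolding sublinear_def by blast
    finally show ?thesis by simp
  qed
  have bb: "bdd_below ((\<lambda>s. p (x - s) + f s) ` S)" for x
    using lb[of _ x] by (intro bdd_belowI2[where m = "- p (- x)"]) auto
  have pq: "p' x \<le> p (x - s) + f s" if "s \<in> S" for x s
    unfolding p'_def using bb that by (intro cINF_lower) auto
  have pg: "b \<le> p' x" if "\<And>s. s \<in> S \<Longrightarrow> b \<le> p (x - s) + f s" for b x
    unfolding p'_def using that z by (intro cINF_greatest) auto
  have "p' (x + y) \<le> p' x + p' y" for x y
  proof -
    have *: "p' (x + y) \<le> (p (x - s) + f s) + (p (y - t) + f t)" if "s \<in> S" "t \<in> S" for s t
    proof -
      have "p' (x + y) \<le> p ((x + y) - (s + t)) + f (s + t)"
        using that S by (intro pq) (simp add: subspace_add)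
      moreover have "(x + y) - (s + t) = (x - s) + (y - t)" by simp
      moreover have "p ((x - s) + (y - t)) \<le> p (x - s) + p (y - t)"
        using p unfolding sublinear_def by blast
      ultimately show ?thesis using fadd[OF that] by simp
    qed
    have "p' (x + y) - (p (y - t) + f t) \<le> p' x" if "t \<in> S" for t
      by (rule pg) (use *[OF _ that] in \<open>simp add: algebra_simps\<close>)
    then have "p' (x + y) - p' x \<le> p' y"
      by (intro pg) (simp add: algebra_simps)
    then show ?thesis by simp
  qed
  moreover have "p' (c *\<^sub>R x) \<le> c * p' x" if "c \<ge> 0" for c x
  proof (cases "c = 0")
    case True
    then show ?thesis using pq[OF z, of 0] sublinear_zero[OF p] f0 by simp
  next
    case False
    then have c: "c > 0" using that by simp
    have "p' (c *\<^sub>R x) / c \<le> p' x"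
    proof (rule pg)
      fix s assume s: "s \<in> S"
      have "p' (c *\<^sub>R x) \<le> p (c *\<^sub>R x - c *\<^sub>R s) + f (c *\<^sub>R s)"
        using s S by (intro pq) (simp add: subspace_scale)
      also have "c *\<^sub>R x - c *\<^sub>R s = c *\<^sub>R (x - s)" by (simp add: algebra_simps)
      also have "p \<dots> = c * p (x - s)" using sublinear_scale[OF p that] .
      finally show "p' (c *\<^sub>R x) / c \<le> p (x - s) + f s" using c fsc[OF s] by (simp add: field_simps)
    qed
    then show ?thesis using c by (simp add: field_simps)
  qed
  ultimately have "sublinear p'" unfolding sublinear_def by blast
  then obtain g where g: "sublinear g" "g \<le> p'" "\<And>r. sublinear r \<Longrightarrow> r \<le> g \<Longrightarrow> r = g"
    using minimal_sublinear_exists by blast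
  have lin: "linear g" using minimal_sublinear_linear g(1,3) by blast
  have gp: "g x \<le> p x" for x
    using order_trans[OF le_funD[OF g(2), of x] pq[OF z, of x]] f0 by simp
  have gf: "g x \<le> f x" if "x \<in> S" for x
    using order_trans[OF le_funD[OF g(2), of x] pq[OF that, of x]] sublinear_zero[OF p] by simp
  have "g x = f x" if "x \<in> S" for x
  proof -
    have "g (- x) \<le> f (- x)" using gf subspace_neg[OF S that] by blast
    then have "f x \<le> g x" using fsc[OF that, of "-1"] linear_neg[OF lin, of x] by simp
    then show ?thesis using gf[OF that] by simp
  qed
  then show thesis using that lin gp by blast
qed

text \<open>The real part of \<open>f\<close> is extended to a real functional \<open>g\<close>, and
  \<open>F x = g x - \<i> * g (\<i> x)\<close> is the only complex-linear functional with real part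
  \<open>g\<close>. Complex multiplication is the parameter \<open>sc\<close>, tied to the real
  vector space by \<open>sc_real\<close>.\<close>

theorem Hahn_Banach_complex:
  fixes sc :: "complex \<Rightarrow> 'v::real_normed_vector \<Rightarrow> 'v"
  assumes vs: "vector_space sc"
    and sc_real: "\<And>r x. sc (complex_of_real r) x = r *\<^sub>R x"
    and sc_norm: "\<And>c x. norm (sc c x) = cmod c * norm x"
    and S0: "0 \<in> S" and Sadd: "\<And>x y. x \<in> S \<Longrightarrow> y \<in> S \<Longrightarrow> x + y \<in> S"
    and Ssc: "\<And>c x. x \<in> S \<Longrightarrow> sc c x \<in> S"
    and fadd: "\<And>x y. x \<in> S \<Longrightarrow> y \<in> S \<Longrightarrow> f (x + y) = f x + f y"
    and fsc: "\<And>c x. x \<in> S \<Longrightarrow> f (sc c x) = c * f x"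
    and C: "C \<ge> 0" and fC: "\<And>x. x \<in> S \<Longrightarrow> cmod (f x) \<le> C * norm x"
  obtains F where "\<And>x y. F (x + y) = F x + F y" "\<And>c x. F (sc c x) = c * F x"
    "\<And>x. cmod (F x) \<le> C * norm x" "\<And>x. x \<in> S \<Longrightarrow> F x = f x"
proof -
  interpret vector_space sc by (rule vs)
  have "sublinear (\<lambda>x::'v. C * norm x)"
    unfolding sublinear_def using C
    by (auto simp: mult.left_commute distrib_left[symmetric] intro!: mult_left_mono norm_triangle_ineq)
  moreover have "Real_Vector_Spaces.subspace S"
    using S0 Sadd Ssc sc_real by (intro Real_Vector_Spaces.subspaceI) metis+
  moreover have "Re (f (x + y)) = Re (f x) + Re (f y)" if "x \<in> S" "y \<in> S" for x y
    using fadd[OF that] by simp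
  moreover have "Re (f (r *\<^sub>R x)) = r * Re (f x)" if "x \<in> S" for r x
    using fsc[OF that, of "complex_of_real r"] sc_real by simp
  moreover have "Re (f x) \<le> C * norm x" if "x \<in> S" for x
    using fC[OF that] complex_Re_le_cmod[of "f x"] by linarith
  ultimately obtain g where g: "linear g" "\<And>x. g x \<le> C * norm x" "\<And>x. x \<in> S \<Longrightarrow> g x = Re (f x)"
    using Hahn_Banach_real[of "\<lambda>x. C * norm x" S "\<lambda>x. Re (f x)"] by blast
  define F where "F x = Complex (g x) (- g (sc \<i> x))" for x
  have add: "F (x + y) = F x + F y" for x y
    by (simp add: F_def linear_add[OF g(1)] scale_right_distrib complex_eq_iff)
  have gr: "g (r *\<^sub>R x) = r * g x" for r x
    using linear_scale[OF g(1)] by simp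
  have sc: "F (sc c x) = c * F x" for c x
  proof -
    have c: "c = complex_of_real (Re c) + complex_of_real (Im c) * \<i>"
      by (simp add: complex_eq_iff)
    have 1: "g (sc c x) = Re c * g x + Im c * g (sc \<i> x)"
      by (subst c, subst scale_left_distrib, subst scale_scale[symmetric], subst sc_real, subst sc_real)
        (simp add: linear_add[OF g(1)] gr)
    have ic: "\<i> * c = complex_of_real (Re c) * \<i> + complex_of_real (- Im c)"
      by (simp add: complex_eq_iff)
    have 2: "g (sc (\<i> * c) x) = - Im c * g x + Re c * g (sc \<i> x)"
      by (subst ic, subst scale_left_distrib, subst scale_scale[symmetric], subst sc_real, subst sc_real)
         (simp add: linear_add[OF g(1)] linear_diff[OF g(1)] gr)
    show ?thesis unfolding F_def scale_scale 1 2 by (simp add: complex_eq_iff)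
  qed
  have bd: "cmod (F x) \<le> C * norm x" for x
  proof (cases "F x = 0")
    case True then show ?thesis using C by simp
  next
    case False
    \<comment> \<open>Multiplying by this phase makes the value of \<open>F\<close> real and
      nonnegative, so the bound on the real part \<open>g\<close> bounds the modulus with the same
      constant.\<close>
    define u where "u = cnj (sgn (F x))"
    have "u * F x = cmod (F x)"
      by (simp add: u_def complex_eq_iff sgn_eq cmod_def power2_eq_square add_divide_distrib[symmetric] real_div_sqrt)
    then have "cmod (F x) = Re (F (sc u x))" by (simp add: sc)
    also have "\<dots> \<le> C * norm (sc u x)" unfolding F_def using g(2) by simp
    also have "\<dots> = C * norm x" using False by (simp add: sc_norm u_def norm_sgn)
    finally show ?thesis .
  qed
  have "F x = f x" if x: "x \<in> S" for x
    using g(3)[OF x] g(3)[OF Ssc[OF x, of \<i>]] fsc[OF x, of \<i>] by (simp add: F_def complex_eq_iff)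
  then show thesis using that[of F] add sc bd by blast
qed

section \<open>Bounded infinite matrices\<close>

text \<open>Bilinear instead of sesquilinear: conjugating \<open>b\<close> does not change its norm,
  so the bounds are the same, and transposing the matrix merely swaps the arguments.\<close>

definition bform :: "nat \<Rightarrow> (nat \<Rightarrow> nat \<Rightarrow> complex) \<Rightarrow> (nat \<Rightarrow> complex) \<Rightarrow> (nat \<Rightarrow> complex) \<Rightarrow> complex" where
  "bform k A a b = (\<Sum>i<k. \<Sum>j<k. a i * b j * A i j)"

abbreviation sn :: "nat \<Rightarrow> (nat \<Rightarrow> complex) \<Rightarrow> real" where
  "sn k a \<equiv> L2_set (\<lambda>i. cmod (a i)) {..<k}"

definition mbd :: "(nat \<Rightarrow> nat \<Rightarrow> complex) \<Rightarrow> real \<Rightarrow> bool" where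
  "mbd A C \<longleftrightarrow> 0 \<le> C \<and> (\<forall>k a b. cmod (bform k A a b) \<le> C * sn k a * sn k b)"

lemma mbdD: "mbd A C \<Longrightarrow> cmod (bform k A a b) \<le> C * sn k a * sn k b"
  and mbd_nonneg: "mbd A C \<Longrightarrow> 0 \<le> C"
  by (simp_all add: mbd_def)

lemma mbd_add: assumes "mbd A C" "mbd B D" shows "mbd (\<lambda>i j. A i j + B i j) (C + D)"
  unfolding mbd_def
proof (intro conjI allI)
  show "0 \<le> C + D" using assms by (simp add: mbd_def)
  fix k a b
  have "bform k (\<lambda>i j. A i j + B i j) a b = bform k A a b + bform k B a b"
    by (simp add: bform_def distrib_left sum.distrib)
  then have "cmod (bform k (\<lambda>i j. A i j + B i j) a b) \<le> C * sn k a * sn k b + D * sn k a * sn k b"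
    using norm_triangle_le[OF add_mono[OF mbdD[OF assms(1)] mbdD[OF assms(2)]]] by simp
  then show "cmod (bform k (\<lambda>i j. A i j + B i j) a b) \<le> (C + D) * sn k a * sn k b"
    by (simp add: algebra_simps)
qed

lemma mbd_scale: assumes "mbd A C" shows "mbd (\<lambda>i j. c * A i j) (cmod c * C)"
  unfolding mbd_def
proof (intro conjI allI)
  show "0 \<le> cmod c * C" using assms by (simp add: mbd_def)
  fix k a b
  have "bform k (\<lambda>i j. c * A i j) a b = c * bform k A a b"
    by (simp add: bform_def sum_distrib_left mult_ac)
  then show "cmod (bform k (\<lambda>i j. c * A i j) a b) \<le> cmod c * C * sn k a * sn k b"
    using mult_left_mono[OF mbdD[OF assms, of k a b], of "cmod c"] by (simp add: norm_mult mult_ac)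
qed

lemma mbd_zero: "mbd (\<lambda>i j. 0) 0"
  by (simp add: mbd_def bform_def)

lemma sn_weight_le:
  assumes "\<And>i. cmod (d i) \<le> D" "0 \<le> D" shows "sn k (\<lambda>i. d i * a i) \<le> D * sn k a"
proof -
  have "sn k (\<lambda>i. d i * a i) \<le> L2_set (\<lambda>i. D * cmod (a i)) {..<k}"
    by (intro L2_set_mono) (auto simp: norm_mult intro: mult_right_mono assms)
  then show ?thesis by (simp add: L2_set_right_distrib[OF assms(2)])
qed

text \<open>The weights move from the matrix onto the two arguments of the form, whose norms grow at
  most by the factors \<open>D\<close> and \<open>E\<close>.\<close>

lemma mbd_weight:
  assumes A: "mbd A C" and d: "\<And>i. cmod (d i) \<le> D" "0 \<le> D" and e: "\<And>i. cmod (e i) \<le> E" "0 \<le> E"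
  shows "mbd (\<lambda>i j. d i * e j * A i j) (D * E * C)"
  unfolding mbd_def
proof (intro conjI allI)
  show "0 \<le> D * E * C" using assms by (simp add: mbd_def)
  fix k a b
  have "bform k (\<lambda>i j. d i * e j * A i j) a b = bform k A (\<lambda>i. d i * a i) (\<lambda>j. e j * b j)"
    by (simp add: bform_def mult_ac)
  then have "cmod (bform k (\<lambda>i j. d i * e j * A i j) a b)
      \<le> C * sn k (\<lambda>i. d i * a i) * sn k (\<lambda>j. e j * b j)"
    using mbdD[OF A] by simp
  also have "\<dots> \<le> C * (D * sn k a) * (E * sn k b)"
    using mbd_nonneg[OF A] d e by (intro mult_mono sn_weight_le mult_nonneg_nonneg) auto
  finally show "cmod (bform k (\<lambda>i j. d i * e j * A i j) a b) \<le> D * E * C * sn k a * sn k b"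
    by (simp add: mult_ac)
qed

lemma mbd_transpose: assumes "mbd A C" shows "mbd (\<lambda>i j. A j i) C"
proof -
  have "bform k (\<lambda>i j. A j i) a b = bform k A b a" for k a b
    unfolding bform_def by (subst sum.swap) (simp add: mult_ac)
  moreover have "cmod (bform k A b a) \<le> C * sn k a * sn k b" for k a b
    using mbdD[OF assms, of k b a] by (simp only: mult_ac)
  ultimately show ?thesis using mbd_nonneg[OF assms] unfolding mbd_def by simp
qed

lemma mbd_entry: assumes "mbd A C" shows "cmod (A i j) \<le> C"
proof -
  define k where "k = Suc (max i j)"
  define a b where "a = (\<lambda>n. if n = i then 1 else 0 :: complex)" and "b = (\<lambda>n. if n = j then 1 else 0 :: complex)"
  have ik: "i < k" "j < k" by (auto simp: k_def)
  have "bform k A a b = (\<Sum>i'<k. if i' = i then (\<Sum>j'<k. if j' = j then A i j' else 0) else 0)"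
    unfolding bform_def a_def b_def
    by (rule sum.cong[OF refl]) (auto intro: sum.cong simp: if_distrib[of "\<lambda>x. x * _"] cong: if_cong)
  also have "\<dots> = A i j" using ik by simp
  finally have 1: "bform k A a b = A i j" .
  have sn1: "sn k (\<lambda>n. if n = m then 1 else 0 :: complex) = 1" if "m < k" for m
  proof -
    have "(\<Sum>n<k. (cmod (if n = m then 1 else 0 :: complex))\<^sup>2) = (\<Sum>n<k. if n = m then 1 else 0)"
      by (intro sum.cong) auto
    then show ?thesis using that by (simp add: L2_set_def)
  qed
  show ?thesis using mbdD[OF assms, of k a b] sn1 ik unfolding 1 by (simp add: a_def b_def)
qed

section \<open>The normed space of bounded matrices\<close>

typedef bmat = "{A. \<exists>C. mbd A C}" morphisms ent Abs_bmat
  using mbd_zero by blast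

setup_lifting type_definition_bmat

instantiation bmat :: real_normed_vector
begin

lift_definition zero_bmat :: bmat is "\<lambda>i j. 0" using mbd_zero by blast
lift_definition plus_bmat :: "bmat \<Rightarrow> bmat \<Rightarrow> bmat" is "\<lambda>A B i j. A i j + B i j"
  using mbd_add by blast
lift_definition uminus_bmat :: "bmat \<Rightarrow> bmat" is "\<lambda>A i j. - A i j"
  using mbd_scale[where c = "-1"] by fastforce
lift_definition minus_bmat :: "bmat \<Rightarrow> bmat \<Rightarrow> bmat" is "\<lambda>A B i j. A i j - B i j"
  using mbd_add mbd_scale[where c = "-1"] by fastforce
lift_definition scaleR_bmat :: "real \<Rightarrow> bmat \<Rightarrow> bmat" is "\<lambda>r A i j. complex_of_real r * A i j"
  using mbd_scale by blast
lift_definition norm_bmat :: "bmat \<Rightarrow> real" is "\<lambda>A. Inf {C. mbd A C}" .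

definition dist_bmat :: "bmat \<Rightarrow> bmat \<Rightarrow> real" where "dist_bmat A B = norm (A - B)"
definition sgn_bmat :: "bmat \<Rightarrow> bmat" where "sgn_bmat A = inverse (norm A) *\<^sub>R A"
definition [code del]: "(uniformity :: (bmat \<times> bmat) filter) = (INF e\<in>{0 <..}. principal {(x, y). dist x y < e})"
definition open_bmat :: "bmat set \<Rightarrow> bool" where
  "open_bmat U \<longleftrightarrow> (\<forall>x\<in>U. \<forall>\<^sub>F (x', y) in uniformity. x' = x \<longrightarrow> y \<in> U)"

lemma norm_bmat_le: "mbd (ent A) C \<Longrightarrow> norm A \<le> C"
  unfolding norm_bmat.rep_eq by (rule cInf_lower) (auto intro!: bdd_belowI[of _ 0] simp: mbd_def)

lemma norm_bmat_nonneg: "0 \<le> norm (A::bmat)"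
  unfolding norm_bmat.rep_eq using ent[of A] by (intro cInf_greatest) (auto simp: mbd_def)

text \<open>The infimum of all bounds is itself a bound, since for fixed \<open>k\<close>,
  \<open>a\<close>, \<open>b\<close> the condition on \<open>C\<close> is a closed one.\<close>

lemma mbd_norm: "mbd (ent A) (norm A)"
  unfolding mbd_def
proof (intro conjI allI norm_bmat_nonneg)
  fix k a b
  show "cmod (bform k (ent A) a b) \<le> norm A * sn k a * sn k b"
  proof (cases "sn k a * sn k b = 0")
    \<comment> \<open>Dividing by the product of the norms is impossible here, but any bound
      \<open>C\<close> already forces the form to vanish.\<close>
    case True
    obtain C where "mbd (ent A) C" using ent[of A] by blast
    then have "cmod (bform k (ent A) a b) \<le> C * (sn k a * sn k b)" unfolding mbd_def by (simp add: mult.assoc)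
    then have "cmod (bform k (ent A) a b) \<le> 0" unfolding True by simp
    moreover have "0 \<le> norm A * sn k a * sn k b"
      by (intro mult_nonneg_nonneg norm_bmat_nonneg L2_set_nonneg)
    ultimately show ?thesis by linarith
  next
    case False
    then have pos: "sn k a * sn k b > 0" by (simp add: less_le)
    have "cmod (bform k (ent A) a b) / (sn k a * sn k b) \<le> norm A"
      unfolding norm_bmat.rep_eq
    proof (rule cInf_greatest)
      show "{C. mbd (ent A) C} \<noteq> {}" using ent[of A] by blast
      fix C assume "C \<in> {C. mbd (ent A) C}"
      then have "cmod (bform k (ent A) a b) \<le> C * (sn k a * sn k b)" unfolding mbd_def by (simp add: mult.assoc)
      then show "cmod (bform k (ent A) a b) / (sn k a * sn k b) \<le> C" using pos by (simp add: pos_divide_le_eq)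
    qed
    then show ?thesis using pos by (simp add: pos_divide_le_eq mult.assoc)
  qed
qed

lemma ent_inject_iff: "A = B \<longleftrightarrow> (\<forall>i j. ent A i j = ent B i j)"
  by (metis ent_inject ext)

instance
proof
  fix A B C :: bmat and r s :: real
  show "A + B + C = A + (B + C)" by transfer (simp add: add.assoc)
  show "A + B = B + A" by transfer (simp add: add.commute)
  show "0 + A = A" by transfer simp
  show "- A + A = 0" by transfer simp
  show "A - B = A + - B" by transfer simp
  show "r *\<^sub>R (A + B) = r *\<^sub>R A + r *\<^sub>R B" by transfer (simp add: distrib_left)
  show "(r + s) *\<^sub>R A = r *\<^sub>R A + s *\<^sub>R A" by transfer (simp add: distrib_right)
  show "r *\<^sub>R s *\<^sub>R A = (r * s) *\<^sub>R A" by transfer (simp add: mult.assoc)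
  show "1 *\<^sub>R A = A" by transfer simp
  show "dist A B = norm (A - B)" by (rule dist_bmat_def)
  show "sgn A = inverse (norm A) *\<^sub>R A" by (rule sgn_bmat_def)
  show "uniformity = (INF e\<in>{0 <..}. principal {(x, y). dist (x::bmat) y < e})" by (rule uniformity_bmat_def)
  show "open U \<longleftrightarrow> (\<forall>x\<in>U. \<forall>\<^sub>F (x', y) in uniformity. x' = x \<longrightarrow> y \<in> U)" for U :: "bmat set"
    by (rule open_bmat_def)
  show "norm A = 0 \<longleftrightarrow> A = 0"
  proof
    assume "norm A = 0"
    then show "A = 0" using mbd_entry[OF mbd_norm, of A] by (auto simp: ent_inject_iff zero_bmat.rep_eq)
  next
    assume "A = 0"
    then have "mbd (ent A) 0" using mbd_zero by (simp add: zero_bmat.rep_eq)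
    then show "norm A = 0" using norm_bmat_le norm_bmat_nonneg by (metis antisym)
  qed
  show "norm (A + B) \<le> norm A + norm B"
    by (rule norm_bmat_le) (simp add: plus_bmat.rep_eq mbd_add mbd_norm)
  have le: "norm (r *\<^sub>R A) \<le> \<bar>r\<bar> * norm A" for r and A :: bmat
    by (rule norm_bmat_le) (use mbd_scale[OF mbd_norm, where c = "complex_of_real r"] in \<open>simp add: scaleR_bmat.rep_eq\<close>)
  show "norm (r *\<^sub>R A) = \<bar>r\<bar> * norm A"
  proof (cases "r = 0")
    case True
    then show ?thesis using le[of r A] norm_bmat_nonneg[of "r *\<^sub>R A"] by simp
  next
    case False
    have "inverse r *\<^sub>R r *\<^sub>R A = A" using False by transfer (simp add: mult.assoc[symmetric] of_real_mult[symmetric] del: of_real_mult)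
    then have "norm A \<le> \<bar>inverse r\<bar> * norm (r *\<^sub>R A)" using le[of "inverse r" "r *\<^sub>R A"] by simp
    then show ?thesis using le[of r A] False by (simp add: field_simps)
  qed
qed

end

text \<open>Kept apart from \<open>scaleR\<close> so that it can serve as the parameter
  \<open>sc\<close> of the complex Hahn-Banach theorem.\<close>

lift_definition cs :: "complex \<Rightarrow> bmat \<Rightarrow> bmat" is "\<lambda>c A i j. c * A i j"
  using mbd_scale by blast

lift_definition transp :: "bmat \<Rightarrow> bmat" is "\<lambda>A i j. A j i"
  using mbd_transpose by blast

text \<open>Weights of modulus greater than one give the zero matrix; they never occur.\<close>
lift_definition wt :: "(nat \<Rightarrow> complex) \<Rightarrow> (nat \<Rightarrow> complex) \<Rightarrow> bmat \<Rightarrow> bmat" is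
  "\<lambda>d e A i j. if (\<forall>i. cmod (d i) \<le> 1) \<and> (\<forall>i. cmod (e i) \<le> 1) then d i * e j * A i j else 0"
proof -
  fix d e and A :: "nat \<Rightarrow> nat \<Rightarrow> complex"
  assume "\<exists>C. mbd A C"
  then obtain C where C: "mbd A C" by blast
  show "\<exists>C. mbd (\<lambda>i j. if (\<forall>i. cmod (d i) \<le> 1) \<and> (\<forall>i. cmod (e i) \<le> 1) then d i * e j * A i j else 0) C"
  proof (cases "(\<forall>i. cmod (d i) \<le> 1) \<and> (\<forall>i. cmod (e i) \<le> 1)")
    case True
    then show ?thesis using mbd_weight[OF C, of d 1 e 1] by auto
  next
    case False
    then have "(\<lambda>i j. if (\<forall>i. cmod (d i) \<le> 1) \<and> (\<forall>i. cmod (e i) \<le> 1) then d i * e j * A i j else 0)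
        = (\<lambda>i j. 0)" by (intro ext if_not_P)
    then show ?thesis using mbd_zero by metis
  qed
qed

lemmas ent_simps [simp] = zero_bmat.rep_eq plus_bmat.rep_eq uminus_bmat.rep_eq minus_bmat.rep_eq
  scaleR_bmat.rep_eq cs.rep_eq transp.rep_eq

lemma bmat_eqI: "(\<And>i j. ent A i j = ent B i j) \<Longrightarrow> A = B"
  using ent_inject_iff by blast

lemma ent_le_norm: "cmod (ent A i j) \<le> norm A"
  using mbd_entry[OF mbd_norm] .

lemma bform_le_norm: "cmod (bform k (ent A) a b) \<le> norm A * sn k a * sn k b"
  using mbdD[OF mbd_norm] .

lemma norm_bmatI:
  assumes "0 \<le> C" "\<And>k a b. cmod (bform k (ent A) a b) \<le> C * sn k a * sn k b" shows "norm A \<le> C"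
  using norm_bmat_le assms unfolding mbd_def by blast

lemma vector_space_cs: "vector_space cs"
  by (rule vector_space.intro) (auto intro!: bmat_eqI simp: algebra_simps)

lemma cs_of_real: "cs (complex_of_real r) A = r *\<^sub>R A"
  by (rule bmat_eqI) simp

lemma norm_cs: "norm (cs c A) = cmod c * norm A"
proof -
  have le: "norm (cs c A) \<le> cmod c * norm A" for c A
    by (rule norm_bmat_le) (simp add: mbd_scale mbd_norm)
  show ?thesis
  proof (cases "c = 0")
    case True then show ?thesis using le[of c A] by simp
  next
    case False
    have "cs (inverse c) (cs c A) = A" using False by (intro bmat_eqI) (simp add: field_simps)
    then have "norm A \<le> cmod (inverse c) * norm (cs c A)" using le[of "inverse c" "cs c A"] by simp
    then show ?thesis using le[of c A] False by (simp add: norm_inverse norm_divide field_simps)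
  qed
qed

lemma norm_transp: "norm (transp A) = norm A"
proof -
  have le: "norm (transp A) \<le> norm A" for A
    by (rule norm_bmat_le) (simp add: mbd_transpose mbd_norm)
  have "transp (transp A) = A" by (rule bmat_eqI) simp
  then show ?thesis using le[of A] le[of "transp A"] by simp
qed

section \<open>Weighted matrices and coordinate blocks\<close>

lemma ent_wt:
  assumes "\<And>i. cmod (d i) \<le> 1" "\<And>i. cmod (e i) \<le> 1"
  shows "ent (wt d e A) i j = d i * e j * ent A i j"
  using assms by (simp add: wt.rep_eq)

lemma norm_wt_le:
  assumes "\<And>i. cmod (d i) \<le> 1" "\<And>i. cmod (e i) \<le> 1"
  shows "norm (wt d e A) \<le> norm A"
proof (rule norm_bmat_le)
  have "ent (wt d e A) = (\<lambda>i j. d i * e j * ent A i j)" by (intro ext ent_wt assms)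
  then show "mbd (ent (wt d e A)) (norm A)" using mbd_weight[OF mbd_norm, of d 1 e 1 A] assms by simp
qed

definition cut :: "nat set \<Rightarrow> nat set \<Rightarrow> bmat \<Rightarrow> bmat" where
  "cut I J = wt (indicator I) (indicator J)"

abbreviation sec :: "nat \<Rightarrow> bmat \<Rightarrow> bmat" where
  "sec n \<equiv> cut {..<n} {..<n}"

lemma ent_cut [simp]: "ent (cut I J A) i j = (if i \<in> I \<and> j \<in> J then ent A i j else 0)"
  unfolding cut_def by (subst ent_wt) (auto simp: indicator_def)

lemma norm_cut_le: "norm (cut I J A) \<le> norm A"
  unfolding cut_def by (rule norm_wt_le) (auto simp: indicator_def)

lemma cut_add: "cut I J (A + B) = cut I J A + cut I J B"
  and cut_diff: "cut I J (A - B) = cut I J A - cut I J B"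
  and cut_cs: "cut I J (cs c A) = cs c (cut I J A)"
  and cut_cut: "cut I J (cut K L A) = cut (I \<inter> K) (J \<inter> L) A"
  and transp_cut: "transp (cut I J A) = cut J I (transp A)"
  by (rule bmat_eqI, auto)+

lemma sn_disjoint:
  assumes "I \<inter> J = {}"
  shows "(sn k (\<lambda>i. indicator I i * a i))\<^sup>2 + (sn k (\<lambda>i. indicator J i * a i))\<^sup>2 \<le> (sn k a)\<^sup>2"
proof -
  have "(\<Sum>i<k. (cmod (indicator I i * a i))\<^sup>2) + (\<Sum>i<k. (cmod (indicator J i * a i))\<^sup>2) \<le> (\<Sum>i<k. (cmod (a i))\<^sup>2)"
    unfolding sum.distrib[symmetric] using assms by (intro sum_mono) (auto simp: indicator_def)
  then show ?thesis by (simp add: L2_set_def sum_nonneg)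
qed

lemma bform_cut: "bform k (ent (cut I J A)) a b = bform k (ent A) (\<lambda>i. indicator I i * a i) (\<lambda>i. indicator J i * b i)"
  unfolding bform_def by (auto intro!: sum.cong simp: indicator_def)

lemma bform_add: "bform k (ent (A + B)) a b = bform k (ent A) a b + bform k (ent B) a b"
  by (simp add: bform_def distrib_left sum.distrib)

lemma two_term_Cauchy_Schwarz: "x * s + y * t \<le> sqrt (x\<^sup>2 + y\<^sup>2) * sqrt (s\<^sup>2 + t\<^sup>2)" for x y s t :: real
proof -
  have "(x * s + y * t)\<^sup>2 \<le> (x\<^sup>2 + y\<^sup>2) * (s\<^sup>2 + t\<^sup>2)"
    using zero_le_power2[of "x * t - y * s"] by (simp add: power2_eq_square algebra_simps)
  then show ?thesis using real_le_rsqrt by (simp add: real_sqrt_mult[symmetric])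
qed

text \<open>The two summands see orthogonal parts of \<open>a\<close>, so Cauchy-Schwarz in the
  plane applies. By this estimate a sum of \<open>n\<close> humps has norm at most
  \<open>sqrt n\<close>.\<close>

lemma norm_disjoint_rows:
  assumes "I \<inter> J = {}"
  shows "(norm (cut I UNIV A + cut J UNIV B))\<^sup>2 \<le> (norm A)\<^sup>2 + (norm B)\<^sup>2"
proof -
  have "norm (cut I UNIV A + cut J UNIV B) \<le> sqrt ((norm A)\<^sup>2 + (norm B)\<^sup>2)"
  proof (rule norm_bmatI)
    fix k and a b :: "nat \<Rightarrow> complex"
    define a1 a2 where "a1 = (\<lambda>i. indicator I i * a i)" and "a2 = (\<lambda>i. indicator J i * a i)"
    have "bform k (ent (cut I UNIV A + cut J UNIV B)) a b = bform k (ent A) a1 b + bform k (ent B) a2 b"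
      by (simp add: bform_add bform_cut a1_def a2_def del: ent_simps ent_cut)
    then have "cmod (bform k (ent (cut I UNIV A + cut J UNIV B)) a b)
        \<le> norm A * sn k a1 * sn k b + norm B * sn k a2 * sn k b"
      using norm_triangle_le[OF add_mono[OF bform_le_norm bform_le_norm]] by simp
    also have "\<dots> = (norm A * sn k a1 + norm B * sn k a2) * sn k b" by (simp add: distrib_right)
    also have "\<dots> \<le> (sqrt ((norm A)\<^sup>2 + (norm B)\<^sup>2) * sqrt ((sn k a1)\<^sup>2 + (sn k a2)\<^sup>2)) * sn k b"
      by (intro mult_right_mono two_term_Cauchy_Schwarz) simp
    also have "\<dots> \<le> (sqrt ((norm A)\<^sup>2 + (norm B)\<^sup>2) * sn k a) * sn k b"
      using sn_disjoint[OF assms, where k = k and a = a] unfolding a1_def a2_def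
      by (intro mult_right_mono mult_left_mono real_le_lsqrt) auto
    finally show "cmod (bform k (ent (cut I UNIV A + cut J UNIV B)) a b)
        \<le> sqrt ((norm A)\<^sup>2 + (norm B)\<^sup>2) * sn k a * sn k b" .
  qed simp
  then have "(norm (cut I UNIV A + cut J UNIV B))\<^sup>2 \<le> (sqrt ((norm A)\<^sup>2 + (norm B)\<^sup>2))\<^sup>2"
    by (rule power_mono) simp
  then show ?thesis by simp
qed

text \<open>Here both arguments split orthogonally, so the norm of a block diagonal matrix is
  controlled by the larger block and not by the sum. This makes the test matrices for the additivity
  of norms have norm at most 1.\<close>

lemma norm_disjoint_blocks:
  assumes "I \<inter> J = {}" "norm A \<le> M" "norm B \<le> M"
  shows "norm (cut I I A + cut J J B) \<le> M"
proof (rule norm_bmatI)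
  show M: "0 \<le> M" using assms(2) norm_ge_zero order_trans by blast
  fix k and a b :: "nat \<Rightarrow> complex"
  define a1 a2 where "a1 = (\<lambda>i. indicator I i * a i)" and "a2 = (\<lambda>i. indicator J i * a i)"
  define b1 b2 where "b1 = (\<lambda>i. indicator I i * b i)" and "b2 = (\<lambda>i. indicator J i * b i)"
  have "bform k (ent (cut I I A + cut J J B)) a b = bform k (ent A) a1 b1 + bform k (ent B) a2 b2"
    by (simp add: bform_add bform_cut a1_def a2_def b1_def b2_def del: ent_simps ent_cut)
  then have "cmod (bform k (ent (cut I I A + cut J J B)) a b)
      \<le> norm A * sn k a1 * sn k b1 + norm B * sn k a2 * sn k b2"
    using norm_triangle_le[OF add_mono[OF bform_le_norm bform_le_norm]] by simp
  also have "\<dots> \<le> M * sn k a1 * sn k b1 + M * sn k a2 * sn k b2"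
    using assms by (intro add_mono mult_right_mono) auto
  also have "\<dots> = M * (sn k a1 * sn k b1 + sn k a2 * sn k b2)" by (simp add: algebra_simps)
  also have "\<dots> \<le> M * (sqrt ((sn k a1)\<^sup>2 + (sn k a2)\<^sup>2) * sqrt ((sn k b1)\<^sup>2 + (sn k b2)\<^sup>2))"
    by (intro mult_left_mono two_term_Cauchy_Schwarz M)
  also have "\<dots> \<le> M * (sn k a * sn k b)"
    using sn_disjoint[OF assms(1), where k = k and a = a] sn_disjoint[OF assms(1), where k = k and a = b] M
    unfolding a1_def a2_def b1_def b2_def
    by (intro mult_left_mono mult_mono real_le_lsqrt) auto
  finally show "cmod (bform k (ent (cut I I A + cut J J B)) a b) \<le> M * sn k a * sn k b"
    by (simp add: mult.assoc)
qed

text \<open>The norm closure of the finite matrices, that is, the matrices of compact operators. For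
  Hankel matrices the equivalence with \<open>compact_op\<close> is proved further down.\<close>

definition cpt :: "bmat \<Rightarrow> bool" where
  "cpt A \<longleftrightarrow> (\<lambda>n. norm (A - sec n A)) \<longlonglongrightarrow> 0"

lemma norm_null_comparison:
  assumes "\<And>n. norm (X n) \<le> g n" "g \<longlonglongrightarrow> 0" shows "(\<lambda>n. norm (X n)) \<longlonglongrightarrow> 0"
  by (rule Lim_null_comparison[OF always_eventually assms(2)]) (use assms(1) in simp)

text \<open>A crude bound, sufficient to pass from entrywise convergence to norm convergence on a
  section of fixed size.\<close>

lemma norm_sec_le_sum: "norm (sec n A) \<le> (\<Sum>i<n. \<Sum>j<n. cmod (ent A i j))"
proof (rule norm_bmatI)
  show "0 \<le> (\<Sum>i<n. \<Sum>j<n. cmod (ent A i j))" by (intro sum_nonneg) simp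
  fix k and a b :: "nat \<Rightarrow> complex"
  have s: "cmod (a i) \<le> sn k a" if "i < k" for i a
    using member_le_L2_set[of "{..<k}" i "\<lambda>i. cmod (a i)"] that by simp
  have "cmod (bform k (ent (sec n A)) a b) \<le> (\<Sum>i<k. \<Sum>j<k. cmod (a i * b j * ent (sec n A) i j))"
    unfolding bform_def by (intro order_trans[OF norm_sum] sum_mono norm_sum)
  also have "\<dots> \<le> (\<Sum>i<k. \<Sum>j<k. sn k a * sn k b * cmod (ent (sec n A) i j))"
    unfolding norm_mult by (intro sum_mono mult_right_mono mult_mono s) auto
  also have "\<dots> = sn k a * sn k b * (\<Sum>i<k. \<Sum>j<k. cmod (ent (sec n A) i j))"
    by (simp only: sum_distrib_left)
  also have "\<dots> \<le> sn k a * sn k b * (\<Sum>i<n. \<Sum>j<n. cmod (ent A i j))"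
  proof (rule mult_left_mono)
    \<comment> \<open>No order between \<open>k\<close> and \<open>n\<close> is known, so the sums
      are compared over the intersection of the two squares.\<close>
    have "(\<Sum>i<k. \<Sum>j<k. cmod (ent (sec n A) i j)) = (\<Sum>(i,j)\<in>{..<k}\<times>{..<k}. cmod (ent (sec n A) i j))"
      by (rule sum.cartesian_product)
    also have "\<dots> = (\<Sum>(i,j)\<in>({..<k}\<times>{..<k}) \<inter> ({..<n}\<times>{..<n}). cmod (ent (sec n A) i j))"
      by (rule sum.mono_neutral_right) (auto split: if_splits)
    also have "\<dots> \<le> (\<Sum>(i,j)\<in>{..<n}\<times>{..<n}. cmod (ent (sec n A) i j))"
      by (rule sum_mono2) auto
    also have "\<dots> = (\<Sum>i<n. \<Sum>j<n. cmod (ent (sec n A) i j))"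
      by (rule sum.cartesian_product[symmetric])
    also have "\<dots> = (\<Sum>i<n. \<Sum>j<n. cmod (ent A i j))"
      by (intro sum.cong) auto
    finally show "(\<Sum>i<k. \<Sum>j<k. cmod (ent (sec n A) i j)) \<le> (\<Sum>i<n. \<Sum>j<n. cmod (ent A i j))" .
  qed simp
  finally show "cmod (bform k (ent (sec n A)) a b) \<le> (\<Sum>i<n. \<Sum>j<n. cmod (ent A i j)) * sn k a * sn k b"
    by (simp only: mult_ac)
qed

lemma sec_tendsto_0:
  assumes "\<And>i j. (\<lambda>k. ent (X k) i j) \<longlonglongrightarrow> 0"
  shows "(\<lambda>k. norm (sec n (X k))) \<longlonglongrightarrow> 0"
proof (rule norm_null_comparison[OF norm_sec_le_sum])
  have "(\<lambda>k. \<Sum>i<n. \<Sum>j<n. cmod (ent (X k) i j)) \<longlonglongrightarrow> (\<Sum>i<n. \<Sum>j<n. 0)"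
    by (intro tendsto_sum tendsto_norm_zero assms)
  then show "(\<lambda>k. \<Sum>i<n. \<Sum>j<n. cmod (ent (X k) i j)) \<longlonglongrightarrow> 0" by simp
qed

text \<open>The last step of duality arguments in which a vector is tested against its own
  conjugate.\<close>

lemma sqrt_le_of_le_mult_sqrt:
  assumes "S \<le> c * sqrt S" "0 \<le> S" "0 \<le> c" shows "sqrt S \<le> c"
proof (cases "S = 0")
  case False
  then have "sqrt S > 0" using assms by simp
  moreover have "sqrt S * sqrt S \<le> c * sqrt S" using assms by simp
  ultimately show ?thesis by (rule mult_right_le_imp_le[rotated])
qed (use assms in simp)

text \<open>The form is evaluated at the unit vector \<open>e\<close> and the conjugate of the
  truncated row: this gives \<open>S \<le> norm A * sqrt S\<close> for the square sum
  \<open>S\<close>. The size \<open>l\<close> makes room for row \<open>i\<close> as well as for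
  \<open>k\<close> columns.\<close>

lemma row_square_sum_le: "(\<Sum>j<k. (cmod (ent A i j))\<^sup>2) \<le> (norm A)\<^sup>2"
proof -
  define l where "l = max k (Suc i)"
  define r where "r = (\<lambda>j. if j < k then ent A i j else 0)"
  define e where "e = (\<lambda>n. if n = i then 1 else 0 :: complex)"
  have il: "i < l" "k \<le> l" by (auto simp: l_def)
  define S where "S = (\<Sum>j<k. (cmod (ent A i j))\<^sup>2)"
  have S0: "S \<ge> 0" unfolding S_def by (intro sum_nonneg) simp
  have "bform l (ent A) e (\<lambda>j. cnj (r j)) = (\<Sum>i'<l. if i' = i then (\<Sum>j<l. cnj (r j) * ent A i j) else 0)"
    unfolding bform_def e_def by (intro sum.cong refl) auto
  also have "\<dots> = (\<Sum>j<l. cnj (r j) * ent A i j)" using il by simp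
  also have "\<dots> = (\<Sum>j<k. cnj (r j) * ent A i j)"
    by (rule sum.mono_neutral_right) (use il in \<open>auto simp: r_def\<close>)
  also have "\<dots> = complex_of_real S"
    unfolding S_def of_real_sum by (intro sum.cong) (auto simp: r_def complex_norm_square mult.commute simp flip: of_real_power)
  finally have 1: "bform l (ent A) e (\<lambda>j. cnj (r j)) = complex_of_real S" .
  have "(\<Sum>n<l. (cmod (e n))\<^sup>2) = (\<Sum>n<l. if n = i then 1 else 0)" by (intro sum.cong) (auto simp: e_def)
  then have 2: "sn l e = 1" using il by (simp add: L2_set_def)
  have "(\<Sum>j<l. (cmod (r j))\<^sup>2) = (\<Sum>j<k. (cmod (r j))\<^sup>2)"
    by (rule sum.mono_neutral_right) (use il in \<open>auto simp: r_def\<close>)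
  also have "\<dots> = S" unfolding S_def by (intro sum.cong) (auto simp: r_def)
  finally have 3: "sn l (\<lambda>j. cnj (r j)) = sqrt S" by (simp add: L2_set_def)
  have "S \<le> norm A * sqrt S" using bform_le_norm[of l A e "\<lambda>j. cnj (r j)"] S0 unfolding 1 2 3 by simp
  then have "sqrt S \<le> norm A" using S0 by (rule sqrt_le_of_le_mult_sqrt) simp
  then show ?thesis unfolding S_def[symmetric] by (rule sqrt_le_D)
qed

lemma summable_row: "summable (\<lambda>j. (cmod (ent A i j))\<^sup>2)"
  by (rule summableI_nonneg_bounded[OF _ row_square_sum_le]) simp

text \<open>A single row is a rank-one matrix, and Cauchy-Schwarz bounds it by its Euclidean norm.
  Tails of the row therefore tend to 0 in norm.\<close>

lemma norm_row_le:
  assumes "summable (\<lambda>j. (cmod (ent A i j))\<^sup>2)"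
  shows "norm (cut {i} UNIV A) \<le> sqrt (\<Sum>j. (cmod (ent A i j))\<^sup>2)"
proof (rule norm_bmatI)
  show "0 \<le> sqrt (\<Sum>j. (cmod (ent A i j))\<^sup>2)" using assms by (simp add: suminf_nonneg)
  fix k and a b :: "nat \<Rightarrow> complex"
  show "cmod (bform k (ent (cut {i} UNIV A)) a b) \<le> sqrt (\<Sum>j. (cmod (ent A i j))\<^sup>2) * sn k a * sn k b"
  proof (cases "i < k")
    case True
    have "bform k (ent (cut {i} UNIV A)) a b = (\<Sum>i'<k. if i' = i then (\<Sum>j<k. a i * b j * ent A i j) else 0)"
      unfolding bform_def by (intro sum.cong refl) auto
    also have "\<dots> = a i * (\<Sum>j<k. b j * ent A i j)" using True by (simp add: sum_distrib_left mult.assoc)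
    finally have "cmod (bform k (ent (cut {i} UNIV A)) a b) = cmod (a i) * cmod (\<Sum>j<k. b j * ent A i j)"
      by (simp add: norm_mult)
    also have "\<dots> \<le> sn k a * (sn k b * sqrt (\<Sum>j. (cmod (ent A i j))\<^sup>2))"
    proof (rule mult_mono)
      show "cmod (a i) \<le> sn k a" using member_le_L2_set[of "{..<k}" i "\<lambda>i. cmod (a i)"] True by simp
      have "cmod (\<Sum>j<k. b j * ent A i j) \<le> (\<Sum>j<k. \<bar>cmod (b j)\<bar> * \<bar>cmod (ent A i j)\<bar>)"
        by (rule order_trans[OF norm_sum]) (simp add: norm_mult)
      also have "\<dots> \<le> sn k b * sn k (ent A i)" by (rule L2_set_mult_ineq)
      also have "\<dots> \<le> sn k b * sqrt (\<Sum>j. (cmod (ent A i j))\<^sup>2)"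
        unfolding L2_set_def[of "\<lambda>j. cmod (ent A i j)"] using assms
        by (intro mult_left_mono real_sqrt_le_mono sum_le_suminf) auto
      finally show "cmod (\<Sum>j<k. b j * ent A i j) \<le> sn k b * sqrt (\<Sum>j. (cmod (ent A i j))\<^sup>2)" .
    qed auto
    finally show ?thesis by (simp add: mult_ac)
  next
    case False
    then have "bform k (ent (cut {i} UNIV A)) a b = 0"
      unfolding bform_def by (auto intro!: sum.neutral)
    then show ?thesis using assms by (simp add: suminf_nonneg)
  qed
qed

lemma norm_row_tail: "(\<lambda>n. norm (cut {i} {n..} A)) \<longlonglongrightarrow> 0"
proof (rule norm_null_comparison)
  let ?f = "\<lambda>j. (cmod (ent A i j))\<^sup>2"
  have "(\<lambda>n. \<Sum>j. ?f (j + n)) \<longlonglongrightarrow> 0" by (rule suminf_exist_split2[OF summable_row])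
  then show "(\<lambda>n. sqrt (\<Sum>j. ?f (j + n))) \<longlonglongrightarrow> 0" using tendsto_real_sqrt[of _ 0] by simp
  show "norm (cut {i} {n..} A) \<le> sqrt (\<Sum>j. ?f (j + n))" for n
  proof -
    let ?g = "\<lambda>j. (cmod (ent (cut UNIV {n..} A) i j))\<^sup>2"
    have "norm (cut {i} {n..} A) = norm (cut {i} UNIV (cut UNIV {n..} A))" by (simp add: cut_cut)
    also have "\<dots> \<le> sqrt (\<Sum>j. ?g j)" by (rule norm_row_le[OF summable_row])
    also have "(\<Sum>j. ?g j) = (\<Sum>j. ?g (j + n)) + (\<Sum>j<n. ?g j)"
      by (rule suminf_split_initial_segment[OF summable_row])
    also have "\<dots> = (\<Sum>j. ?f (j + n))" by simp
    finally show "norm (cut {i} {n..} A) \<le> sqrt (\<Sum>j. ?f (j + n))" .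
  qed
qed

lemma norm_rows_tail: "(\<lambda>n. norm (cut {..<m} {n..} A)) \<longlonglongrightarrow> 0"
proof (induction m)
  case 0
  have "cut {} {n..} A = 0" for n by (rule bmat_eqI) simp
  then show ?case by simp
next
  case (Suc m)
  have "cut {..<Suc m} {n..} A = cut {..<m} {n..} A + cut {m} {n..} A" for n
    by (rule bmat_eqI) auto
  then have le: "norm (cut {..<Suc m} {n..} A) \<le> norm (cut {..<m} {n..} A) + norm (cut {m} {n..} A)" for n
    by (simp add: norm_triangle_ineq)
  show ?case
    by (rule norm_null_comparison[OF le]) (use tendsto_add[OF Suc.IH norm_row_tail[of m A]] in simp)
qed

text \<open>As soon as \<open>n \<ge> m\<close>, what the section misses is the part of the first
  \<open>m\<close> rows in the columns from \<open>n\<close> on, and finitely many row tails vanish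
  in the limit.\<close>

lemma cpt_rows: "cpt (cut {..<m} UNIV A)"
proof -
  have "\<forall>\<^sub>F n in sequentially. norm (cut {..<m} {n..} A) = norm (cut {..<m} UNIV A - sec n (cut {..<m} UNIV A))"
    using eventually_ge_at_top[of m]
  proof eventually_elim
    case (elim n)
    then show ?case by (intro arg_cong[of _ _ norm] bmat_eqI) auto
  qed
  then show ?thesis unfolding cpt_def by (rule Lim_transform_eventually[OF norm_rows_tail])
qed

lemma cpt_transp: "cpt A \<Longrightarrow> cpt (transp A)"
proof -
  have "norm (transp A - sec n (transp A)) = norm (A - sec n A)" for n
  proof -
    have "transp A - sec n (transp A) = transp (A - sec n A)" by (rule bmat_eqI) auto
    then show ?thesis by (simp add: norm_transp)
  qed
  then show "cpt A \<Longrightarrow> cpt (transp A)" unfolding cpt_def by simp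
qed

lemma cpt_add: assumes "cpt A" "cpt B" shows "cpt (A + B)"
proof -
  have le: "norm ((A + B) - sec n (A + B)) \<le> norm (A - sec n A) + norm (B - sec n B)" for n
    using norm_triangle_ineq[of "A - sec n A" "B - sec n B"] by (simp add: cut_add algebra_simps)
  show ?thesis unfolding cpt_def
    by (rule norm_null_comparison[OF le]) (use tendsto_add[OF assms[unfolded cpt_def]] in simp)
qed

lemma cpt_cs: assumes "cpt A" shows "cpt (cs c A)"
proof -
  have "norm (cs c A - sec n (cs c A)) = cmod c * norm (A - sec n A)" for n
  proof -
    have "cs c A - sec n (cs c A) = cs c (A - sec n A)" by (rule bmat_eqI) auto
    then show ?thesis by (simp add: norm_cs)
  qed
  then show ?thesis using tendsto_mult_right_zero[OF assms[unfolded cpt_def]] unfolding cpt_def by simp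
qed

lemma cpt_limit: assumes "\<And>k. cpt (S k)" "(\<lambda>k. norm (S k - A)) \<longlonglongrightarrow> 0" shows "cpt A"
  unfolding cpt_def
proof (rule LIMSEQ_I)
  fix e :: real assume e: "e > 0"
  obtain k where k: "norm (S k - A) < e / 3" using LIMSEQ_D[OF assms(2), of "e/3"] e by auto
  obtain N where N: "\<And>n. n \<ge> N \<Longrightarrow> norm (S k - sec n (S k)) < e / 3"
    using LIMSEQ_D[OF assms(1)[of k, unfolded cpt_def], of "e/3"] e by auto
  have "norm (A - sec n A) < e" if "n \<ge> N" for n
  proof -
    \<comment> \<open>The usual three-term estimate; sections do not increase the norm, so the third
      term is as small as the first, whatever \<open>n\<close> is.\<close>
    have "A - sec n A = - (S k - A) + (S k - sec n (S k)) + sec n (S k - A)" by (simp add: cut_diff)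
    then have "norm (A - sec n A) \<le> norm (S k - A) + norm (S k - sec n (S k)) + norm (sec n (S k - A))"
      using norm_triangle_ineq[of "- (S k - A) + (S k - sec n (S k))" "sec n (S k - A)"]
        norm_triangle_ineq[of "- (S k - A)" "S k - sec n (S k)"] by (simp only: norm_minus_cancel)
    then show ?thesis using k N[OF that] norm_cut_le[of "{..<n}" "{..<n}" "S k - A"] by linarith
  qed
  then show "\<exists>N. \<forall>n\<ge>N. norm (norm (A - sec n A) - 0) < e" by auto
qed

section \<open>Functionals on bounded matrices\<close>

text \<open>\<open>C\<close> is a prescribed bound and not the norm, so that a Hahn-Banach extension
  and its normal part satisfy the locale with the same constant.\<close>

locale functional =
  fixes F :: "bmat \<Rightarrow> complex" and C :: real
  assumes add: "F (A + B) = F A + F B"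
    and scale: "F (cs c A) = c * F A"
    and bound: "cmod (F A) \<le> C * norm A"
    and C_nonneg: "0 \<le> C"
begin

lemma zero: "F 0 = 0"
  using add[of 0 0] by simp

lemma diff: "F (A - B) = F A - F B"
  using add[of "A - B" B] by simp

lemma rotate: "\<exists>u. cmod u = 1 \<and> F (cs u A) = complex_of_real (cmod (F A))"
proof (cases "F A = 0")
  case True then show ?thesis by (intro exI[of _ 1]) (simp add: scale)
next
  case False
  have "cnj (sgn (F A)) * F A = cmod (F A)"
    by (simp add: complex_eq_iff sgn_eq cmod_def power2_eq_square add_divide_distrib[symmetric] real_div_sqrt)
  then show ?thesis using False by (intro exI[of _ "cnj (sgn (F A))"]) (simp add: scale norm_sgn)
qed

text \<open>Gliding hump: \<open>n\<close> matrices of norm at most 1 living on disjoint sets of rows have a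
  sum of norm at most \<open>sqrt n\<close>, so \<open>F\<close> cannot be bounded below on all of them.\<close>
lemma rows_uniformly_small:
  assumes e: "e > 0"
  shows "\<exists>N. \<forall>k\<ge>N. \<forall>l A. cmod (F (cut {k..<l} UNIV A)) \<le> e * norm A"
proof (rule ccontr)
  assume "\<not> ?thesis"
  then have neg: "\<exists>k\<ge>N. \<exists>l A. cmod (F (cut {k..<l} UNIV A)) > e * norm A" for N
    by (meson not_le)
  have hump: "\<exists>k\<ge>N. \<exists>l A. norm A \<le> 1 \<and> Re (F (cut {k..<l} UNIV A)) \<ge> e" for N
  proof -
    obtain k l A where k: "k \<ge> N" and A: "cmod (F (cut {k..<l} UNIV A)) > e * norm A" using neg by blast
    have pos: "norm A > 0"
    proof (rule ccontr)
      assume "\<not> norm A > 0"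
      then have "A = 0" by simp
      moreover have "cut {k..<l} UNIV 0 = 0" by (rule bmat_eqI) simp
      ultimately show False using A zero by simp
    qed
    obtain u where u: "cmod u = 1" "F (cs u (cut {k..<l} UNIV A)) = complex_of_real (cmod (F (cut {k..<l} UNIV A)))"
      using rotate by blast
    define B where "B = cs (complex_of_real (inverse (norm A))) (cs u A)"
    have "norm B \<le> 1" using pos u(1) by (simp add: B_def norm_cs norm_inverse)
    have "F (cut {k..<l} UNIV B) = complex_of_real (inverse (norm A) * cmod (F (cut {k..<l} UNIV A)))"
      unfolding B_def cut_cs scale[of "complex_of_real (inverse (norm A))"] u(2) by simp
    then have "Re (F (cut {k..<l} UNIV B)) = inverse (norm A) * cmod (F (cut {k..<l} UNIV A))"
      by (simp only: Re_complex_of_real)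
    moreover have "e < inverse (norm A) * cmod (F (cut {k..<l} UNIV A))"
      using A pos by (simp add: pos_less_divide_eq divide_inverse_commute[symmetric])
    ultimately have "Re (F (cut {k..<l} UNIV B)) \<ge> e" by simp
    with \<open>norm B \<le> 1\<close> show ?thesis using k by blast
  qed
  \<comment> \<open>The partial sum records the number \<open>l\<close> of rows it occupies, so that
    the next hump can be chosen from row \<open>l\<close> on.\<close>
  have humps: "\<exists>B l. B = cut {..<l} UNIV B \<and> (norm B)\<^sup>2 \<le> real n \<and> Re (F B) \<ge> real n * e" for n
  proof (induction n)
    case 0
    have "0 = cut {..<0} UNIV 0" by (rule bmat_eqI) simp
    then show ?case using zero by (intro exI[of _ 0]) auto
  next
    case (Suc n)
    then obtain B l where B: "B = cut {..<l} UNIV B" "(norm B)\<^sup>2 \<le> real n" "Re (F B) \<ge> real n * e" by blast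
    obtain k l' A where A: "k \<ge> l" "norm A \<le> 1" "Re (F (cut {k..<l'} UNIV A)) \<ge> e" using hump[of l] by blast
    let ?B = "B + cut {k..<l'} UNIV A"
    have z: "ent B i j = 0" if "\<not> i < l" for i j
      by (subst B(1)) (use that in simp)
    have "(norm ?B)\<^sup>2 \<le> (norm B)\<^sup>2 + (norm A)\<^sup>2"
    proof -
      have "{..<l} \<inter> {k..<l'} = {}" using A(1) by auto
      from norm_disjoint_rows[OF this, of B A] show ?thesis using B(1)[symmetric] by simp
    qed
    also have "\<dots> \<le> real n + 1" using B(2) A(2) by (simp add: power_le_one add_mono)
    finally have "(norm ?B)\<^sup>2 \<le> real (Suc n)" by simp
    moreover have "?B = cut {..<max l l'} UNIV ?B"
      by (rule bmat_eqI) (auto simp: z)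
    moreover have "Re (F ?B) \<ge> real (Suc n) * e" using A(3) B(3) by (simp add: add algebra_simps)
    ultimately show ?case by blast
  qed
  have bd: "real n * e \<le> C * sqrt (real n)" for n
  proof -
    obtain B where B: "(norm B)\<^sup>2 \<le> real n" "Re (F B) \<ge> real n * e"
      using humps by blast
    have "norm B \<le> sqrt (real n)" using B(1) by (rule real_le_rsqrt)
    then have "C * norm B \<le> C * sqrt (real n)" using C_nonneg by (rule mult_left_mono)
    then show ?thesis using B(2) bound[of B] complex_Re_le_cmod[of "F B"] by linarith
  qed
  obtain m :: nat where m: "real m * e > C" using e reals_Archimedean3 by blast
  have "m \<noteq> 0" using m C_nonneg by (intro notI) simp
  \<comment> \<open>Taking \<open>m * m\<close> humps removes the square root and contradicts
    \<open>real m * e > C\<close>.\<close>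
  have "real m * (real m * e) \<le> real m * C" using bd[of "m * m"] by (simp add: real_sqrt_mult mult_ac)
  then show False using m \<open>m \<noteq> 0\<close> by simp
qed

lemma functional_transp: "functional (\<lambda>A. F (transp A)) C"
proof
  fix A B c
  have "transp (A + B) = transp A + transp B" "transp (cs c A) = cs c (transp A)" by (rule bmat_eqI, simp)+
  then show "F (transp (A + B)) = F (transp A) + F (transp B)" "F (transp (cs c A)) = c * F (transp A)"
    by (simp_all add: add scale)
  show "cmod (F (transp A)) \<le> C * norm A" using bound[of "transp A"] by (simp add: norm_transp)
qed (rule C_nonneg)

lemma columns_uniformly_small:
  assumes "e > 0"
  shows "\<exists>N. \<forall>k\<ge>N. \<forall>l A. cmod (F (cut UNIV {k..<l} A)) \<le> e * norm A"
proof -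
  interpret T: functional "\<lambda>A. F (transp A)" C by (rule functional_transp)
  obtain N where N: "\<And>k l A. k \<ge> N \<Longrightarrow> cmod (F (transp (cut {k..<l} UNIV A))) \<le> e * norm A"
    using T.rows_uniformly_small[OF assms] by blast
  have tt: "transp (transp A) = A" for A by (rule bmat_eqI) simp
  have "cmod (F (cut UNIV {k..<l} A)) \<le> e * norm A" if "k \<ge> N" for k l A
    using N[OF that, of l "transp A"] by (simp add: transp_cut tt norm_transp)
  then show ?thesis by blast
qed

text \<open>The difference of two sections is L-shaped: it consists of the rows from
  \<open>k\<close> to \<open>l - 1\<close> inside the larger square and the columns from
  \<open>k\<close> to \<open>l - 1\<close> above them. Each arm takes half of
  \<open>e\<close>.\<close>

lemma sections_uniformly_Cauchy:
  assumes "e > 0"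
  shows "\<exists>N. \<forall>k\<ge>N. \<forall>l\<ge>k. \<forall>A. cmod (F (sec l A) - F (sec k A)) \<le> e * norm A"
proof -
  have e2: "e / 2 > 0" using assms by simp
  obtain N where N: "\<And>k l A. k \<ge> N \<Longrightarrow> cmod (F (cut {k..<l} UNIV A)) \<le> e / 2 * norm A"
    using rows_uniformly_small[OF e2] by blast
  obtain M where M: "\<And>k l A. k \<ge> M \<Longrightarrow> cmod (F (cut UNIV {k..<l} A)) \<le> e / 2 * norm A"
    using columns_uniformly_small[OF e2] by blast
  have "cmod (F (sec l A) - F (sec k A)) \<le> e * norm A" if k: "k \<ge> max N M" and l: "l \<ge> k" for k l A
  proof -
    let ?R = "cut {k..<l} UNIV (cut UNIV {..<l} A)" and ?S = "cut UNIV {k..<l} (cut {..<k} UNIV A)"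
    have "sec l A = sec k A + (?R + ?S)" using l by (intro bmat_eqI) auto
    then have "F (sec l A) - F (sec k A) = F ?R + F ?S" by (metis add add_diff_cancel_left')
    then have "cmod (F (sec l A) - F (sec k A)) \<le> cmod (F ?R) + cmod (F ?S)"
      by (simp only: norm_triangle_ineq)
    moreover have "cmod (F ?R) \<le> e / 2 * norm (cut UNIV {..<l} A)" using N k by simp
    moreover have "\<dots> \<le> e / 2 * norm A" using e2 by (intro mult_left_mono norm_cut_le) simp
    moreover have "cmod (F ?S) \<le> e / 2 * norm (cut {..<k} UNIV A)" using M k by simp
    moreover have "\<dots> \<le> e / 2 * norm A" using e2 by (intro mult_left_mono norm_cut_le) simp
    ultimately show ?thesis by (simp add: field_simps)
  qed
  then show ?thesis by blast
qed

section \<open>The normal and the singular part of a functional\<close>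

definition normal_part :: "bmat \<Rightarrow> complex" where
  "normal_part A = lim (\<lambda>n. F (sec n A))"

lemma normal_part_LIMSEQ: "(\<lambda>n. F (sec n A)) \<longlonglongrightarrow> normal_part A"
proof -
  have "Cauchy (\<lambda>n. F (sec n A))"
  proof (rule metric_CauchyI)
    fix e :: real assume e: "e > 0"
    \<comment> \<open>The summand 1 avoids division by zero and makes \<open>d * norm A < e\<close>
      strict.\<close>
    define d where "d = e / (norm A + 1)"
    have d: "d > 0" "d * norm A < e"
      using e by (auto simp: d_def field_simps add_pos_nonneg intro!: divide_pos_pos)
    obtain N where N: "\<And>k l. k \<ge> N \<Longrightarrow> l \<ge> k \<Longrightarrow> cmod (F (sec l A) - F (sec k A)) \<le> d * norm A"
      using sections_uniformly_Cauchy[OF d(1)] by blast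
    have "dist (F (sec m A)) (F (sec n A)) < e" if "m \<ge> N" "n \<ge> N" for m n
    proof (cases "m \<le> n")
      case True
      then show ?thesis using N[of m n] that d(2) by (simp add: dist_norm norm_minus_commute)
    next
      case False
      then show ?thesis using N[of n m] that d(2) by (simp add: dist_norm)
    qed
    then show "\<exists>M. \<forall>m\<ge>M. \<forall>n\<ge>M. dist (F (sec m A)) (F (sec n A)) < e" by blast
  qed
  then show ?thesis unfolding normal_part_def by (simp add: Cauchy_convergent convergent_LIMSEQ_iff[symmetric])
qed

text \<open>The larger section goes to infinity in the uniform Cauchy estimate. Uniformity in
  \<open>A\<close> means convergence in the dual norm, on which both the continuity of the normal
  part and the description of the bidual rest.\<close>

lemma normal_part_uniform:
  assumes "e > 0"
  shows "\<exists>N. \<forall>n\<ge>N. \<forall>A. cmod (normal_part A - F (sec n A)) \<le> e * norm A"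
proof -
  obtain N where N: "\<And>k l A. k \<ge> N \<Longrightarrow> l \<ge> k \<Longrightarrow> cmod (F (sec l A) - F (sec k A)) \<le> e * norm A"
    using sections_uniformly_Cauchy[OF assms] by blast
  have "cmod (normal_part A - F (sec n A)) \<le> e * norm A" if n: "n \<ge> N" for n A
  proof (rule tendsto_upperbound)
    show "(\<lambda>l. cmod (F (sec l A) - F (sec n A))) \<longlonglongrightarrow> cmod (normal_part A - F (sec n A))"
      by (intro tendsto_intros normal_part_LIMSEQ)
    show "\<forall>\<^sub>F l in sequentially. cmod (F (sec l A) - F (sec n A)) \<le> e * norm A"
      using eventually_ge_at_top[of n] by eventually_elim (rule N[OF n])
  qed simp
  then show ?thesis by blast
qed

lemma functional_normal_part: "functional normal_part C"
proof
  fix A B :: bmat and c :: complex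
  show "normal_part (A + B) = normal_part A + normal_part B"
    using tendsto_add[OF normal_part_LIMSEQ normal_part_LIMSEQ, of A B]
    by (intro LIMSEQ_unique[OF normal_part_LIMSEQ]) (simp add: cut_add add)
  show "normal_part (cs c A) = c * normal_part A"
    using tendsto_mult_left[OF normal_part_LIMSEQ, of c A]
    by (intro LIMSEQ_unique[OF normal_part_LIMSEQ]) (simp add: cut_cs scale)
  show "cmod (normal_part A) \<le> C * norm A"
  proof (rule tendsto_upperbound[OF tendsto_norm[OF normal_part_LIMSEQ]])
    have "cmod (F (sec n A)) \<le> C * norm A" for n
      using order_trans[OF bound mult_left_mono[OF norm_cut_le C_nonneg]] .
    then show "\<forall>\<^sub>F n in sequentially. cmod (F (sec n A)) \<le> C * norm A" by simp
  qed simp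
qed (rule C_nonneg)

lemma normal_part_cpt: assumes "cpt A" shows "normal_part A = F A"
proof (rule LIMSEQ_unique[OF normal_part_LIMSEQ])
  have "(\<lambda>n. F (sec n A) - F A) \<longlonglongrightarrow> 0"
  proof (rule Lim_null_comparison)
    have "cmod (F (sec n A) - F A) \<le> C * norm (A - sec n A)" for n
      using bound[of "sec n A - A"] by (simp add: diff norm_minus_commute)
    then show "\<forall>\<^sub>F n in sequentially. cmod (F (sec n A) - F A) \<le> C * norm (A - sec n A)" by simp
    show "(\<lambda>n. C * norm (A - sec n A)) \<longlonglongrightarrow> 0"
      using tendsto_mult_right_zero assms unfolding cpt_def by blast
  qed
  then show "(\<lambda>n. F (sec n A)) \<longlonglongrightarrow> F A" by (simp add: LIM_zero_iff)
qed

text \<open>\<open>F\<close> is tested on \<open>sec m A + Q B Q\<close>, where \<open>Q\<close> cuts off the first \<open>m\<close> coordinates.\<close>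
lemma norm_normal_plus_singular:
  assumes A: "norm A \<le> 1" and B: "norm B \<le> 1"
  shows "cmod (normal_part A) + cmod (F B - normal_part B) \<le> C"
proof -
  interpret N: functional normal_part C by (rule functional_normal_part)
  \<comment> \<open>\<open>A\<close> and \<open>B\<close> receive separate phases \<open>u\<close>
    and \<open>v\<close>, so that both values become nonnegative and their sum is the sum of the
    moduli.\<close>
  obtain u where u: "cmod u = 1" "normal_part (cs u A) = complex_of_real (cmod (normal_part A))"
    using N.rotate by blast
  have "functional (\<lambda>X. F X - normal_part X) (2 * C)"
  proof
    fix X show "cmod (F X - normal_part X) \<le> 2 * C * norm X"
      using norm_triangle_ineq4[of "F X" "normal_part X"] bound[of X] N.bound[of X] by simp
  qed (use C_nonneg in \<open>auto simp: add scale N.add N.scale algebra_simps\<close>)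
  then interpret S: functional "\<lambda>X. F X - normal_part X" "2 * C" .
  obtain v where v: "cmod v = 1" "F (cs v B) - normal_part (cs v B) = complex_of_real (cmod (F B - normal_part B))"
    using S.rotate by blast
  define A' B' where "A' = cs u A" and "B' = cs v B"
  have n: "norm A' \<le> 1" "norm B' \<le> 1" using A B u v by (simp_all add: A'_def B'_def norm_cs)
  let ?Q = "\<lambda>m. cut {m..} {m..} B'"
  \<comment> \<open>Cutting off finitely many rows and columns removes a compact matrix, which the
    singular part does not see.\<close>
  have sing: "F (?Q m) - normal_part (?Q m) = F B' - normal_part B'" for m
  proof -
    have c1: "cpt (cut {..<m} UNIV B')" by (rule cpt_rows)
    have "transp (cut {..<m} UNIV (transp (cut {m..} UNIV B'))) = cut {m..} {..<m} B'" by (rule bmat_eqI) auto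
    then have c2: "cpt (cut {m..} {..<m} B')" using cpt_transp[OF cpt_rows] by metis
    have "B' = cut {..<m} UNIV B' + cut {m..} {..<m} B' + ?Q m" by (rule bmat_eqI) auto
    then have "F B' - normal_part B' = (F (cut {..<m} UNIV B') - normal_part (cut {..<m} UNIV B'))
       + (F (cut {m..} {..<m} B') - normal_part (cut {m..} {..<m} B')) + (F (?Q m) - normal_part (?Q m))"
      by (metis S.add)
    then show ?thesis using normal_part_cpt[OF c1] normal_part_cpt[OF c2] by simp
  qed
  \<comment> \<open>The section of size \<open>m\<close> of this corner is zero, so the uniform
    approximation by sections leaves only the error term.\<close>
  have "(\<lambda>m. normal_part (?Q m)) \<longlonglongrightarrow> 0"
  proof (rule LIMSEQ_I)
    fix e :: real assume e: "e > 0"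
    obtain N where N: "\<And>n A. n \<ge> N \<Longrightarrow> cmod (normal_part A - F (sec n A)) \<le> e / 2 * norm A"
      using normal_part_uniform[of "e / 2"] e by auto
    have "norm (normal_part (?Q m) - 0) < e" if "m \<ge> N" for m
    proof -
      have "sec m (?Q m) = 0" by (rule bmat_eqI) auto
      then have "cmod (normal_part (?Q m)) \<le> e / 2 * norm (?Q m)" using N[OF that, of "?Q m"] zero by simp
      also have "\<dots> \<le> e / 2 * 1" using e order_trans[OF norm_cut_le n(2)] by (intro mult_left_mono) auto
      finally show ?thesis using e by simp
    qed
    then show "\<exists>no. \<forall>n\<ge>no. norm (normal_part (?Q n) - 0) < e" by blast
  qed
  then have "(\<lambda>m. F (sec m A') + (F B' - normal_part B') + normal_part (?Q m))
      \<longlonglongrightarrow> normal_part A' + (F B' - normal_part B') + 0"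
    by (intro tendsto_add normal_part_LIMSEQ tendsto_const)
  moreover have "F (sec m A') + (F B' - normal_part B') + normal_part (?Q m) = F (sec m A' + ?Q m)" for m
    using sing[of m] by (simp add: add algebra_simps)
  ultimately have lim: "(\<lambda>m. F (sec m A' + ?Q m)) \<longlonglongrightarrow> normal_part A' + (F B' - normal_part B')" by simp
  have "cmod (F (sec m A' + ?Q m)) \<le> C" for m
  proof -
    have "norm (sec m A' + ?Q m) \<le> 1" by (rule norm_disjoint_blocks[OF _ n]) auto
    then show ?thesis using order_trans[OF bound mult_left_mono[OF _ C_nonneg]] by (metis mult.right_neutral)
  qed
  then have "cmod (normal_part A' + (F B' - normal_part B')) \<le> C"
    by (intro tendsto_upperbound[OF tendsto_norm[OF lim]]) auto
  moreover have "normal_part A' + (F B' - normal_part B')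
      = complex_of_real (cmod (normal_part A) + cmod (F B - normal_part B))"
    unfolding A'_def B'_def u(2) v(2) by simp
  ultimately show ?thesis by (metis abs_of_nonneg add_nonneg_nonneg norm_ge_zero norm_of_real)
qed

text \<open>On a bounded set the normal part is uniformly close to \<open>F\<close> composed with
  one fixed section, and on that section entrywise convergence is norm convergence. Dilations
  converge entrywise but in general not in norm, which is why this form is required.\<close>

lemma normal_part_continuous:
  assumes "\<And>i j. (\<lambda>k. ent (X k) i j) \<longlonglongrightarrow> ent A i j" "\<And>k. norm (X k) \<le> M" "norm A \<le> M"
  shows "(\<lambda>k. normal_part (X k)) \<longlonglongrightarrow> normal_part A"
proof -
  interpret N: functional normal_part C by (rule functional_normal_part)
  have M: "M \<ge> 0" using assms(3) norm_ge_zero order_trans by blast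
  have "(\<lambda>k. normal_part (X k - A)) \<longlonglongrightarrow> 0"
  proof (rule LIMSEQ_I)
    fix e :: real assume e: "e > 0"
    \<comment> \<open>The differences \<open>X k - A\<close> have norm at most \<open>2 * M\<close>,
      so the approximation error stays below \<open>e / 2\<close>.\<close>
    define d where "d = e / (4 * M + 1)"
    have d: "d > 0" "d * (2 * M) < e / 2"
      using e M by (auto simp: d_def field_simps add_nonneg_pos intro!: divide_pos_pos)
    obtain n where n: "\<And>A. cmod (normal_part A - F (sec n A)) \<le> d * norm A"
      using normal_part_uniform[OF d(1)] by blast
    have "(\<lambda>k. ent (X k - A) i j) \<longlonglongrightarrow> 0" for i j
      using assms(1)[of i j] by (simp add: LIM_zero)
    then have "(\<lambda>k. C * norm (sec n (X k - A))) \<longlonglongrightarrow> 0"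
      by (intro tendsto_mult_right_zero sec_tendsto_0)
    then obtain K where K: "\<And>k. k \<ge> K \<Longrightarrow> C * norm (sec n (X k - A)) < e / 2"
      using LIMSEQ_D[of _ 0 "e / 2"] e by force
    have "norm (normal_part (X k - A) - 0) < e" if "k \<ge> K" for k
    proof -
      have "norm (X k - A) \<le> 2 * M" using norm_triangle_ineq4[of "X k" A] assms(2)[of k] assms(3) by linarith
      then have "d * norm (X k - A) \<le> d * (2 * M)" using d by (intro mult_left_mono) auto
      then have "cmod (normal_part (X k - A) - F (sec n (X k - A))) < e / 2"
        using n[of "X k - A"] d(2) by linarith
      moreover have "cmod (F (sec n (X k - A))) < e / 2" using bound[of "sec n (X k - A)"] K[OF that] by linarith
      ultimately show ?thesis
        using norm_triangle_sub[of "normal_part (X k - A)" "F (sec n (X k - A))"] by simp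
    qed
    then show "\<exists>no. \<forall>n\<ge>no. norm (normal_part (X n - A) - 0) < e" by blast
  qed
  then show ?thesis by (simp add: N.diff LIM_zero_iff)
qed

text \<open>The weights are the values of \<open>F\<close> on the matrix units \<open>U i j\<close>.
  On Hankel matrices such a truncated functional is thus a finite combination of coefficients of the
  symbol.\<close>

lemma eval_section: "\<exists>w. \<forall>A. F (sec n A) = (\<Sum>i<n. \<Sum>j<n. w i j * ent A i j)"
proof -
  define U where "U i j = Abs_bmat (\<lambda>i' j'. if i' = i \<and> j' = j then 1 else 0)" for i j
  have U: "ent (U i j) i' j' = (if i' = i \<and> j' = j then 1 else 0)" for i j i' j'
  proof -
    define A :: "nat \<Rightarrow> nat \<Rightarrow> complex" where "A = (\<lambda>i' j'. if i' = i \<and> j' = j then 1 else 0)"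
    have "mbd A 1" unfolding mbd_def
    proof (intro conjI allI)
      fix k a b
      have s: "cmod (a i) \<le> sn k a" if "i < k" for i a
        using member_le_L2_set[of "{..<k}" i "\<lambda>i. cmod (a i)"] that by simp
      have "bform k A a b = (\<Sum>i'<k. if i' = i then (\<Sum>j'<k. if j' = j then a i * b j else 0) else 0)"
        unfolding bform_def A_def
        by (rule sum.cong[OF refl]) (auto simp: if_distrib[of "\<lambda>x. _ * x"] cong: if_cong)
      also have "\<dots> = (if i < k \<and> j < k then a i * b j else 0)" by simp
      finally show "cmod (bform k A a b) \<le> 1 * sn k a * sn k b"
        by (auto simp: norm_mult intro!: mult_mono s)
    qed simp
    then have "ent (Abs_bmat A) = A" by (intro Abs_bmat_inverse) blast
    then show ?thesis unfolding U_def A_def by simp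
  qed
  have Fsum: "F (\<Sum>i\<in>I. X i) = (\<Sum>i\<in>I. F (X i))" for I :: "nat set" and X
    by (induction I rule: infinite_finite_induct) (auto simp: zero add)
  have entsum: "ent (\<Sum>i\<in>I. X i) p q = (\<Sum>i\<in>I. ent (X i) p q)" for I :: "nat set" and X p q
    by (induction I rule: infinite_finite_induct) auto
  have "F (sec n A) = (\<Sum>i<n. \<Sum>j<n. F (U i j) * ent A i j)" for A
  proof -
    have "sec n A = (\<Sum>i<n. \<Sum>j<n. cs (ent A i j) (U i j))"
    proof (rule bmat_eqI)
      fix p q
      have "ent (\<Sum>i<n. \<Sum>j<n. cs (ent A i j) (U i j)) p q = (\<Sum>i<n. if i = p then (\<Sum>j<n. if j = q then ent A p q else 0) else 0)"
        unfolding entsum by (rule sum.cong[OF refl]) (auto simp: U if_distrib[of "\<lambda>x. _ * x"] cong: if_cong)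
      then show "ent (sec n A) p q = ent (\<Sum>i<n. \<Sum>j<n. cs (ent A i j) (U i j)) p q" by simp
    qed
    then show ?thesis by (simp add: Fsum scale mult.commute)
  qed
  then show ?thesis by (intro exI[of _ "\<lambda>i j. F (U i j)"] allI)
qed

end

section \<open>Matrices as operators\<close>

lemma l2norm_nonneg: "0 \<le> l2norm a" if "summable (\<lambda>n. (cmod (a n))\<^sup>2)"
  using that by (simp add: l2norm_def suminf_nonneg)

lemma sn_le_l2norm: "summable (\<lambda>n. (cmod (a n))\<^sup>2) \<Longrightarrow> sn k a \<le> l2norm a"
  unfolding L2_set_def l2norm_def by (intro real_sqrt_le_mono sum_le_suminf) auto

lemma summable_of_sn_le:
  assumes "\<And>k. sn k a \<le> C" shows "summable (\<lambda>n. (cmod (a n))\<^sup>2)"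
proof (rule summableI_nonneg_bounded)
  fix k show "(\<Sum>n<k. (cmod (a n))\<^sup>2) \<le> C\<^sup>2"
    using assms[of k] unfolding L2_set_def by (rule sqrt_le_D)
qed simp

lemma l2norm_le:
  assumes "\<And>k. sn k a \<le> C" shows "l2norm a \<le> C"
  unfolding l2norm_def
proof (rule real_le_lsqrt)
  show "0 \<le> C" using assms[of 0] by simp
  show "(\<Sum>n. (cmod (a n))\<^sup>2) \<le> C\<^sup>2"
  proof (rule suminf_le_const[OF summable_of_sn_le[OF assms]])
    fix k show "(\<Sum>n<k. (cmod (a n))\<^sup>2) \<le> C\<^sup>2"
      using assms[of k] unfolding L2_set_def by (rule sqrt_le_D)
  qed
qed

lemma sn_triangle: "sn k (\<lambda>i. a i + b i) \<le> sn k a + sn k b"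
proof -
  have "sn k (\<lambda>i. a i + b i) \<le> L2_set (\<lambda>i. cmod (a i) + cmod (b i)) {..<k}"
    by (intro L2_set_mono norm_triangle_ineq norm_ge_zero)
  also have "\<dots> \<le> sn k a + sn k b" by (rule L2_set_triangle_ineq)
  finally show ?thesis .
qed

lemma l2norm_triangle:
  assumes "summable (\<lambda>n. (cmod (a n))\<^sup>2)" "summable (\<lambda>n. (cmod (b n))\<^sup>2)"
  shows "summable (\<lambda>n. (cmod (a n + b n))\<^sup>2)" "l2norm (\<lambda>n. a n + b n) \<le> l2norm a + l2norm b"
proof -
  have *: "sn k (\<lambda>n. a n + b n) \<le> l2norm a + l2norm b" for k
    using sn_triangle[where k = k and a = a and b = b] sn_le_l2norm[OF assms(1), where k = k] sn_le_l2norm[OF assms(2), where k = k] by linarith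
  show "summable (\<lambda>n. (cmod (a n + b n))\<^sup>2)" by (rule summable_of_sn_le[OF *])
  show "l2norm (\<lambda>n. a n + b n) \<le> l2norm a + l2norm b" by (rule l2norm_le[OF *])
qed

lemma summable_finsupp:
  assumes "\<And>n. n \<ge> k \<Longrightarrow> a n = 0"
  shows "summable (\<lambda>n. (cmod (a n))\<^sup>2)" "l2norm a = sn k a"
proof -
  have "(\<lambda>n. (cmod (a n))\<^sup>2) sums (\<Sum>n<k. (cmod (a n))\<^sup>2)" by (rule sums_finite) (use assms in auto)
  then show "summable (\<lambda>n. (cmod (a n))\<^sup>2)" "l2norm a = sn k a"
    by (auto simp: l2norm_def L2_set_def sums_iff)
qed

text \<open>The sum runs over the first index, as in \<open>Mop\<close>; hence cutting columns
  truncates the image vector.\<close>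

definition ap :: "bmat \<Rightarrow> (nat \<Rightarrow> complex) \<Rightarrow> nat \<Rightarrow> complex" where
  "ap A a = (\<lambda>m. \<Sum>n. ent A n m * a n)"

lemma summable_ap:
  assumes "summable (\<lambda>n. (cmod (a n))\<^sup>2)" shows "summable (\<lambda>n. ent A n m * a n)"
proof (rule summable_comparison_test')
  show "summable (\<lambda>n. (cmod (ent A n m))\<^sup>2 + (cmod (a n))\<^sup>2)"
    using summable_row[of "transp A" m] assms by (intro summable_add) simp_all
  fix n
  have "2 * (cmod (ent A n m) * cmod (a n)) \<le> (cmod (ent A n m))\<^sup>2 + (cmod (a n))\<^sup>2"
    using sum_squares_bound[of "cmod (ent A n m)" "cmod (a n)"] by simp
  moreover have "0 \<le> cmod (ent A n m) * cmod (a n)" by simp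
  ultimately have "cmod (ent A n m) * cmod (a n) \<le> (cmod (ent A n m))\<^sup>2 + (cmod (a n))\<^sup>2" by linarith
  then show "norm (ent A n m * a n) \<le> (cmod (ent A n m))\<^sup>2 + (cmod (a n))\<^sup>2"
    by (simp add: norm_mult)
qed

text \<open>Duality again: the form is tested with the conjugate of the image. Input and output are
  padded by zeros to a common size \<open>l\<close>, since sections are square.\<close>

lemma ap_partial_bound: "sn k (\<lambda>m. \<Sum>n<K. ent A n m * a n) \<le> norm A * sn K a"
proof -
  define y where "y = (\<lambda>m. \<Sum>n<K. ent A n m * a n)"
  define l where "l = max k K"
  define b where "b = (\<lambda>m. if m < k then cnj (y m) else 0)"
  define a' where "a' = (\<lambda>n. if n < K then a n else 0)"
  define S where "S = (\<Sum>m<k. (cmod (y m))\<^sup>2)"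
  have S0: "S \<ge> 0" unfolding S_def by (intro sum_nonneg) simp
  have "bform l (ent A) a' b = (\<Sum>j<l. \<Sum>i<l. a' i * b j * ent A i j)"
    unfolding bform_def by (rule sum.swap)
  also have "\<dots> = (\<Sum>j<l. b j * (\<Sum>i<l. ent A i j * a' i))" by (simp add: sum_distrib_left mult_ac)
  also have "\<dots> = (\<Sum>j<l. b j * y j)"
  proof -
    have "(\<Sum>i<l. ent A i j * a' i) = y j" for j
    proof -
      have "(\<Sum>i<l. ent A i j * a' i) = (\<Sum>i<K. ent A i j * a' i)"
        by (rule sum.mono_neutral_right) (auto simp: l_def a'_def)
      then show ?thesis by (simp add: y_def a'_def)
    qed
    then show ?thesis by simp
  qed
  also have "\<dots> = (\<Sum>j<k. b j * y j)"
    by (rule sum.mono_neutral_right) (auto simp: l_def b_def)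
  also have "\<dots> = complex_of_real S"
    unfolding S_def of_real_sum
    by (intro sum.cong) (auto simp: b_def complex_norm_square mult.commute simp flip: of_real_power)
  finally have 1: "bform l (ent A) a' b = complex_of_real S" .
  have "l2norm a' = sn l a'" "l2norm a' = sn K a'" by (rule summable_finsupp, simp add: a'_def l_def)+
  moreover have "sn K a' = sn K a" by (rule L2_set_cong) (auto simp: a'_def)
  ultimately have 2: "sn l a' = sn K a" by simp
  have "l2norm b = sn l b" "l2norm b = sn k b" by (rule summable_finsupp, simp add: b_def l_def)+
  moreover have "sn k b = sn k y" by (rule L2_set_cong) (auto simp: b_def)
  ultimately have 3: "sn l b = sqrt S" by (simp add: S_def L2_set_def)
  have "S \<le> (norm A * sn K a) * sqrt S" using bform_le_norm[of l A a' b] S0 unfolding 1 2 3 by simp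
  then have "sqrt S \<le> norm A * sn K a" using S0 by (rule sqrt_le_of_le_mult_sqrt) simp
  then show ?thesis by (simp add: S_def L2_set_def y_def)
qed

lemma ap_bound:
  assumes "summable (\<lambda>n. (cmod (a n))\<^sup>2)"
  shows "summable (\<lambda>m. (cmod (ap A a m))\<^sup>2)" "l2norm (ap A a) \<le> norm A * l2norm a"
proof -
  have *: "sn k (ap A a) \<le> norm A * l2norm a" for k
  proof (rule tendsto_upperbound)
    show "(\<lambda>K. sn k (\<lambda>m. \<Sum>n<K. ent A n m * a n)) \<longlonglongrightarrow> sn k (ap A a)"
      unfolding L2_set_def ap_def
      by (intro tendsto_intros summable_LIMSEQ summable_ap assms)
    have "sn k (\<lambda>m. \<Sum>n<K. ent A n m * a n) \<le> norm A * l2norm a" for K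
      using ap_partial_bound[where k = k and A = A and a = a and K = K] mult_left_mono[OF sn_le_l2norm[OF assms, where k = K] norm_ge_zero[of A]] by linarith
    then show "\<forall>\<^sub>F K in sequentially. sn k (\<lambda>m. \<Sum>n<K. ent A n m * a n) \<le> norm A * l2norm a" by simp
  qed simp
  show "summable (\<lambda>m. (cmod (ap A a m))\<^sup>2)" by (rule summable_of_sn_le[OF *])
  show "l2norm (ap A a) \<le> norm A * l2norm a" by (rule l2norm_le[OF *])
qed

lemma ap_add: "summable (\<lambda>n. (cmod (a n))\<^sup>2) \<Longrightarrow> ap (A + B) a m = ap A a m + ap B a m"
  unfolding ap_def by (simp add: distrib_right suminf_add summable_ap)

lemma ap_cs: "summable (\<lambda>n. (cmod (a n))\<^sup>2) \<Longrightarrow> ap (cs c A) a m = c * ap A a m"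
  unfolding ap_def by (simp add: mult.assoc suminf_mult summable_ap)

lemma ap_diff_right:
  assumes "summable (\<lambda>n. (cmod (a n))\<^sup>2)" "summable (\<lambda>n. (cmod (b n))\<^sup>2)"
  shows "ap A (\<lambda>n. a n - b n) m = ap A a m - ap A b m"
  unfolding ap_def by (simp add: right_diff_distrib suminf_diff summable_ap assms)

lemma ap_scale_right: "summable (\<lambda>n. (cmod (a n))\<^sup>2) \<Longrightarrow> ap A (\<lambda>n. c * a n) m = c * ap A a m"
  unfolding ap_def by (simp add: mult.left_commute suminf_mult summable_ap)

lemma ap_cut_columns: "ap (cut UNIV J A) a m = (if m \<in> J then ap A a m else 0)"
  unfolding ap_def by auto

lemma l2D: "a \<in> l2 \<Longrightarrow> summable (\<lambda>n. (cmod (a n))\<^sup>2)"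
  by (simp add: l2_def)

text \<open>Each form value pairs \<open>b\<close> with the image of a finitely supported vector.
  Elements of \<open>l2\<close> vanish at 0, so the operator cannot detect row 0, which is therefore
  assumed to be zero.\<close>

lemma norm_le_of_ap_le:
  assumes C: "0 \<le> C" and row0: "\<And>j. ent A 0 j = 0"
    and bd: "\<And>a. a \<in> l2 \<Longrightarrow> l2norm (ap A a) \<le> C * l2norm a"
  shows "norm A \<le> C"
proof (rule norm_bmatI[OF C])
  fix k and a b :: "nat \<Rightarrow> complex"
  define a' where "a' = (\<lambda>n. if 0 < n \<and> n < k then a n else 0)"
  have s: "summable (\<lambda>n. (cmod (a' n))\<^sup>2)" "l2norm a' = sn k a'" by (rule summable_finsupp[of k], simp add: a'_def)+
  have a': "a' \<in> l2" using s by (simp add: l2_def a'_def)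
  have "sn k a' \<le> sn k a" by (rule L2_set_mono) (auto simp: a'_def)
  then have n: "l2norm a' \<le> sn k a" using s by simp
  have ap: "ap A a' j = (\<Sum>i<k. ent A i j * a i)" for j
  proof -
    have "ap A a' j = (\<Sum>i<k. ent A i j * a' i)"
      unfolding ap_def by (rule suminf_finite) (auto simp: a'_def)
    also have "\<dots> = (\<Sum>i<k. ent A i j * a i)" by (rule sum.cong) (use row0 in \<open>auto simp: a'_def\<close>)
    finally show ?thesis .
  qed
  have "bform k (ent A) a b = (\<Sum>j<k. \<Sum>i<k. a i * b j * ent A i j)"
    unfolding bform_def by (rule sum.swap)
  also have "\<dots> = (\<Sum>j<k. b j * ap A a' j)" by (simp add: ap sum_distrib_left mult_ac)
  finally have "cmod (bform k (ent A) a b) \<le> (\<Sum>j<k. \<bar>cmod (b j)\<bar> * \<bar>cmod (ap A a' j)\<bar>)"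
    using norm_sum[of "\<lambda>j. b j * ap A a' j" "{..<k}"] by (simp add: norm_mult)
  also have "\<dots> \<le> sn k b * sn k (ap A a')" by (rule L2_set_mult_ineq)
  also have "\<dots> \<le> sn k b * (C * sn k a)"
  proof (rule mult_left_mono)
    have "sn k (ap A a') \<le> l2norm (ap A a')" by (rule sn_le_l2norm[OF ap_bound(1)[OF s(1)]])
    also have "\<dots> \<le> C * l2norm a'" by (rule bd[OF a'])
    also have "\<dots> \<le> C * sn k a" by (rule mult_left_mono[OF n C])
    finally show "sn k (ap A a') \<le> C * sn k a" .
  qed simp
  finally show "cmod (bform k (ent A) a b) \<le> C * sn k a * sn k b" by (simp add: mult_ac)
qed

section \<open>Multiplicative Hankel operators\<close>

text \<open>Row and column 0 are filled with zeros because sequences start at index 1; the value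
  \<open>\<alpha> 0\<close> has no influence.\<close>

definition hmat :: "(nat \<Rightarrow> complex) \<Rightarrow> nat \<Rightarrow> nat \<Rightarrow> complex" where
  "hmat \<alpha> i j = (if i = 0 \<or> j = 0 then 0 else \<alpha> (i * j))"

definition hankel :: "bmat \<Rightarrow> bool" where
  "hankel A \<longleftrightarrow> (\<exists>\<alpha>. ent A = hmat \<alpha>)"

definition op_of :: "bmat \<Rightarrow> op" where
  "op_of A = (\<lambda>a. if a \<in> l2 then ap A a else (\<lambda>_. 0))"

text \<open>The image of the first unit vector is \<open>m \<mapsto> \<alpha> (1 * m)\<close>, so
  the symbol can be read off from the operator.\<close>

definition coef :: "op \<Rightarrow> nat \<Rightarrow> complex" where
  "coef T = T (\<lambda>n. if n = 1 then 1 else 0)"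

definition mat :: "op \<Rightarrow> bmat" where
  "mat T = Abs_bmat (hmat (coef T))"

lemma mh_form_eq_bform:
  assumes "a 0 = 0" "b 0 = 0" "\<And>n. n \<ge> k \<Longrightarrow> a n = 0" "\<And>n. n \<ge> k \<Longrightarrow> b n = 0"
  shows "mh_form \<alpha> a b = bform k (hmat \<alpha>) a (\<lambda>n. cnj (b n))"
proof -
  have lt: "n < k" if "a n \<noteq> 0 \<or> b n \<noteq> 0" for n using assms(3,4)[of n] that by (meson not_le)
  have "mh_form \<alpha> a b = (\<Sum>n\<in>{n. a n \<noteq> 0}. \<Sum>m<k. a n * cnj (b m) * \<alpha> (n * m))"
    unfolding mh_form_def by (intro sum.cong sum.mono_neutral_left) (auto intro: lt)
  also have "\<dots> = (\<Sum>n<k. \<Sum>m<k. a n * cnj (b m) * \<alpha> (n * m))"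
    by (intro sum.mono_neutral_left) (auto intro: lt)
  also have "\<dots> = bform k (hmat \<alpha>) a (\<lambda>n. cnj (b n))"
    unfolding bform_def hmat_def by (intro sum.cong refl) (use assms in auto)
  finally show ?thesis .
qed

lemma mh_bounded_iff_mbd: "mh_bounded \<alpha> \<longleftrightarrow> (\<exists>C. mbd (hmat \<alpha>) C)"
proof
  assume "mh_bounded \<alpha>"
  then obtain C where C: "\<And>a b. finsupp a \<Longrightarrow> finsupp b \<Longrightarrow> cmod (mh_form \<alpha> a b) \<le> C * l2norm a * l2norm b"
    unfolding mh_bounded_def by blast
  have "mbd (hmat \<alpha>) \<bar>C\<bar>" unfolding mbd_def
  proof (intro conjI allI)
    fix k and a b :: "nat \<Rightarrow> complex"
    \<comment> \<open>Index 0 is dropped to satisfy \<open>finsupp\<close>, which does not matter as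
      \<open>hmat\<close> vanishes there. The conjugate in \<open>b'\<close> cancels the one in
      \<open>mh_form\<close>.\<close>
    define a' where "a' = (\<lambda>n. if 0 < n \<and> n < k then a n else 0)"
    define b' where "b' = (\<lambda>n. if 0 < n \<and> n < k then cnj (b n) else 0)"
    have "{n. a' n \<noteq> 0} \<subseteq> {..<k}" "{n. b' n \<noteq> 0} \<subseteq> {..<k}" by (auto simp: a'_def b'_def)
    then have fs: "finsupp a'" "finsupp b'"
      unfolding finsupp_def using finite_subset by (auto simp: a'_def b'_def)
    have sa: "summable (\<lambda>n. (cmod (a' n))\<^sup>2)" "l2norm a' = sn k a'" by (rule summable_finsupp[of k], simp add: a'_def)+
    have sb: "summable (\<lambda>n. (cmod (b' n))\<^sup>2)" "l2norm b' = sn k b'" by (rule summable_finsupp[of k], simp add: b'_def)+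
    have a: "0 \<le> l2norm a'" "l2norm a' \<le> sn k a" using l2norm_nonneg[OF sa(1)] unfolding sa(2)
      by (auto intro!: L2_set_mono simp: a'_def)
    have b: "0 \<le> l2norm b'" "l2norm b' \<le> sn k b" using l2norm_nonneg[OF sb(1)] unfolding sb(2)
      by (auto intro!: L2_set_mono simp: b'_def)
    have "bform k (hmat \<alpha>) a b = bform k (hmat \<alpha>) a' (\<lambda>n. cnj (b' n))"
      unfolding bform_def by (intro sum.cong refl) (auto simp: a'_def b'_def hmat_def)
    also have "\<dots> = mh_form \<alpha> a' b'"
      by (rule mh_form_eq_bform[symmetric]) (auto simp: a'_def b'_def)
    finally have "cmod (bform k (hmat \<alpha>) a b) \<le> C * l2norm a' * l2norm b'" using C[OF fs] by simp
    also have "\<dots> \<le> \<bar>C\<bar> * l2norm a' * l2norm b'" using a b by (intro mult_right_mono) auto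
    also have "\<dots> \<le> \<bar>C\<bar> * sn k a * sn k b" using a b by (intro mult_mono) auto
    finally show "cmod (bform k (hmat \<alpha>) a b) \<le> \<bar>C\<bar> * sn k a * sn k b" .
  qed simp
  then show "\<exists>C. mbd (hmat \<alpha>) C" by blast
next
  assume "\<exists>C. mbd (hmat \<alpha>) C"
  then obtain C where C: "mbd (hmat \<alpha>) C" by blast
  have "cmod (mh_form \<alpha> a b) \<le> C * l2norm a * l2norm b" if fs: "finsupp a" "finsupp b" for a b
  proof -
    have "finite ({n. a n \<noteq> 0} \<union> {n. b n \<noteq> 0})" using fs by (simp add: finsupp_def)
    then obtain k where k: "\<And>n. n \<in> {n. a n \<noteq> 0} \<union> {n. b n \<noteq> 0} \<Longrightarrow> n < k"
      unfolding finite_nat_set_iff_bounded by blast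
    then have z: "\<And>n. n \<ge> k \<Longrightarrow> a n = 0" "\<And>n. n \<ge> k \<Longrightarrow> b n = 0" by (auto simp: not_less[symmetric])
    have "mh_form \<alpha> a b = bform k (hmat \<alpha>) a (\<lambda>n. cnj (b n))"
      using fs z by (intro mh_form_eq_bform) (auto simp: finsupp_def)
    then show ?thesis using mbdD[OF C, of k a "\<lambda>n. cnj (b n)"] summable_finsupp(2)[OF z(1)] summable_finsupp(2)[OF z(2)] by simp
  qed
  then show "mh_bounded \<alpha>" unfolding mh_bounded_def by blast
qed

lemma Mop_eq_op_of: assumes "ent A = hmat \<alpha>" shows "Mop \<alpha> = op_of A"
proof (intro ext)
  fix a m
  have "(\<Sum>n. \<alpha> (n * m) * a n) = ap A a m" if "a \<in> l2" "m \<noteq> 0"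
    unfolding ap_def assms using that by (intro suminf_cong) (auto simp: hmat_def l2_def)
  moreover have "ap A a 0 = 0" unfolding ap_def assms hmat_def by simp
  ultimately show "Mop \<alpha> a m = op_of A a m" by (auto simp: Mop_def op_of_def)
qed

lemma unit_vector_l2: "(\<lambda>n. if n = 1 then 1 else 0) \<in> l2"
  using summable_finsupp(1)[of 2 "\<lambda>n. if n = 1 then 1 else 0 :: complex"] by (simp add: l2_def)

lemma coef_op_of: "coef (op_of A) m = ent A 1 m"
proof -
  have "(\<lambda>n. ent A n m * (if n = 1 then 1 else 0)) = (\<lambda>n. if n = 1 then ent A n m else 0)" by auto
  then have "(\<Sum>n. ent A n m * (if n = 1 then 1 else 0)) = ent A 1 m"
    using sums_single[of 1 "\<lambda>n. ent A n m"] by (simp add: sums_iff)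
  then show ?thesis using unit_vector_l2 unfolding coef_def op_of_def ap_def by simp
qed

lemma hankel_iff: "hankel A \<longleftrightarrow> ent A = hmat (ent A 1)"
proof
  assume "hankel A"
  then obtain \<alpha> where "ent A = hmat \<alpha>" unfolding hankel_def by blast
  then show "ent A = hmat (ent A 1)" by (auto simp: hmat_def fun_eq_iff)
qed (auto simp: hankel_def)

lemma mat_op_of: assumes "hankel A" shows "mat (op_of A) = A"
proof -
  have "coef (op_of A) = ent A 1" using coef_op_of by blast
  then have "mat (op_of A) = Abs_bmat (ent A)" using assms unfolding mat_def hankel_iff by simp
  then show ?thesis by (simp add: ent_inverse)
qed

lemma op_of_in_Mspace: assumes "hankel A" shows "op_of A \<in> Mspace"
proof -
  obtain \<alpha> where \<alpha>: "ent A = hmat \<alpha>" using assms unfolding hankel_def by blast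
  then have "mh_bounded \<alpha>" using ent[of A] by (simp add: mh_bounded_iff_mbd)
  then show ?thesis unfolding Mspace_def Mop_eq_op_of[OF \<alpha>, symmetric] by blast
qed

lemma Mspace_obtain: assumes "T \<in> Mspace" obtains A where "hankel A" "T = op_of A"
proof -
  obtain \<alpha> where \<alpha>: "mh_bounded \<alpha>" "T = Mop \<alpha>" using assms unfolding Mspace_def by blast
  then have "ent (Abs_bmat (hmat \<alpha>)) = hmat \<alpha>" using mh_bounded_iff_mbd by (intro Abs_bmat_inverse) simp
  then show thesis using that \<alpha>(2) Mop_eq_op_of unfolding hankel_def by blast
qed

lemma mat_Mspace:
  assumes "T \<in> Mspace"
  shows hankel_mat: "hankel (mat T)" and op_of_mat: "op_of (mat T) = T"
    and ent_mat: "ent (mat T) = hmat (coef T)"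
proof -
  obtain A where A: "hankel A" "T = op_of A" using Mspace_obtain[OF assms] .
  then have m: "mat T = A" using mat_op_of by simp
  have "coef T = ent A 1" unfolding A(2) by (rule ext) (rule coef_op_of)
  then show "hankel (mat T)" "op_of (mat T) = T" "ent (mat T) = hmat (coef T)"
    using A m hankel_iff[of A] by simp_all
qed

lemma op_of_add: "op_of (A + B) = op_add (op_of A) (op_of B)"
  by (intro ext) (simp add: op_of_def op_add_def ap_add l2D)

lemma op_of_cs: "op_of (cs c A) = op_scale c (op_of A)"
  by (intro ext) (simp add: op_of_def op_scale_def ap_cs l2D)

lemma hankel_add: "hankel A \<Longrightarrow> hankel B \<Longrightarrow> hankel (A + B)"
proof -
  assume "hankel A" "hankel B"
  then obtain \<alpha> \<beta> where "ent A = hmat \<alpha>" "ent B = hmat \<beta>" unfolding hankel_def by blast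
  then have "ent (A + B) = hmat (\<lambda>n. \<alpha> n + \<beta> n)" by (auto simp: hmat_def fun_eq_iff)
  then show ?thesis unfolding hankel_def by blast
qed

lemma hankel_cs: "hankel A \<Longrightarrow> hankel (cs c A)"
proof -
  assume "hankel A"
  then obtain \<alpha> where "ent A = hmat \<alpha>" unfolding hankel_def by blast
  then have "ent (cs c A) = hmat (\<lambda>n. c * \<alpha> n)" by (auto simp: hmat_def fun_eq_iff)
  then show ?thesis unfolding hankel_def by blast
qed

lemma op_add_Mspace: "T \<in> Mspace \<Longrightarrow> S \<in> Mspace \<Longrightarrow> op_add T S \<in> Mspace"
  using op_of_in_Mspace[OF hankel_add[OF hankel_mat hankel_mat], of T S] by (simp add: op_of_add op_of_mat)

lemma op_scale_Mspace: "T \<in> Mspace \<Longrightarrow> op_scale c T \<in> Mspace"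
  using op_of_in_Mspace[OF hankel_cs[OF hankel_mat], of T c] by (simp add: op_of_cs op_of_mat)

lemma mat_op_add: "T \<in> Mspace \<Longrightarrow> S \<in> Mspace \<Longrightarrow> mat (op_add T S) = mat T + mat S"
  using mat_op_of[OF hankel_add[OF hankel_mat hankel_mat], of T S] by (simp add: op_of_add op_of_mat)

lemma mat_op_scale: "T \<in> Mspace \<Longrightarrow> mat (op_scale c T) = cs c (mat T)"
  using mat_op_of[OF hankel_cs[OF hankel_mat], of T c] by (simp add: op_of_cs op_of_mat)

lemma mat_eq_iff: "T \<in> Mspace \<Longrightarrow> S \<in> Mspace \<Longrightarrow> mat T = mat S \<longleftrightarrow> T = S"
  by (metis op_of_mat)

lemma norm_le_of_ap_le_on_ball:
  assumes C: "0 \<le> C" and row0: "\<And>j. ent A 0 j = 0"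
    and bd: "\<And>a. a \<in> l2 \<Longrightarrow> l2norm a \<le> 1 \<Longrightarrow> l2norm (ap A a) \<le> C"
  shows "norm A \<le> C"
proof (rule norm_le_of_ap_le[OF C row0])
  fix a assume a: "a \<in> l2"
  show "l2norm (ap A a) \<le> C * l2norm a"
  proof (cases "l2norm a = 0")
    case True
    then show ?thesis using ap_bound(2)[OF l2D[OF a], of A] by simp
  next
    case False
    then have pos: "l2norm a > 0" using l2norm_nonneg[OF l2D[OF a]] by simp
    define c where "c = inverse (l2norm a)"
    have c0: "c \<ge> 0" using pos by (simp add: c_def)
    define b where "b = (\<lambda>n. complex_of_real c * a n)"
    have nb: "l2norm (\<lambda>n. complex_of_real c * x n) = c * l2norm x" if "summable (\<lambda>n. (cmod (x n))\<^sup>2)" for x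
      using that c0 by (simp add: l2norm_def norm_mult power_mult_distrib suminf_mult real_sqrt_mult)
    have "summable (\<lambda>n. (cmod (b n))\<^sup>2)"
      using summable_mult[OF l2D[OF a], of "c\<^sup>2"] by (simp add: b_def norm_mult power_mult_distrib)
    then have b: "b \<in> l2" using a by (simp add: l2_def b_def)
    have "l2norm b \<le> 1" unfolding b_def using nb[OF l2D[OF a]] pos by (simp add: c_def)
    then have "l2norm (ap A b) \<le> C" by (rule bd[OF b])
    moreover have "ap A b = (\<lambda>m. complex_of_real c * ap A a m)"
      by (simp add: b_def ap_scale_right[OF l2D[OF a]] fun_eq_iff)
    ultimately have "c * l2norm (ap A a) \<le> C" using nb[OF ap_bound(1)[OF l2D[OF a]]] by simp
    then show ?thesis using pos by (simp add: c_def field_simps)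
  qed
qed

lemma hankel_zero_row: "hankel A \<Longrightarrow> ent A 0 j = 0" and hankel_zero_column: "hankel A \<Longrightarrow> ent A i 0 = 0"
  unfolding hankel_def hmat_def by auto

lemma opnorm_op_of:
  assumes "hankel A" shows "opnorm (op_of A) = norm A"
proof -
  let ?S = "{l2norm (op_of A a) | a. a \<in> l2 \<and> l2norm a \<le> 1}"
  have ub: "x \<le> norm A" if x: "x \<in> ?S" for x
  proof -
    obtain a where a: "x = l2norm (ap A a)" "a \<in> l2" "l2norm a \<le> 1" using x by (auto simp: op_of_def)
    then show ?thesis using ap_bound(2)[OF l2D[OF a(2)], of A] mult_left_mono[OF a(3) norm_ge_zero[of A]] by simp
  qed
  have bdd: "bdd_above ?S" using ub by (rule bdd_aboveI)
  \<comment> \<open>The zero vector makes the set nonempty, without which a bound on its real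
    supremum could not be derived.\<close>
  have z: "(\<lambda>_. 0) \<in> l2" "l2norm (\<lambda>_. 0) = 0" by (simp_all add: l2_def l2norm_def)
  then have mem: "l2norm (op_of A (\<lambda>_. 0)) \<in> ?S" by (intro CollectI exI[of _ "\<lambda>_. 0"]) simp
  have "opnorm (op_of A) \<le> norm A" unfolding opnorm_def
    using ub mem by (intro cSup_least) blast+
  moreover have "norm A \<le> opnorm (op_of A)"
  proof (rule norm_le_of_ap_le_on_ball[OF _ hankel_zero_row[OF assms]])
    have "0 \<le> l2norm (op_of A (\<lambda>_. 0))"
      using l2norm_nonneg[OF ap_bound(1)[OF l2D[OF z(1)]]] z by (simp add: op_of_def)
    then show "0 \<le> opnorm (op_of A)" unfolding opnorm_def using cSup_upper2[OF mem _ bdd] by blast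
    fix a assume a: "a \<in> l2" "l2norm a \<le> 1"
    then have "l2norm (op_of A a) \<le> opnorm (op_of A)" unfolding opnorm_def by (intro cSup_upper bdd) blast
    then show "l2norm (ap A a) \<le> opnorm (op_of A)" using a by (simp add: op_of_def)
  qed
  ultimately show ?thesis by simp
qed

lemma norm_mat: "T \<in> Mspace \<Longrightarrow> norm (mat T) = opnorm T"
  using opnorm_op_of[OF hankel_mat, of T] by (simp add: op_of_mat)

text \<open>A diagonal subsequence converges in every coordinate. A section depends on finitely many
  coordinates only, so its images converge in norm, and the remainder \<open>A - sec n A\<close> is
  small uniformly on bounded sets.\<close>

lemma compact_op_of_cpt:
  assumes "hankel A" "cpt A" shows "compact_op (op_of A)"
  unfolding compact_op_def
proof (intro allI impI)
  fix x :: "nat \<Rightarrow> nat \<Rightarrow> complex"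
  assume asm: "(\<forall>k. x k \<in> l2) \<and> bounded (range (\<lambda>k. l2norm (x k)))"
  then have x: "\<And>k. x k \<in> l2" by blast
  obtain M where "\<And>k. norm (l2norm (x k)) \<le> M" using asm unfolding bounded_iff by blast
  then have M: "l2norm (x k) \<le> M" for k using abs_ge_self order_trans by (metis real_norm_def)
  have M0: "M \<ge> 0" using M[of 0] l2norm_nonneg[OF l2D[OF x[of 0]]] by linarith
  have ent_le: "cmod (x k n) \<le> M" for k n
  proof -
    have "cmod (x k n) \<le> sn (Suc n) (x k)" using member_le_L2_set[of "{..<Suc n}" n "\<lambda>i. cmod (x k i)"] by simp
    then show ?thesis using sn_le_l2norm[OF l2D[OF x[of k]], where k = "Suc n"] M[of k] by linarith
  qed
  interpret subseqs "\<lambda>n s. convergent (\<lambda>k. x (s k) n)"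
  proof
    fix n and s :: "nat \<Rightarrow> nat" assume "strict_mono s"
    have "bounded (range (\<lambda>k. x (s k) n))" using ent_le unfolding bounded_iff by blast
    then obtain l r where "strict_mono r" "((\<lambda>k. x (s k) n) \<circ> r) \<longlonglongrightarrow> l"
      using bounded_imp_convergent_subsequence by blast
    then show "\<exists>r'. strict_mono r' \<and> convergent (\<lambda>k. x ((s \<circ> r') k) n)"
      unfolding convergent_def by (auto simp: o_def)
  qed
  define r where "r = diagseq"
  have r: "strict_mono r" unfolding r_def by (rule subseq_diagseq)
  have "convergent (\<lambda>k. x (r k) n)" for n
  \<comment> \<open>The diagonal sequence is a subsequence of the \<open>n\<close>-th stage only
    from index \<open>Suc n\<close> on; the shift is undone afterwards.\<close>
  proof -
    have "convergent (\<lambda>k. x ((diagseq \<circ> (+) (Suc n)) k) n)"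
    proof (rule diagseq_holds)
      fix s r :: "nat \<Rightarrow> nat" and n
      assume "strict_mono r" "convergent (\<lambda>k. x (s k) n)"
      then show "convergent (\<lambda>k. x ((s \<circ> r) k) n)"
        unfolding convergent_def using LIMSEQ_subseq_LIMSEQ[of "\<lambda>k. x (s k) n" _ r] by (auto simp: o_def)
    qed
    then obtain L where "(\<lambda>k. x (r (k + Suc n)) n) \<longlonglongrightarrow> L"
      unfolding convergent_def r_def by (auto simp: o_def add.commute)
    then show ?thesis using LIMSEQ_offset[of "\<lambda>k. x (r k) n"] unfolding convergent_def by blast
  qed
  then obtain z where z: "\<And>n. (\<lambda>k. x (r k) n) \<longlonglongrightarrow> z n" unfolding convergent_def by metis
  have "sn k z \<le> M" for k
  proof (rule tendsto_upperbound)
    show "(\<lambda>l. sn k (x (r l))) \<longlonglongrightarrow> sn k z" unfolding L2_set_def by (intro tendsto_intros z)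
    show "\<forall>\<^sub>F l in sequentially. sn k (x (r l)) \<le> M"
      using order_trans[OF sn_le_l2norm[OF l2D[OF x]] M] by simp
  qed simp
  then have zs: "summable (\<lambda>n. (cmod (z n))\<^sup>2)" "l2norm z \<le> M"
    using summable_of_sn_le l2norm_le by blast+
  have "z 0 = 0" using z[of 0] x LIMSEQ_unique[OF z[of 0], of 0] by (simp add: l2_def)
  then have zl2: "z \<in> l2" using zs by (simp add: l2_def)
  \<comment> \<open>The limit of the images has to lie in \<open>l2\<close>, hence to vanish at
    index 0; the zero column ensures this.\<close>
  have "ap A z 0 = 0" unfolding ap_def by (simp add: hankel_zero_column[OF assms(1)])
  then have y: "ap A z \<in> l2" using ap_bound(1)[OF zs(1)] by (simp add: l2_def)
  define w where "w l = (\<lambda>n. x (r l) n - z n)" for l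
  have nz: "l2norm (\<lambda>n. - z n) = l2norm z" by (simp add: l2norm_def)
  have w: "summable (\<lambda>n. (cmod (w l n))\<^sup>2)" "l2norm (w l) \<le> 2 * M" for l
  proof -
    note * = l2norm_triangle[OF l2D[OF x[of "r l"]], of "\<lambda>n. - z n"]
    show "summable (\<lambda>n. (cmod (w l n))\<^sup>2)" using *(1) zs(1) by (simp add: w_def)
    show "l2norm (w l) \<le> 2 * M" using *(2) zs M[of "r l"] nz by (simp add: w_def)
  qed
  have diff: "(\<lambda>n. op_of A (x (r l)) n - ap A z n) = ap A (w l)" for l
    by (simp add: op_of_def x w_def ap_diff_right[OF l2D[OF x] zs(1)] fun_eq_iff)
  have "(\<lambda>l. l2norm (ap A (w l))) \<longlonglongrightarrow> 0"
  proof (rule LIMSEQ_I)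
    fix e :: real assume e: "e > 0"
    define d where "d = e / (4 * M + 1)"
    have d: "d > 0" "d * (2 * M) < e / 2"
      using e M0 by (auto simp: d_def field_simps add_nonneg_pos intro!: divide_pos_pos)
    obtain n where n: "norm (A - sec n A) < d" using LIMSEQ_D[OF assms(2)[unfolded cpt_def] d(1)] by auto
    have "(\<lambda>l. norm A * sn n (w l)) \<longlonglongrightarrow> norm A * sn n (\<lambda>_. 0)"
      unfolding L2_set_def w_def by (intro tendsto_intros) (use z in \<open>simp_all add: LIM_zero\<close>)
    then have "(\<lambda>l. norm A * sn n (w l)) \<longlonglongrightarrow> 0" by (simp add: L2_set_def)
    then obtain K where K: "\<And>l. l \<ge> K \<Longrightarrow> norm A * sn n (w l) < e / 2"
      using LIMSEQ_D[of _ 0 "e / 2"] e by force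
    have "norm (l2norm (ap A (w l)) - 0) < e" if "l \<ge> K" for l
    proof -
      define v where "v = (\<lambda>i. if i < n then w l i else 0)"
      have v: "summable (\<lambda>i. (cmod (v i))\<^sup>2)" "l2norm v = sn n v" by (rule summable_finsupp[of n], simp add: v_def)+
      have vn: "l2norm v = sn n (w l)" unfolding v(2) by (rule L2_set_cong) (auto simp: v_def)
      have 1: "ap (sec n A) (w l) = ap (sec n A) v"
        unfolding ap_def by (intro ext suminf_cong) (simp add: v_def)
      have 2: "l2norm (ap (sec n A) (w l)) < e / 2"
      proof -
        have "l2norm (ap (sec n A) v) \<le> norm (sec n A) * l2norm v" by (rule ap_bound(2)[OF v(1)])
        also have "\<dots> \<le> norm A * sn n (w l)" unfolding vn by (intro mult_right_mono norm_cut_le) simp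
        finally show ?thesis using K[OF that] 1 by simp
      qed
      have 3: "l2norm (ap (A - sec n A) (w l)) < e / 2"
      proof -
        have "l2norm (ap (A - sec n A) (w l)) \<le> norm (A - sec n A) * l2norm (w l)" by (rule ap_bound(2)[OF w(1)])
        also have "\<dots> \<le> d * (2 * M)" using n d(1) w l2norm_nonneg[OF w(1)] by (intro mult_mono) auto
        finally show ?thesis using d(2) by linarith
      qed
      have "ap A (w l) = (\<lambda>m. ap (A - sec n A) (w l) m + ap (sec n A) (w l) m)"
        unfolding ap_add[OF w(1), symmetric] by simp
      then have "l2norm (ap A (w l)) \<le> l2norm (ap (A - sec n A) (w l)) + l2norm (ap (sec n A) (w l))"
        using l2norm_triangle(2)[OF ap_bound(1)[OF w(1)] ap_bound(1)[OF w(1)]] by simp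
      then have "l2norm (ap A (w l)) < e" using 2 3 by linarith
      then show ?thesis using l2norm_nonneg[OF ap_bound(1)[OF w(1)]] by simp
    qed
    then show "\<exists>no. \<forall>n\<ge>no. norm (l2norm (ap A (w n)) - 0) < e" by blast
  qed
  show "\<exists>r y. strict_mono r \<and> y \<in> l2 \<and> (\<lambda>k. l2norm (\<lambda>n. op_of A (x (r k)) n - y n)) \<longlonglongrightarrow> 0"
    using r y \<open>(\<lambda>l. l2norm (ap A (w l))) \<longlonglongrightarrow> 0\<close>
    by (intro exI[of _ r] exI[of _ "ap A z"]) (simp add: diff)
qed

lemma l2norm_tail:
  assumes "summable (\<lambda>n. (cmod (y n))\<^sup>2)"
  shows "(\<lambda>n. l2norm (\<lambda>m. if n \<le> m then y m else 0)) \<longlonglongrightarrow> 0"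
proof -
  let ?f = "\<lambda>j. (cmod (y j))\<^sup>2"
  have "(\<Sum>m. (cmod (if n \<le> m then y m else 0))\<^sup>2) = (\<Sum>j. ?f (j + n))" for n
  proof -
    let ?g = "\<lambda>m. (cmod (if n \<le> m then y m else 0))\<^sup>2"
    have "summable ?g" by (rule summable_comparison_test'[OF assms]) auto
    then have "(\<Sum>m. ?g m) = (\<Sum>j. ?g (j + n)) + (\<Sum>j<n. ?g j)" by (rule suminf_split_initial_segment)
    also have "\<dots> = (\<Sum>j. ?f (j + n))" by simp
    finally show ?thesis .
  qed
  moreover have "(\<lambda>n. sqrt (\<Sum>j. ?f (j + n))) \<longlonglongrightarrow> 0"
    using tendsto_real_sqrt[OF suminf_exist_split2[OF assms]] by simp
  ultimately show ?thesis unfolding l2norm_def by simp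
qed

text \<open>Otherwise there are vectors in the unit ball whose images keep mass at least
  \<open>e / 2\<close> beyond index \<open>N\<close>, for every \<open>N\<close>. A norm limit
  \<open>y\<close> of a subsequence of the images would inherit this mass in all its tails, but
  tails of a square summable sequence vanish.\<close>

lemma columns_tail_of_compact_op:
  assumes A: "hankel A" and K: "compact_op (op_of A)"
  shows "(\<lambda>n. norm (cut UNIV {n..} A)) \<longlonglongrightarrow> 0"
proof (rule ccontr)
  assume "\<not> ?thesis"
  then obtain e where e: "e > 0" "\<And>N. \<exists>n\<ge>N. norm (cut UNIV {n..} A) \<ge> e"
    unfolding LIMSEQ_iff by (auto simp: not_less)
  \<comment> \<open>Tail norms decrease in \<open>N\<close>, so being at least \<open>e\<close>
    infinitely often becomes a bound for all \<open>N\<close>. Halving makes it strict, as needed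
    for refuting a non-strict bound on the unit ball.\<close>
  have big: "norm (cut UNIV {N..} A) > e / 2" for N
  proof -
    obtain n where n: "n \<ge> N" "norm (cut UNIV {n..} A) \<ge> e" using e(2) by blast
    have "cut UNIV {n..} A = cut UNIV {n..} (cut UNIV {N..} A)" using n(1) by (intro bmat_eqI) auto
    then have "norm (cut UNIV {n..} A) \<le> norm (cut UNIV {N..} A)" using norm_cut_le by metis
    then show ?thesis using n(2) e(1) by linarith
  qed
  have "\<exists>x. x \<in> l2 \<and> l2norm x \<le> 1 \<and> l2norm (ap (cut UNIV {N..} A) x) > e / 2" for N
  proof (rule ccontr)
    assume "\<not> ?thesis"
    then have "norm (cut UNIV {N..} A) \<le> e / 2"
      using e(1) by (intro norm_le_of_ap_le_on_ball) (auto simp: not_less hankel_zero_row[OF A])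
    then show False using big[of N] by simp
  qed
  then obtain x where x: "\<And>N. x N \<in> l2" "\<And>N. l2norm (x N) \<le> 1"
    and xb: "\<And>N. l2norm (ap (cut UNIV {N..} A) (x N)) > e / 2" by metis
  have "bounded (range (\<lambda>k. l2norm (x k)))"
    unfolding bounded_iff using x l2norm_nonneg[OF l2D[OF x(1)]] by (intro exI[of _ 1]) auto
  then obtain r y where r: "strict_mono r" and y: "y \<in> l2"
    and lim: "(\<lambda>k. l2norm (\<lambda>n. op_of A (x (r k)) n - y n)) \<longlonglongrightarrow> 0"
    using K x(1) unfolding compact_op_def by blast
  have tail: "(\<lambda>k. l2norm (\<lambda>m. if r k \<le> m then y m else 0)) \<longlonglongrightarrow> 0"
    using LIMSEQ_subseq_LIMSEQ[OF l2norm_tail[OF l2D[OF y]] r] by (simp add: o_def)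
  have le: "e / 2 \<le> l2norm (\<lambda>n. op_of A (x (r k)) n - y n) + l2norm (\<lambda>m. if r k \<le> m then y m else 0)" for k
  proof -
    define d where "d = (\<lambda>n. op_of A (x (r k)) n - y n)"
    define d' where "d' = (\<lambda>m. if r k \<le> m then d m else 0)"
    define t where "t = (\<lambda>m. if r k \<le> m then y m else 0)"
    have "summable (\<lambda>n. (cmod (- y n))\<^sup>2)" using l2D[OF y] by simp
    from l2norm_triangle(1)[OF ap_bound(1)[OF l2D[OF x(1)]] this]
    have d: "summable (\<lambda>n. (cmod (d n))\<^sup>2)" by (simp add: d_def op_of_def x)
    have d': "summable (\<lambda>n. (cmod (d' n))\<^sup>2)"
      by (rule summable_comparison_test'[OF d]) (auto simp: d'_def)
    have t: "summable (\<lambda>n. (cmod (t n))\<^sup>2)"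
      by (rule summable_comparison_test'[OF l2D[OF y]]) (auto simp: t_def)
    have "ap (cut UNIV {r k..} A) (x (r k)) = (\<lambda>m. d' m + t m)"
      by (auto simp: fun_eq_iff ap_cut_columns d'_def t_def d_def op_of_def x)
    then have "e / 2 < l2norm (\<lambda>m. d' m + t m)" using xb[of "r k"] by simp
    also have "\<dots> \<le> l2norm d' + l2norm t" by (rule l2norm_triangle(2)[OF d' t])
    also have "l2norm d' \<le> l2norm d"
      unfolding l2norm_def using d d' by (intro real_sqrt_le_mono suminf_le) (auto simp: d'_def)
    finally show ?thesis by (simp add: d_def t_def)
  qed
  have "e / 2 \<le> 0 + 0"
    by (rule tendsto_lowerbound[OF tendsto_add[OF lim tail]]) (use le in auto)
  then show False using e(1) by simp
qed

lemma transp_hankel: "hankel A \<Longrightarrow> transp A = A"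
  by (rule bmat_eqI) (auto simp: hankel_def hmat_def mult.commute)

text \<open>Compactness controls the tail of the output index. A Hankel matrix is symmetric, so
  transposition gives the same control over the input index, and the complement of a section is
  covered by the two tails.\<close>

lemma cpt_of_compact_op:
  assumes A: "hankel A" and K: "compact_op (op_of A)"
  shows "cpt A"
  unfolding cpt_def
proof (rule norm_null_comparison)
  show "(\<lambda>n. norm (cut UNIV {n..} A) + norm (cut UNIV {n..} A)) \<longlonglongrightarrow> 0"
    using tendsto_add[OF columns_tail_of_compact_op[OF assms] columns_tail_of_compact_op[OF assms]] by simp
  fix n
  let ?B = "cut UNIV {n..} A"
  have "A - sec n A = ?B + cut {n..} {..<n} A" by (rule bmat_eqI) auto
  moreover have "cut {n..} {..<n} A = transp (cut {..<n} UNIV ?B)"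
    using transp_cut[of "{..<n}" "{n..}" A] transp_hankel[OF A] by (simp add: cut_cut)
  ultimately have "norm (A - sec n A) \<le> norm ?B + norm (cut {..<n} UNIV ?B)"
    using norm_triangle_ineq[of ?B "transp (cut {..<n} UNIV ?B)"] by (simp add: norm_transp)
  then show "norm (A - sec n A) \<le> norm ?B + norm ?B"
    using norm_cut_le[of "{..<n}" UNIV ?B] by linarith
qed

lemma M0space_iff: "T \<in> M0space \<longleftrightarrow> T \<in> Mspace \<and> cpt (mat T)"
  using compact_op_of_cpt[OF hankel_mat] cpt_of_compact_op[OF hankel_mat] op_of_mat
  unfolding M0space_def by auto

section \<open>Dual norms\<close>

text \<open>What \<open>Mspace\<close>, \<open>M0space\<close> and \<open>M0dual\<close> have in
  common, so that the properties of dual norms are proved once for all three, including the step to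
  the bidual.\<close>

locale seminormed_carrier =
  fixes V :: "'v set" and ad :: "'v \<Rightarrow> 'v \<Rightarrow> 'v" and sc :: "complex \<Rightarrow> 'v \<Rightarrow> 'v" and nrm :: "'v \<Rightarrow> real"
  assumes nonempty: "V \<noteq> {}"
    and sc_closed: "x \<in> V \<Longrightarrow> sc c x \<in> V"
    and nrm_nonneg: "x \<in> V \<Longrightarrow> 0 \<le> nrm x"
    and nrm_scale: "x \<in> V \<Longrightarrow> nrm (sc c x) = cmod c * nrm x"
begin

abbreviation "dual \<equiv> dual_space V ad sc nrm"
abbreviation "dnorm \<equiv> dual_norm V nrm"

lemma dualD:
  assumes "f \<in> dual"
  shows "x \<in> V \<Longrightarrow> y \<in> V \<Longrightarrow> f (ad x y) = f x + f y" "x \<in> V \<Longrightarrow> f (sc c x) = c * f x"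
    "x \<notin> V \<Longrightarrow> f x = 0"
  using assms by (auto simp: dual_space_def)

lemma dualI:
  assumes "\<And>x y. x \<in> V \<Longrightarrow> y \<in> V \<Longrightarrow> f (ad x y) = f x + f y" "\<And>c x. x \<in> V \<Longrightarrow> f (sc c x) = c * f x"
    "\<And>x. x \<in> V \<Longrightarrow> cmod (f x) \<le> C * nrm x" "\<And>x. x \<notin> V \<Longrightarrow> f x = 0"
  shows "f \<in> dual"
  using assms unfolding dual_space_def by blast

lemma small_element: obtains z where "z \<in> V" "nrm z = 0"
proof -
  obtain x where "x \<in> V" using nonempty by blast
  then show thesis using that[of "sc 0 x"] sc_closed nrm_scale by simp
qed

lemma dnorm_least:
  assumes "\<And>x. x \<in> V \<Longrightarrow> nrm x \<le> 1 \<Longrightarrow> cmod (f x) \<le> C"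
  shows "dnorm f \<le> C"
proof -
  obtain z where "z \<in> V" "nrm z = 0" by (rule small_element)
  then have "cmod (f z) \<in> {cmod (f x) | x. x \<in> V \<and> nrm x \<le> 1}" by (intro CollectI exI[of _ z]) simp
  then show ?thesis unfolding dual_norm_def using assms by (intro cSup_least) blast+
qed

lemma dnorm_upper:
  assumes "f \<in> dual" "x \<in> V" "nrm x \<le> 1" shows "cmod (f x) \<le> dnorm f"
proof -
  obtain C where C: "\<And>x. x \<in> V \<Longrightarrow> cmod (f x) \<le> C * nrm x" using assms(1) unfolding dual_space_def by blast
  have "cmod (f x) \<le> \<bar>C\<bar>" if "x \<in> V" "nrm x \<le> 1" for x
  proof -
    have "C * nrm x \<le> \<bar>C\<bar> * 1" using that nrm_nonneg by (intro mult_mono) auto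
    then show ?thesis using C[OF that(1)] by simp
  qed
  then have "bdd_above {cmod (f x) | x. x \<in> V \<and> nrm x \<le> 1}" by (intro bdd_aboveI[of _ "\<bar>C\<bar>"]) blast
  then show ?thesis unfolding dual_norm_def using assms by (intro cSup_upper) blast+
qed

lemma dnorm_nonneg: assumes "f \<in> dual" shows "0 \<le> dnorm f"
proof -
  obtain z where "z \<in> V" "nrm z = 0" by (rule small_element)
  then have "cmod (f z) \<le> dnorm f" using dnorm_upper[OF assms] by simp
  then show ?thesis using norm_ge_zero order_trans by blast
qed

lemma dnorm_bound:
  assumes f: "f \<in> dual" and x: "x \<in> V" shows "cmod (f x) \<le> dnorm f * nrm x"
proof (cases "nrm x = 0")
  case True
  \<comment> \<open>Normalising \<open>x\<close> is impossible when its seminorm is 0, but any bound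
    of \<open>f\<close> then gives \<open>f x = 0\<close>.\<close>
  obtain C where "cmod (f x) \<le> C * nrm x" using f x unfolding dual_space_def by blast
  then show ?thesis using True by simp
next
  case False
  then have pos: "nrm x > 0" using nrm_nonneg[OF x] by simp
  let ?c = "complex_of_real (inverse (nrm x))"
  have "nrm (sc ?c x) \<le> 1" unfolding nrm_scale[OF x] norm_of_real using pos by simp
  then have "cmod (f (sc ?c x)) \<le> dnorm f" using dnorm_upper[OF f sc_closed[OF x]] by blast
  then have "inverse (nrm x) * cmod (f x) \<le> dnorm f"
    unfolding dualD(2)[OF f x] norm_mult norm_of_real using pos by simp
  then show ?thesis using pos by (simp add: field_simps)
qed

lemma fun_add_dual:
  assumes "f \<in> dual" "g \<in> dual" shows "fun_add f g \<in> dual"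
proof (rule dualI)
  fix x assume x: "x \<in> V"
  have "cmod (f x + g x) \<le> cmod (f x) + cmod (g x)" by (rule norm_triangle_ineq)
  then show "cmod (fun_add f g x) \<le> (dnorm f + dnorm g) * nrm x"
    using dnorm_bound[OF assms(1) x] dnorm_bound[OF assms(2) x] by (simp add: fun_add_def distrib_right)
qed (use assms in \<open>auto simp: fun_add_def dualD algebra_simps\<close>)

lemma fun_scale_dual:
  assumes "f \<in> dual" shows "fun_scale c f \<in> dual"
proof (rule dualI)
  fix x assume x: "x \<in> V"
  show "cmod (fun_scale c f x) \<le> (cmod c * dnorm f) * nrm x"
    using mult_left_mono[OF dnorm_bound[OF assms x] norm_ge_zero[of c]] by (simp add: fun_scale_def norm_mult mult.assoc)
qed (use assms in \<open>auto simp: fun_scale_def dualD algebra_simps\<close>)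

lemma fun_diff_dual:
  assumes "f \<in> dual" "g \<in> dual" shows "fun_diff f g \<in> dual"
proof -
  have "fun_diff f g = fun_add f (fun_scale (-1) g)" by (simp add: fun_diff_def fun_add_def fun_scale_def)
  then show ?thesis using fun_add_dual[OF assms(1) fun_scale_dual[OF assms(2)]] by simp
qed

lemma zero_dual: "(\<lambda>_. 0) \<in> dual"
  by (rule dualI[where C = 0]) auto

lemma dnorm_scale:
  assumes f: "f \<in> dual" shows "dnorm (fun_scale c f) = cmod c * dnorm f"
proof -
  have le: "dnorm (fun_scale c f) \<le> cmod c * dnorm f" if f: "f \<in> dual" for c f
  proof (rule dnorm_least)
    fix x assume "x \<in> V" "nrm x \<le> 1"
    then show "cmod (fun_scale c f x) \<le> cmod c * dnorm f"
      using mult_left_mono[OF dnorm_upper[OF f] norm_ge_zero[of c]] by (simp add: fun_scale_def norm_mult)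
  qed
  show ?thesis
  proof (cases "c = 0")
    case True
    then show ?thesis using le[OF f, of c] dnorm_nonneg[OF fun_scale_dual[OF f, of c]] by simp
  next
    case False
    have "fun_scale (inverse c) (fun_scale c f) = f" using False by (simp add: fun_scale_def fun_eq_iff)
    then have "dnorm f \<le> cmod (inverse c) * dnorm (fun_scale c f)"
      using le[OF fun_scale_dual[OF f, of c], of "inverse c"] by simp
    then show ?thesis using le[OF f, of c] False by (simp add: norm_inverse norm_divide field_simps)
  qed
qed

lemma seminormed_carrier_dual: "seminormed_carrier dual fun_scale dnorm"
  by standard (use zero_dual fun_scale_dual dnorm_nonneg dnorm_scale in auto)

end

section \<open>The Hankel operator spaces and the dual as carriers\<close>

lemma op_of_0_M0space: "op_of 0 \<in> M0space"
proof -
  have "hankel 0" unfolding hankel_def by (intro exI[of _ "\<lambda>_. 0"]) (auto simp: hmat_def fun_eq_iff)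
  moreover have "cut I J 0 = 0" for I J by (rule bmat_eqI) simp
  then have "cpt 0" unfolding cpt_def by simp
  ultimately show ?thesis by (simp add: M0space_iff op_of_in_Mspace mat_op_of)
qed

lemma M0_Mspace: "T \<in> M0space \<Longrightarrow> T \<in> Mspace"
  by (simp add: M0space_def)

lemma op_add_M0space: "T \<in> M0space \<Longrightarrow> S \<in> M0space \<Longrightarrow> op_add T S \<in> M0space"
  by (simp add: M0space_iff op_add_Mspace mat_op_add cpt_add)

lemma op_scale_M0space: "T \<in> M0space \<Longrightarrow> op_scale c T \<in> M0space"
  by (simp add: M0space_iff op_scale_Mspace mat_op_scale cpt_cs)

lemma opnorm_op_scale: "T \<in> Mspace \<Longrightarrow> opnorm (op_scale c T) = cmod c * opnorm T"
  by (metis norm_mat op_scale_Mspace mat_op_scale norm_cs)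

lemma opnorm_nonneg: "T \<in> Mspace \<Longrightarrow> 0 \<le> opnorm T"
  by (metis norm_mat norm_ge_zero)

interpretation M: seminormed_carrier Mspace op_add op_scale opnorm
  by standard (use op_of_0_M0space M0_Mspace in \<open>auto simp: op_scale_Mspace opnorm_nonneg opnorm_op_scale\<close>)

interpretation M0: seminormed_carrier M0space op_add op_scale opnorm
  rewrites "dual_space M0space op_add op_scale opnorm \<equiv> M0dual"
    and "dual_norm M0space opnorm \<equiv> M0dual_norm"
proof -
  show "seminormed_carrier M0space op_scale opnorm"
    by standard (use op_of_0_M0space M0_Mspace in \<open>auto simp: op_scale_M0space opnorm_nonneg opnorm_op_scale\<close>)
qed (simp_all add: M0dual_def M0dual_norm_def)

interpretation MD: seminormed_carrier M0dual fun_add fun_scale M0dual_norm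
  rewrites "dual_space M0dual fun_add fun_scale M0dual_norm \<equiv> M0bidual"
    and "dual_norm M0dual M0dual_norm \<equiv> M0bidual_norm"
  by (rule M0.seminormed_carrier_dual) (simp_all add: M0bidual_def M0bidual_norm_def)

section \<open>Dilations\<close>

text \<open>The factors \<open>n powr -\<epsilon>\<close> are completely multiplicative, so that conjugating by the diagonal
  operator they define preserves the Hankel structure.\<close>
definition dfac :: "nat \<Rightarrow> nat \<Rightarrow> complex" where
  "dfac k n = complex_of_real (real n powr (- inverse (real (Suc k))))"

definition dil :: "nat \<Rightarrow> op \<Rightarrow> op" where
  "dil k T = op_of (wt (dfac k) (dfac k) (mat T))"

lemma cmod_dfac: "cmod (dfac k n) = real n powr (- inverse (real (Suc k)))"
  unfolding dfac_def norm_of_real by simp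

text \<open>Index 0 must be excluded: \<open>0 powr x\<close> is 0, so the factor jumps up from 0 to
  1 before it decreases.\<close>

lemma dfac_antimono: assumes "0 < m" "m \<le> n" shows "cmod (dfac k n) \<le> cmod (dfac k m)"
  unfolding cmod_dfac using assms by (intro powr_mono2') auto

lemma dfac_le_1: "cmod (dfac k n) \<le> 1"
proof (cases "n = 0")
  case True then show ?thesis by (simp add: cmod_dfac)
next
  case False
  then show ?thesis using dfac_antimono[of 1 n k] by (simp add: cmod_dfac)
qed

lemma dfac_mult: "dfac k (i * j) = dfac k i * dfac k j"
  by (simp add: dfac_def powr_mult)

lemma dfac_tendsto_0: "(\<lambda>n. cmod (dfac k n)) \<longlonglongrightarrow> 0"
  unfolding cmod_dfac by (intro tendsto_neg_powr filterlim_real_sequentially) simp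

lemma dfac_tendsto_1: assumes "0 < n" shows "(\<lambda>k. dfac k n) \<longlonglongrightarrow> 1"
proof -
  have "(\<lambda>k. real n powr (- inverse (real (Suc k)))) \<longlonglongrightarrow> real n powr (- 0)"
    using assms by (intro tendsto_intros LIMSEQ_inverse_real_of_nat) simp_all
  then have "(\<lambda>k. complex_of_real (real n powr (- inverse (real (Suc k))))) \<longlonglongrightarrow> complex_of_real 1"
    using assms by (intro tendsto_of_real) simp
  then show ?thesis by (simp add: dfac_def)
qed

lemma ent_wt_dfac: "ent (wt (dfac k) (dfac k) A) i j = dfac k i * dfac k j * ent A i j"
  by (rule ent_wt) (rule dfac_le_1)+

lemma hankel_wt_dfac: assumes "hankel A" shows "hankel (wt (dfac k) (dfac k) A)"
proof -
  obtain \<alpha> where "ent A = hmat \<alpha>" using assms unfolding hankel_def by blast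
  then have "ent (wt (dfac k) (dfac k) A) = hmat (\<lambda>n. dfac k n * \<alpha> n)"
    by (auto simp: fun_eq_iff ent_wt_dfac hmat_def dfac_mult)
  then show ?thesis unfolding hankel_def by blast
qed

text \<open>Outside the section at least one of the two indices is large, so one weight is at most
  \<open>?c\<close> while the other is at most 1. The two pieces of the complement therefore have
  norm at most \<open>?c * norm A\<close> each, and \<open>?c\<close> tends to 0.\<close>

lemma cpt_wt_dfac: "cpt (wt (dfac k) (dfac k) A)" (is "cpt ?W")
proof -
  \<comment> \<open>Sections of size \<open>Suc n\<close> keep the index positive, where the factors
    are monotone.\<close>
  have le: "norm (?W - sec (Suc n) ?W) \<le> 2 * (cmod (dfac k (Suc n)) * norm A)" for n
  proof -
    let ?c = "cmod (dfac k (Suc n))"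
    let ?e = "\<lambda>j. if Suc n \<le> j then dfac k j else 0" and ?d = "\<lambda>j. if j < Suc n then dfac k j else 0"
    have e: "cmod (?e j) \<le> ?c" for j using dfac_antimono[of "Suc n" j k] by auto
    have d: "cmod (?d j) \<le> 1" for j using dfac_le_1 by auto
    have "norm (cut UNIV {Suc n..} ?W) \<le> 1 * ?c * norm A"
    proof (rule norm_bmat_le)
      have "ent (cut UNIV {Suc n..} ?W) = (\<lambda>i j. dfac k i * ?e j * ent A i j)"
        by (auto simp: fun_eq_iff ent_wt_dfac)
      then show "mbd (ent (cut UNIV {Suc n..} ?W)) (1 * ?c * norm A)"
        using mbd_weight[OF mbd_norm, of "dfac k" 1 ?e ?c A] e dfac_le_1 by simp
    qed
    moreover have "norm (cut {Suc n..} {..<Suc n} ?W) \<le> ?c * 1 * norm A"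
    proof (rule norm_bmat_le)
      have "ent (cut {Suc n..} {..<Suc n} ?W) = (\<lambda>i j. ?e i * ?d j * ent A i j)"
        by (auto simp: fun_eq_iff ent_wt_dfac)
      then show "mbd (ent (cut {Suc n..} {..<Suc n} ?W)) (?c * 1 * norm A)"
        using mbd_weight[OF mbd_norm, of ?e ?c ?d 1 A] e d by simp
    qed
    moreover have "?W - sec (Suc n) ?W = cut UNIV {Suc n..} ?W + cut {Suc n..} {..<Suc n} ?W"
      by (rule bmat_eqI) auto
    ultimately show ?thesis
      using norm_triangle_ineq[of "cut UNIV {Suc n..} ?W" "cut {Suc n..} {..<Suc n} ?W"] by simp
  qed
  have "(\<lambda>n. 2 * (cmod (dfac k (Suc n)) * norm A)) \<longlonglongrightarrow> 0"
    by (intro tendsto_mult_right_zero tendsto_mult_left_zero LIMSEQ_Suc[OF dfac_tendsto_0])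
  from norm_null_comparison[OF le this] show ?thesis
    unfolding cpt_def by (rule LIMSEQ_imp_Suc)
qed

lemma mat_dil: "T \<in> Mspace \<Longrightarrow> mat (dil k T) = wt (dfac k) (dfac k) (mat T)"
  unfolding dil_def by (rule mat_op_of[OF hankel_wt_dfac[OF hankel_mat]])

lemma dil_M0space: "T \<in> Mspace \<Longrightarrow> dil k T \<in> M0space"
  using mat_dil[of T k] op_of_in_Mspace[OF hankel_wt_dfac[OF hankel_mat], of T k]
  by (simp add: M0space_iff cpt_wt_dfac) (simp add: dil_def)

lemma ent_dil_tendsto:
  assumes "T \<in> Mspace" shows "(\<lambda>k. ent (mat (dil k T)) i j) \<longlonglongrightarrow> ent (mat T) i j"
\<comment> \<open>For index 0 the factor is constantly 0 and does not tend to 1, but the entry of a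
  Hankel matrix is 0 there too.\<close>
proof (cases "i = 0 \<or> j = 0")
  case True
  then show ?thesis using hankel_zero_row hankel_zero_column hankel_mat[OF assms]
    by (auto simp: mat_dil[OF assms] ent_wt_dfac)
next
  case False
  then have "(\<lambda>k. dfac k i * dfac k j * ent (mat T) i j) \<longlonglongrightarrow> 1 * 1 * ent (mat T) i j"
    by (intro tendsto_intros dfac_tendsto_1) auto
  then show ?thesis by (simp add: mat_dil[OF assms] ent_wt_dfac)
qed

section \<open>Normal extensions of functionals\<close>

text \<open>For \<open>T\<close> in \<open>Mspace\<close> this uses values of \<open>f\<close> at
  operators in \<open>M0space\<close> only, so it applies to functionals on either space.\<close>

definition hat :: "(op \<Rightarrow> complex) \<Rightarrow> op \<Rightarrow> complex" where
  "hat f T = lim (\<lambda>k. f (dil k T))"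

text \<open>The two cases for \<open>V\<close> serve the M-ideal property and the bidual. The
  constant \<open>C\<close> is not enlarged by the extension, without which the additivity of norms
  could not be carried back to \<open>f\<close>.\<close>

lemma extend_functional:
  assumes V: "V \<in> {Mspace, M0space}"
    and f: "f \<in> dual_space V op_add op_scale opnorm"
    and C: "\<And>T. T \<in> V \<Longrightarrow> cmod (f T) \<le> C * opnorm T" "0 \<le> C"
  shows "\<exists>F. functional F C \<and> (\<forall>T\<in>V. F (mat T) = f T) \<and>
    (\<forall>T\<in>Mspace. (\<lambda>k. f (dil k T)) \<longlonglongrightarrow> functional.normal_part F (mat T)) \<and>
    (\<forall>T\<in>Mspace. hat f T = functional.normal_part F (mat T))"
proof -
  have VM: "T \<in> Mspace" if "T \<in> V" for T using that V M0_Mspace by blast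
  have M0V: "T \<in> V" if "T \<in> M0space" for T using that V M0_Mspace by blast
  have Vadd: "op_add T S \<in> V" if "T \<in> V" "S \<in> V" for T S
    using that V op_add_Mspace op_add_M0space by blast
  have Vsc: "op_scale c T \<in> V" if "T \<in> V" for T c
    using that V op_scale_Mspace op_scale_M0space by blast
  have lin: "f (op_add T S) = f T + f S" "f (op_scale c T) = c * f T" if "T \<in> V" "S \<in> V" for T S c
    using f that unfolding dual_space_def by blast+
  let ?S = "mat ` V" and ?f = "\<lambda>A. f (op_of A)"
  have z: "0 \<in> ?S"
  proof -
    have "hankel 0" unfolding hankel_def by (intro exI[of _ "\<lambda>_. 0"]) (auto simp: hmat_def fun_eq_iff)
    then have "mat (op_of 0) = 0" by (rule mat_op_of)
    then show ?thesis using M0V[OF op_of_0_M0space] by (metis image_eqI)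
  qed
  obtain F where F: "\<And>x y. F (x + y) = F x + F y" "\<And>c x. F (cs c x) = c * F x"
    "\<And>x. cmod (F x) \<le> C * norm x" "\<And>x. x \<in> ?S \<Longrightarrow> F x = ?f x"
  proof (rule Hahn_Banach_complex[of cs ?S ?f C, OF vector_space_cs cs_of_real norm_cs z])
    show "x + y \<in> ?S" if "x \<in> ?S" "y \<in> ?S" for x y
      using that by (auto simp: VM mat_op_add[symmetric] intro!: imageI Vadd)
    show "cs c x \<in> ?S" if "x \<in> ?S" for x c
      using that by (auto simp: VM mat_op_scale[symmetric] intro!: imageI Vsc)
    show "?f (x + y) = ?f x + ?f y" if "x \<in> ?S" "y \<in> ?S" for x y
      using that by (auto simp: op_of_add op_of_mat VM lin)
    show "?f (cs c x) = c * ?f x" if "x \<in> ?S" for x c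
      using that by (auto simp: op_of_cs op_of_mat VM lin)
    show "cmod (?f x) \<le> C * norm x" if "x \<in> ?S" for x
      using that C(1) by (auto simp: op_of_mat VM norm_mat)
  qed (use C(2) in blast)+
  then have func: "functional F C" using C(2) by unfold_locales auto
  interpret functional F C by (rule func)
  have Ff: "F (mat T) = f T" if "T \<in> V" for T using F(4)[of "mat T"] that by (simp add: op_of_mat VM)
  have lim: "(\<lambda>k. f (dil k T)) \<longlonglongrightarrow> normal_part (mat T)" if T: "T \<in> Mspace" for T
  proof -
    \<comment> \<open>A dilated operator is compact, so \<open>f\<close>, its extension and the
      normal part agree on it; entrywise convergence with bounded norms then gives the
      limit.\<close>
    have "f (dil k T) = normal_part (mat (dil k T))" for k
      using normal_part_cpt[of "mat (dil k T)"] Ff[OF M0V[OF dil_M0space[OF T]]] dil_M0space[OF T]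
      by (simp add: M0space_iff)
    moreover have "norm (mat (dil k T)) \<le> norm (mat T)" for k
      unfolding mat_dil[OF T] by (rule norm_wt_le) (rule dfac_le_1)+
    ultimately show ?thesis
      using normal_part_continuous[of "\<lambda>k. mat (dil k T)" "mat T" "norm (mat T)"] ent_dil_tendsto[OF T] by simp
  qed
  moreover have "hat f T = normal_part (mat T)" if "T \<in> Mspace" for T
    unfolding hat_def by (rule limI[OF lim[OF that]])
  ultimately show ?thesis using func Ff by blast
qed

lemma hat_M0space:
  assumes V: "V \<in> {Mspace, M0space}" and f: "f \<in> dual_space V op_add op_scale opnorm"
    and C: "\<And>T. T \<in> V \<Longrightarrow> cmod (f T) \<le> C * opnorm T" "0 \<le> C" and T: "T \<in> M0space"
  shows "hat f T = f T"
proof -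
  obtain F where F: "functional F C" "\<And>T. T \<in> V \<Longrightarrow> F (mat T) = f T"
    "\<And>T. T \<in> Mspace \<Longrightarrow> (\<lambda>k. f (dil k T)) \<longlonglongrightarrow> functional.normal_part F (mat T)"
    "\<And>T. T \<in> Mspace \<Longrightarrow> hat f T = functional.normal_part F (mat T)"
    using extend_functional[OF V f C] by blast
  have "T \<in> V" using V T M0_Mspace by blast
  then show ?thesis using functional.normal_part_cpt[OF F(1)] F(2,4) T by (simp add: M0space_iff)
qed

lemma norm_hat_plus_rest:
  assumes f: "f \<in> M.dual" and C: "\<And>T. T \<in> Mspace \<Longrightarrow> cmod (f T) \<le> C * opnorm T" "0 \<le> C"
    and "S \<in> Mspace" "T \<in> Mspace" "opnorm S \<le> 1" "opnorm T \<le> 1"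
  shows "cmod (hat f S) + cmod (f T - hat f T) \<le> C"
proof -
  obtain F where F: "functional F C" "\<And>T. T \<in> Mspace \<Longrightarrow> F (mat T) = f T"
    "\<And>T. T \<in> Mspace \<Longrightarrow> (\<lambda>k. f (dil k T)) \<longlonglongrightarrow> functional.normal_part F (mat T)"
    "\<And>T. T \<in> Mspace \<Longrightarrow> hat f T = functional.normal_part F (mat T)"
    using extend_functional[OF insertI1 f C] by blast
  show ?thesis
    using functional.norm_normal_plus_singular[OF F(1), of "mat S" "mat T"] assms(4-)
    by (simp add: norm_mat F(2,4))
qed

lemma hat_linear_bounded:
  assumes V: "V \<in> {Mspace, M0space}" and f: "f \<in> dual_space V op_add op_scale opnorm"
    and C: "\<And>T. T \<in> V \<Longrightarrow> cmod (f T) \<le> C * opnorm T" "0 \<le> C" and T: "T \<in> Mspace"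
  shows hat_LIMSEQ: "(\<lambda>k. f (dil k T)) \<longlonglongrightarrow> hat f T"
    and hat_op_add: "S \<in> Mspace \<Longrightarrow> hat f (op_add T S) = hat f T + hat f S"
    and hat_op_scale: "hat f (op_scale c T) = c * hat f T"
    and hat_bound: "cmod (hat f T) \<le> C * opnorm T"
proof -
  obtain F where F: "functional F C" "\<And>T. T \<in> V \<Longrightarrow> F (mat T) = f T"
    "\<And>T. T \<in> Mspace \<Longrightarrow> (\<lambda>k. f (dil k T)) \<longlonglongrightarrow> functional.normal_part F (mat T)"
    "\<And>T. T \<in> Mspace \<Longrightarrow> hat f T = functional.normal_part F (mat T)"
    using extend_functional[OF V f C] by blast
  interpret N: functional "functional.normal_part F" C by (rule functional.functional_normal_part[OF F(1)])
  show "(\<lambda>k. f (dil k T)) \<longlonglongrightarrow> hat f T" using F(3,4)[OF T] by simp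
  show "S \<in> Mspace \<Longrightarrow> hat f (op_add T S) = hat f T + hat f S"
    using T by (simp add: F(4) op_add_Mspace mat_op_add N.add)
  show "hat f (op_scale c T) = c * hat f T"
    using T by (simp add: F(4) op_scale_Mspace mat_op_scale N.scale)
  show "cmod (hat f T) \<le> C * opnorm T"
    using N.bound[of "mat T"] T by (simp add: F(4) norm_mat)
qed

lemma M0dual_hat:
  assumes f: "f \<in> M0dual" and T: "T \<in> Mspace"
  shows M0dual_hat_LIMSEQ: "(\<lambda>k. f (dil k T)) \<longlonglongrightarrow> hat f T"
    and M0dual_hat_bound: "cmod (hat f T) \<le> M0dual_norm f * opnorm T"
  using hat_LIMSEQ[of M0space f "M0dual_norm f" T] hat_bound[of M0space f "M0dual_norm f" T]
    M0.dnorm_bound[OF f] M0.dnorm_nonneg[OF f] f T by (auto simp: M0dual_def)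

lemma M0dual_hat_M0space: "f \<in> M0dual \<Longrightarrow> T \<in> M0space \<Longrightarrow> hat f T = f T"
  using hat_M0space[of M0space f "M0dual_norm f" T] M0.dnorm_bound[of f] M0.dnorm_nonneg[of f]
  by (auto simp: M0dual_def)

section \<open>The bidual\<close>

definition ev :: "nat \<Rightarrow> op \<Rightarrow> complex" where
  "ev n T = (if T \<in> M0space then coef T n else 0)"

text \<open>The only possible symbol: if \<Phi> is represented by \<open>M(\<alpha>)\<close>, it
  must send the \<open>n\<close>-th coefficient functional to \<open>\<alpha> n\<close>.\<close>

definition symb :: "((op \<Rightarrow> complex) \<Rightarrow> complex) \<Rightarrow> nat \<Rightarrow> complex" where
  "symb \<Phi> n = \<Phi> (ev n)"

definition bidual_to_op :: "((op \<Rightarrow> complex) \<Rightarrow> complex) \<Rightarrow> op" where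
  "bidual_to_op \<Phi> = (if \<Phi> \<in> M0bidual then Mop (symb \<Phi>) else (\<lambda>_ _. 0))"

text \<open>Evaluation at \<open>T\<close>, which need not be compact, of functionals carried over
  to \<open>Mspace\<close> by \<open>hat\<close>.\<close>

definition op_to_bidual :: "op \<Rightarrow> (op \<Rightarrow> complex) \<Rightarrow> complex" where
  "op_to_bidual T \<phi> = (if \<phi> \<in> M0dual then hat \<phi> T else 0)"

lemma coef_eq_ent: "T \<in> Mspace \<Longrightarrow> coef T n = ent (mat T) 1 n"
  using coef_op_of[of "mat T" n] by (simp add: op_of_mat)

lemma coef_linear:
  assumes "T \<in> Mspace"
  shows "S \<in> Mspace \<Longrightarrow> coef (op_add T S) n = coef T n + coef S n" "coef (op_scale c T) n = c * coef T n"
    "cmod (coef T n) \<le> opnorm T"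
  using assms ent_le_norm[of "mat T" 1 n]
  by (simp_all add: coef_eq_ent op_add_Mspace op_scale_Mspace mat_op_add mat_op_scale norm_mat)

lemma ev_M0dual: "ev n \<in> M0dual"
  by (rule M0.dualI[where C = 1])
    (auto simp: ev_def coef_linear M0_Mspace op_add_M0space op_scale_M0space)

lemma M0bidual_sum:
  assumes \<Phi>: "\<Phi> \<in> M0bidual" and "finite I" and g: "\<And>s. s \<in> I \<Longrightarrow> g s \<in> M0dual"
  shows "(\<lambda>T. \<Sum>s\<in>I. c s * g s T) \<in> M0dual \<and> \<Phi> (\<lambda>T. \<Sum>s\<in>I. c s * g s T) = (\<Sum>s\<in>I. c s * \<Phi> (g s))"
  using assms(2) g
proof (induction I rule: finite_induct)
  case empty
  have "\<Phi> (fun_scale 0 (\<lambda>_. 0)) = 0 * \<Phi> (\<lambda>_. 0)" by (rule MD.dualD(2)[OF \<Phi> M0.zero_dual])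
  then show ?case using M0.zero_dual by (simp add: fun_scale_def)
next
  case (insert s I)
  let ?f = "fun_scale (c s) (g s)" and ?h = "\<lambda>T. \<Sum>s\<in>I. c s * g s T"
  have f: "?f \<in> M0dual" "\<Phi> ?f = c s * \<Phi> (g s)"
    using M0.fun_scale_dual MD.dualD(2)[OF \<Phi>] insert.prems by auto
  have h: "?h \<in> M0dual" "\<Phi> ?h = (\<Sum>s\<in>I. c s * \<Phi> (g s))" using insert by auto
  have "(\<lambda>T. \<Sum>s\<in>insert s I. c s * g s T) = fun_add ?f ?h"
    using insert.hyps by (simp add: fun_add_def fun_scale_def)
  then show ?case using M0.fun_add_dual[OF f(1) h(1)] MD.dualD(1)[OF \<Phi> f(1) h(1)] f h insert.hyps by simp
qed

text \<open>The entry at \<open>(i, j)\<close> is the coefficient functional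
  \<open>ev (i * j)\<close>, so \<Phi> may be applied to a finite combination of entries term by
  term.\<close>

lemma M0bidual_matrix:
  assumes \<Phi>: "\<Phi> \<in> M0bidual"
  defines "\<phi> \<equiv> \<lambda>w k T. if T \<in> M0space then (\<Sum>i<k. \<Sum>j<k. w i j * ent (mat T) i j) else 0"
  shows "\<phi> w k \<in> M0dual" "\<Phi> (\<phi> w k) = (\<Sum>i<k. \<Sum>j<k. w i j * hmat (symb \<Phi>) i j)"
proof -
  let ?I = "{..<k} \<times> {..<k}"
  \<comment> \<open>Zero weights for index 0 match the zero row and column of
    \<open>hmat\<close>.\<close>
  let ?c = "\<lambda>(i, j). if i = 0 \<or> j = 0 then 0 else w i j" and ?g = "\<lambda>(i, j). ev (i * j)"
  note * = M0bidual_sum[OF \<Phi>, of ?I ?g ?c]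
  have "\<phi> w k = (\<lambda>T. \<Sum>s\<in>?I. ?c s * ?g s T)"
  proof
    fix T
    show "\<phi> w k T = (\<Sum>s\<in>?I. ?c s * ?g s T)"
    proof (cases "T \<in> M0space")
      case True
      then show ?thesis unfolding \<phi>_def sum.cartesian_product
        by (auto intro!: sum.cong simp: ent_mat[OF M0_Mspace] hmat_def ev_def)
    next
      case False
      then have "(\<Sum>s\<in>?I. ?c s * ?g s T) = 0" by (intro sum.neutral) (auto simp: ev_def)
      then show ?thesis using False by (simp add: \<phi>_def)
    qed
  qed
  moreover have "(\<Sum>s\<in>?I. ?c s * \<Phi> (?g s)) = (\<Sum>i<k. \<Sum>j<k. w i j * hmat (symb \<Phi>) i j)"
    unfolding sum.cartesian_product by (auto intro!: sum.cong simp: hmat_def symb_def)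
  moreover have "?g s \<in> M0dual" for s by (auto simp: ev_M0dual split: prod.split)
  ultimately show "\<phi> w k \<in> M0dual" "\<Phi> (\<phi> w k) = (\<Sum>i<k. \<Sum>j<k. w i j * hmat (symb \<Phi>) i j)"
    using * by simp_all
qed

text \<open>The form of the symbol at \<open>a\<close>, \<open>b\<close> is the value of \<Phi> at
  the functional evaluating the form of \<open>T\<close> at \<open>a\<close>, \<open>b\<close>, and
  this functional has norm at most \<open>sn k a * sn k b\<close>.\<close>

lemma mbd_symb: assumes \<Phi>: "\<Phi> \<in> M0bidual" shows "mbd (hmat (symb \<Phi>)) (M0bidual_norm \<Phi>)"
  unfolding mbd_def
proof (intro conjI allI)
  show nn: "0 \<le> M0bidual_norm \<Phi>" by (rule MD.dnorm_nonneg[OF \<Phi>])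
  fix k and a b :: "nat \<Rightarrow> complex"
  define \<phi> where "\<phi> = (\<lambda>T. if T \<in> M0space then (\<Sum>i<k. \<Sum>j<k. (a i * b j) * ent (mat T) i j) else 0)"
  have \<phi>: "\<phi> \<in> M0dual" "\<Phi> \<phi> = bform k (hmat (symb \<Phi>)) a b"
    using M0bidual_matrix[OF \<Phi>, where w = "\<lambda>i j. a i * b j" and k = k] by (simp_all add: \<phi>_def bform_def)
  have "M0dual_norm \<phi> \<le> sn k a * sn k b"
  proof (rule M0.dnorm_least)
    fix T assume T: "T \<in> M0space" "opnorm T \<le> 1"
    have "cmod (\<phi> T) \<le> opnorm T * sn k a * sn k b"
      using bform_le_norm[of k "mat T" a b] T(1) by (simp add: \<phi>_def bform_def norm_mat M0_Mspace)
    also have "\<dots> \<le> 1 * sn k a * sn k b" using T by (intro mult_right_mono) auto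
    finally show "cmod (\<phi> T) \<le> sn k a * sn k b" by simp
  qed
  then have "M0bidual_norm \<Phi> * M0dual_norm \<phi> \<le> M0bidual_norm \<Phi> * (sn k a * sn k b)"
    using nn by (rule mult_left_mono)
  then show "cmod (bform k (hmat (symb \<Phi>)) a b) \<le> M0bidual_norm \<Phi> * sn k a * sn k b"
    using MD.dnorm_bound[OF \<Phi> \<phi>(1)] by (simp add: \<phi>(2) mult.assoc)
qed

lemma bidual_to_op_facts:
  assumes \<Phi>: "\<Phi> \<in> M0bidual"
  shows bidual_to_op_Mspace: "bidual_to_op \<Phi> \<in> Mspace" and ent_mat_bidual_to_op: "ent (mat (bidual_to_op \<Phi>)) = hmat (symb \<Phi>)"
    and opnorm_bidual_to_op_le: "opnorm (bidual_to_op \<Phi>) \<le> M0bidual_norm \<Phi>"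
proof -
  show M: "bidual_to_op \<Phi> \<in> Mspace"
    using mbd_symb[OF \<Phi>] \<Phi> mh_bounded_iff_mbd unfolding Mspace_def bidual_to_op_def by auto
  define A where "A = Abs_bmat (hmat (symb \<Phi>))"
  have A: "ent A = hmat (symb \<Phi>)" unfolding A_def using mbd_symb[OF \<Phi>] by (intro Abs_bmat_inverse) blast
  then have "bidual_to_op \<Phi> = op_of A" using Mop_eq_op_of \<Phi> by (simp add: bidual_to_op_def)
  moreover have "hankel A" using A unfolding hankel_def by blast
  ultimately have "mat (bidual_to_op \<Phi>) = A" by (simp add: mat_op_of)
  then show *: "ent (mat (bidual_to_op \<Phi>)) = hmat (symb \<Phi>)" using A by simp
  show "opnorm (bidual_to_op \<Phi>) \<le> M0bidual_norm \<Phi>"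
    using norm_bmat_le[of "mat (bidual_to_op \<Phi>)"] mbd_symb[OF \<Phi>] * norm_mat[OF M] by simp
qed

text \<open>The truncations \<open>\<phi>n n\<close> are finite combinations of coefficient
  functionals, on which \<Phi> is determined by its symbol. They converge to \<phi> in the dual
  norm, because \<phi> coincides on compact operators with the normal part of its extension. So
  \<Phi> is determined by its symbol everywhere.\<close>

lemma hat_bidual_to_op:
  assumes \<Phi>: "\<Phi> \<in> M0bidual" and \<phi>: "\<phi> \<in> M0dual"
  shows "hat \<phi> (bidual_to_op \<Phi>) = \<Phi> \<phi>"
proof -
  let ?C = "M0dual_norm \<phi>" and ?B = "mat (bidual_to_op \<Phi>)"
  have \<phi>': "\<phi> \<in> dual_space M0space op_add op_scale opnorm" using \<phi> by (simp add: M0dual_def)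
  obtain F where F: "functional F ?C" "\<And>T. T \<in> M0space \<Longrightarrow> F (mat T) = \<phi> T"
    "\<And>T. T \<in> Mspace \<Longrightarrow> (\<lambda>k. \<phi> (dil k T)) \<longlonglongrightarrow> functional.normal_part F (mat T)"
    "\<And>T. T \<in> Mspace \<Longrightarrow> hat \<phi> T = functional.normal_part F (mat T)"
    using extend_functional[OF insertI2[OF singletonI] \<phi>' M0.dnorm_bound[OF \<phi>] M0.dnorm_nonneg[OF \<phi>]] by blast
  interpret functional F ?C by (rule F(1))
  define \<phi>n where "\<phi>n n T = (if T \<in> M0space then F (sec n (mat T)) else 0)" for n T
  have \<phi>n: "\<phi>n n \<in> M0dual" "\<Phi> (\<phi>n n) = F (sec n ?B)" for n
  proof -
    obtain w where w: "\<And>A. F (sec n A) = (\<Sum>i<n. \<Sum>j<n. w i j * ent A i j)" using eval_section by blast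
    have "\<phi>n n = (\<lambda>T. if T \<in> M0space then (\<Sum>i<n. \<Sum>j<n. w i j * ent (mat T) i j) else 0)"
      by (rule ext) (simp add: \<phi>n_def w)
    then show "\<phi>n n \<in> M0dual" "\<Phi> (\<phi>n n) = F (sec n ?B)"
      using M0bidual_matrix[OF \<Phi>, where w = w and k = n] by (simp_all add: w ent_mat_bidual_to_op[OF \<Phi>])
  qed
  have "(\<lambda>n. \<Phi> (\<phi>n n)) \<longlonglongrightarrow> \<Phi> \<phi>"
  proof (rule LIMSEQ_I)
    fix e :: real assume e: "e > 0"
    define d where "d = e / (M0bidual_norm \<Phi> + 1)"
    have nn: "0 \<le> M0bidual_norm \<Phi>" by (rule MD.dnorm_nonneg[OF \<Phi>])
    have d: "d > 0" "M0bidual_norm \<Phi> * d < e"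
      using e nn by (auto simp: d_def field_simps add_nonneg_pos intro!: divide_pos_pos)
    obtain N where N: "\<And>n A. n \<ge> N \<Longrightarrow> cmod (normal_part A - F (sec n A)) \<le> d * norm A"
      using normal_part_uniform[OF d(1)] by blast
    have "norm (\<Phi> (\<phi>n n) - \<Phi> \<phi>) < e" if n: "n \<ge> N" for n
    proof -
      have m: "fun_scale (-1) \<phi> \<in> M0dual" by (rule M0.fun_scale_dual[OF \<phi>])
      let ?\<psi> = "fun_add (\<phi>n n) (fun_scale (-1) \<phi>)"
      have \<psi>: "?\<psi> \<in> M0dual" by (rule M0.fun_add_dual[OF \<phi>n(1) m])
      have "\<Phi> ?\<psi> = \<Phi> (\<phi>n n) - \<Phi> \<phi>"
        using MD.dualD(1)[OF \<Phi> \<phi>n(1) m] MD.dualD(2)[OF \<Phi> \<phi>, of "-1"] by simp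
      then have "norm (\<Phi> (\<phi>n n) - \<Phi> \<phi>) \<le> M0bidual_norm \<Phi> * M0dual_norm ?\<psi>"
        using MD.dnorm_bound[OF \<Phi> \<psi>] by simp
      also have "M0dual_norm ?\<psi> \<le> d"
      proof (rule M0.dnorm_least)
        fix T assume T: "T \<in> M0space" "opnorm T \<le> 1"
        have "?\<psi> T = F (sec n (mat T)) - normal_part (mat T)"
          using T F(2)[of T] normal_part_cpt[of "mat T"] by (simp add: fun_add_def fun_scale_def \<phi>n_def M0space_iff)
        then have "cmod (?\<psi> T) \<le> d * opnorm T"
          using N[OF n, of "mat T"] T by (simp add: norm_minus_commute norm_mat M0_Mspace)
        also have "\<dots> \<le> d * 1" using T d by (intro mult_left_mono) auto
        finally show "cmod (?\<psi> T) \<le> d" by simp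
      qed
      finally show ?thesis using d(2) nn mult_left_mono by fastforce
    qed
    then show "\<exists>no. \<forall>n\<ge>no. norm (\<Phi> (\<phi>n n) - \<Phi> \<phi>) < e" by blast
  qed
  then have "normal_part ?B = \<Phi> \<phi>" using LIMSEQ_unique[OF normal_part_LIMSEQ[of ?B]] by (simp add: \<phi>n(2))
  then show ?thesis using F(4)[OF bidual_to_op_Mspace[OF \<Phi>]] by simp
qed

section \<open>The two maps are inverse to each other and isometric\<close>

lemma op_to_bidual_bidual_to_op: assumes "\<Phi> \<in> M0bidual" shows "op_to_bidual (bidual_to_op \<Phi>) = \<Phi>"
  using hat_bidual_to_op[OF assms] MD.dualD(3)[OF assms] by (auto simp: op_to_bidual_def fun_eq_iff)

lemma op_to_bidual_M0bidual:
  assumes T: "T \<in> Mspace" shows "op_to_bidual T \<in> M0bidual" "M0bidual_norm (op_to_bidual T) \<le> opnorm T"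
proof -
  have bd: "cmod (op_to_bidual T \<phi>) \<le> opnorm T * M0dual_norm \<phi>" if "\<phi> \<in> M0dual" for \<phi>
    using M0dual_hat_bound[OF that T] that by (simp add: op_to_bidual_def mult.commute)
  show "op_to_bidual T \<in> M0bidual"
  proof (rule MD.dualI)
    fix \<phi> \<psi> assume \<phi>: "\<phi> \<in> M0dual" and \<psi>: "\<psi> \<in> M0dual"
    have "hat (fun_add \<phi> \<psi>) T = hat \<phi> T + hat \<psi> T"
      using LIMSEQ_unique[OF M0dual_hat_LIMSEQ[OF M0.fun_add_dual[OF \<phi> \<psi>] T]]
        tendsto_add[OF M0dual_hat_LIMSEQ[OF \<phi> T] M0dual_hat_LIMSEQ[OF \<psi> T]]
      by (simp add: fun_add_def)
    then show "op_to_bidual T (fun_add \<phi> \<psi>) = op_to_bidual T \<phi> + op_to_bidual T \<psi>"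
      using \<phi> \<psi> by (simp add: op_to_bidual_def M0.fun_add_dual)
  next
    fix c \<phi> assume \<phi>: "\<phi> \<in> M0dual"
    have "hat (fun_scale c \<phi>) T = c * hat \<phi> T"
      using LIMSEQ_unique[OF M0dual_hat_LIMSEQ[OF M0.fun_scale_dual[OF \<phi>] T]]
        tendsto_mult_left[OF M0dual_hat_LIMSEQ[OF \<phi> T]]
      by (simp add: fun_scale_def)
    then show "op_to_bidual T (fun_scale c \<phi>) = c * op_to_bidual T \<phi>"
      using \<phi> by (simp add: op_to_bidual_def M0.fun_scale_dual)
  qed (use bd in \<open>auto simp: op_to_bidual_def\<close>)
  show "M0bidual_norm (op_to_bidual T) \<le> opnorm T"
  proof (rule MD.dnorm_least)
    fix \<phi> assume "\<phi> \<in> M0dual" "M0dual_norm \<phi> \<le> 1"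
    then show "cmod (op_to_bidual T \<phi>) \<le> opnorm T"
      using bd[of \<phi>] mult_left_mono[of "M0dual_norm \<phi>" 1 "opnorm T"] opnorm_nonneg[OF T] by simp
  qed
qed

lemma coef_dil_tendsto: assumes "T \<in> Mspace" shows "(\<lambda>k. coef (dil k T) n) \<longlonglongrightarrow> coef T n"
  using ent_dil_tendsto[OF assms, of 1 n] assms by (simp add: coef_eq_ent M0_Mspace dil_M0space)

lemma bidual_to_op_op_to_bidual: assumes T: "T \<in> Mspace" shows "bidual_to_op (op_to_bidual T) = T"
proof -
  have "hat (ev n) T = coef T n" for n
    using coef_dil_tendsto[OF T, of n] unfolding hat_def by (simp add: ev_def dil_M0space[OF T] limI)
  then have "symb (op_to_bidual T) = coef T" by (auto simp: symb_def op_to_bidual_def ev_M0dual)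
  then have "bidual_to_op (op_to_bidual T) = Mop (coef T)" using op_to_bidual_M0bidual[OF T] by (simp add: bidual_to_op_def)
  then show ?thesis using Mop_eq_op_of[OF ent_mat[OF T]] op_of_mat[OF T] by simp
qed

lemma iota_eq_op_to_bidual: "T \<in> M0space \<Longrightarrow> iota_M0 T = op_to_bidual T"
  by (auto simp: iota_M0_def canon_emb_def op_to_bidual_def M0dual_def[symmetric] M0dual_hat_M0space)

lemma bidual_to_op_linear:
  assumes \<Phi>: "\<Phi> \<in> M0bidual"
  shows "\<Psi> \<in> M0bidual \<Longrightarrow> bidual_to_op (fun_add \<Phi> \<Psi>) = op_add (bidual_to_op \<Phi>) (bidual_to_op \<Psi>)"
    and "bidual_to_op (fun_scale c \<Phi>) = op_scale c (bidual_to_op \<Phi>)"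
proof -
  assume \<Psi>: "\<Psi> \<in> M0bidual"
  have "mat (bidual_to_op (fun_add \<Phi> \<Psi>)) = mat (op_add (bidual_to_op \<Phi>) (bidual_to_op \<Psi>))"
    unfolding mat_op_add[OF bidual_to_op_Mspace[OF \<Phi>] bidual_to_op_Mspace[OF \<Psi>]]
    by (rule bmat_eqI, simp only: plus_bmat.rep_eq ent_mat_bidual_to_op[OF \<Phi>] ent_mat_bidual_to_op[OF \<Psi>]
        ent_mat_bidual_to_op[OF MD.fun_add_dual[OF \<Phi> \<Psi>]]) (simp add: hmat_def symb_def fun_add_def)
  then show "bidual_to_op (fun_add \<Phi> \<Psi>) = op_add (bidual_to_op \<Phi>) (bidual_to_op \<Psi>)"
    using \<Phi> \<Psi> by (simp add: mat_eq_iff bidual_to_op_Mspace op_add_Mspace MD.fun_add_dual)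
next
  have "mat (bidual_to_op (fun_scale c \<Phi>)) = mat (op_scale c (bidual_to_op \<Phi>))"
    unfolding mat_op_scale[OF bidual_to_op_Mspace[OF \<Phi>]]
    by (rule bmat_eqI, simp only: cs.rep_eq ent_mat_bidual_to_op[OF \<Phi>]
        ent_mat_bidual_to_op[OF MD.fun_scale_dual[OF \<Phi>]]) (simp add: hmat_def symb_def fun_scale_def)
  then show "bidual_to_op (fun_scale c \<Phi>) = op_scale c (bidual_to_op \<Phi>)"
    using \<Phi> by (simp add: mat_eq_iff bidual_to_op_Mspace op_scale_Mspace MD.fun_scale_dual)
qed

text \<open>Both maps are contractions and they are mutually inverse, so neither can shrink the
  norm.\<close>

lemma opnorm_bidual_to_op: assumes "\<Phi> \<in> M0bidual" shows "opnorm (bidual_to_op \<Phi>) = M0bidual_norm \<Phi>"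
  using opnorm_bidual_to_op_le[OF assms] op_to_bidual_M0bidual(2)[OF bidual_to_op_Mspace[OF assms]] by (simp add: op_to_bidual_bidual_to_op[OF assms])

lemma bij_bidual_to_op: "bij_betw bidual_to_op M0bidual Mspace"
  by (rule bij_betwI[where g = op_to_bidual]) (auto simp: bidual_to_op_Mspace op_to_bidual_M0bidual op_to_bidual_bidual_to_op bidual_to_op_op_to_bidual)

lemma op_to_bidual_linear:
  assumes "T \<in> Mspace"
  shows "S \<in> Mspace \<Longrightarrow> op_to_bidual (op_add T S) = fun_add (op_to_bidual T) (op_to_bidual S)"
    and "op_to_bidual (op_scale c T) = fun_scale c (op_to_bidual T)"
proof -
  assume S: "S \<in> Mspace"
  have "op_add T S = bidual_to_op (fun_add (op_to_bidual T) (op_to_bidual S))"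
    using assms S by (simp add: bidual_to_op_linear op_to_bidual_M0bidual bidual_to_op_op_to_bidual)
  then show "op_to_bidual (op_add T S) = fun_add (op_to_bidual T) (op_to_bidual S)"
    using assms S by (simp add: op_to_bidual_bidual_to_op MD.fun_add_dual op_to_bidual_M0bidual)
next
  have "op_scale c T = bidual_to_op (fun_scale c (op_to_bidual T))"
    using assms by (simp add: bidual_to_op_linear op_to_bidual_M0bidual bidual_to_op_op_to_bidual)
  then show "op_to_bidual (op_scale c T) = fun_scale c (op_to_bidual T)"
    using assms by (simp add: op_to_bidual_bidual_to_op MD.fun_scale_dual op_to_bidual_M0bidual)
qed

text \<open>Composing a coefficient functional with \<open>J\<close> changes it only by a functional vanishing on the
  compact operators, which must be zero because the norms of the two parts add up.\<close>
lemma contraction_fixing_M0space_is_identity: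
  assumes JM: "\<And>T. T \<in> Mspace \<Longrightarrow> J T \<in> Mspace"
    and Jadd: "\<And>T S. T \<in> Mspace \<Longrightarrow> S \<in> Mspace \<Longrightarrow> J (op_add T S) = op_add (J T) (J S)"
    and Jsc: "\<And>c T. T \<in> Mspace \<Longrightarrow> J (op_scale c T) = op_scale c (J T)"
    and Jnorm: "\<And>T. T \<in> Mspace \<Longrightarrow> opnorm (J T) \<le> opnorm T"
    and Jfix: "\<And>T. T \<in> M0space \<Longrightarrow> J T = T"
    and T: "T \<in> Mspace"
  shows "J T = T"
proof -
  have "coef (J T) n = coef T n" for n
  proof -
    define g where "g T = (if T \<in> Mspace then coef T n else 0)" for T
    define f where "f T = (if T \<in> Mspace then coef (J T) n else 0)" for T
    define C where "C = M.dnorm g"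
    have g: "g \<in> M.dual"
      by (rule M.dualI[where C = 1]) (auto simp: g_def coef_linear op_add_Mspace op_scale_Mspace)
    have C0: "0 \<le> C" unfolding C_def by (rule M.dnorm_nonneg[OF g])
    have fC: "cmod (f T) \<le> C * opnorm T" if "T \<in> Mspace" for T
    proof -
      have "cmod (f T) \<le> C * opnorm (J T)"
        using M.dnorm_bound[OF g JM[OF that]] that by (simp add: f_def g_def JM C_def)
      also have "\<dots> \<le> C * opnorm T" by (rule mult_left_mono[OF Jnorm[OF that] C0])
      finally show ?thesis .
    qed
    have f: "f \<in> M.dual"
      by (rule M.dualI[where C = C]) (use fC in \<open>auto simp: f_def coef_linear op_add_Mspace op_scale_Mspace JM Jadd Jsc\<close>)
    \<comment> \<open>\<open>J\<close> fixes the dilated operators, and \<open>hat f\<close> depends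
      on nothing else.\<close>
    have hat: "hat f S = coef S n" if "S \<in> Mspace" for S
      unfolding hat_def using coef_dil_tendsto[OF that, of n] dil_M0space[OF that]
      by (intro limI) (simp add: f_def Jfix M0_Mspace)
    have unit: "coef (J S) n = coef S n" if S: "S \<in> Mspace" "opnorm S \<le> 1" for S
    proof -
      \<comment> \<open>\<open>C\<close> is the exact norm of \<open>g\<close>, the normal part of
        \<open>f\<close> on \<open>Mspace\<close>. The normal part thus uses up the whole bound, and
        nothing is left for the singular part.\<close>
      have "C \<le> C - cmod (f S - hat f S)" unfolding C_def
      proof (rule M.dnorm_least)
        fix R assume R: "R \<in> Mspace" "opnorm R \<le> 1"
        show "cmod (g R) \<le> M.dnorm g - cmod (f S - hat f S)"
          using norm_hat_plus_rest[OF f fC C0 R(1) S(1) R(2) S(2)] R by (simp add: hat g_def C_def)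
      qed
      then show ?thesis using S by (simp add: hat f_def)
    qed
    \<comment> \<open>Scaling by \<open>r\<close> moves \<open>T\<close> into the unit ball, where
      \<open>unit\<close> applies.\<close>
    define r where "r = inverse (opnorm T + 1)"
    have r: "r > 0" "r * opnorm T \<le> 1" using opnorm_nonneg[OF T] by (auto simp: r_def field_simps)
    have "coef (J (op_scale (complex_of_real r) T)) n = coef (op_scale (complex_of_real r) T) n"
      using r T by (intro unit) (auto simp: op_scale_Mspace opnorm_op_scale)
    then show ?thesis using r T by (simp add: Jsc coef_linear JM)
  qed
  then have "coef (J T) = coef T" by blast
  then have "ent (mat (J T)) = ent (mat T)" using ent_mat[OF JM[OF T]] ent_mat[OF T] by simp
  then have "mat (J T) = mat T" by (simp add: ent_inject)
  then show ?thesis using mat_eq_iff[OF JM[OF T] T] by simp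
qed

section \<open>The M-ideal property\<close>

definition hatM :: "(op \<Rightarrow> complex) \<Rightarrow> op \<Rightarrow> complex" where
  "hatM f T = (if T \<in> Mspace then hat f T else 0)"

lemma M_hat:
  assumes "f \<in> M.dual" "T \<in> Mspace"
  shows M_hat_LIMSEQ: "(\<lambda>k. f (dil k T)) \<longlonglongrightarrow> hat f T"
    and M_hat_add: "S \<in> Mspace \<Longrightarrow> hat f (op_add T S) = hat f T + hat f S"
    and M_hat_scale: "hat f (op_scale c T) = c * hat f T"
    and M_hat_bound: "cmod (hat f T) \<le> M.dnorm f * opnorm T"
  using hat_linear_bounded[of Mspace f "M.dnorm f" T] M.dnorm_bound[OF assms(1)] M.dnorm_nonneg[OF assms(1)] assms
  by blast+

lemma M_hat_M0space: "f \<in> M.dual \<Longrightarrow> T \<in> M0space \<Longrightarrow> hat f T = f T"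
  using hat_M0space[of Mspace f "M.dnorm f" T] M.dnorm_bound[of f] M.dnorm_nonneg[of f] by blast

lemma hatM_dual: assumes f: "f \<in> M.dual" shows "hatM f \<in> M.dual"
  by (rule M.dualI[where C = "M.dnorm f"])
    (use f in \<open>auto simp: hatM_def M_hat_add M_hat_scale M_hat_bound op_add_Mspace op_scale_Mspace\<close>)

lemma hatM_add: assumes "f \<in> M.dual" "g \<in> M.dual" shows "hatM (fun_add f g) = fun_add (hatM f) (hatM g)"
proof
  fix T
  show "hatM (fun_add f g) T = fun_add (hatM f) (hatM g) T"
  proof (cases "T \<in> Mspace")
    case T: True
    show ?thesis
      using LIMSEQ_unique[OF M_hat_LIMSEQ[OF M.fun_add_dual[OF assms] T]]
        tendsto_add[OF M_hat_LIMSEQ[OF assms(1) T] M_hat_LIMSEQ[OF assms(2) T]] T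
      by (simp add: fun_add_def hatM_def)
  qed (simp add: hatM_def fun_add_def)
qed

lemma hatM_scale: assumes "f \<in> M.dual" shows "hatM (fun_scale c f) = fun_scale c (hatM f)"
proof
  fix T
  show "hatM (fun_scale c f) T = fun_scale c (hatM f) T"
  proof (cases "T \<in> Mspace")
    case T: True
    show ?thesis
      using LIMSEQ_unique[OF M_hat_LIMSEQ[OF M.fun_scale_dual[OF assms] T]]
        tendsto_mult_left[OF M_hat_LIMSEQ[OF assms T]] T
      by (simp add: fun_scale_def hatM_def)
  qed (simp add: hatM_def fun_scale_def)
qed

text \<open>The limit defining \<open>hat\<close> runs over values at compact operators, all of
  which are 0 here.\<close>

lemma hatM_annihilator:
  assumes "\<And>T. T \<in> M0space \<Longrightarrow> f T = 0" shows "hatM f = (\<lambda>_. 0)"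
proof
  fix T
  have "hat f T = 0" if "T \<in> Mspace" unfolding hat_def using assms dil_M0space[OF that] by simp
  then show "hatM f T = 0" by (simp add: hatM_def)
qed

text \<open>The triangle inequality gives one direction. For the other,
  \<open>norm_hat_plus_rest\<close> allows the two parts to be tested at independent operators
  \<open>S\<close> and \<open>T\<close>, so the two suprema can be taken one after the
  other.\<close>

lemma dnorm_split:
  assumes f: "f \<in> M.dual"
  shows "M.dnorm f = M.dnorm (fun_diff f (hatM f)) + M.dnorm (hatM f)"
proof (rule antisym)
  note h = hatM_dual[OF f] and d = M.fun_diff_dual[OF f hatM_dual[OF f]]
  show "M.dnorm f \<le> M.dnorm (fun_diff f (hatM f)) + M.dnorm (hatM f)"
  proof (rule M.dnorm_least)
    fix T assume T: "T \<in> Mspace" "opnorm T \<le> 1"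
    have "cmod (f T) \<le> cmod (fun_diff f (hatM f) T) + cmod (hatM f T)"
      using norm_triangle_ineq[of "fun_diff f (hatM f) T" "hatM f T"] by (simp add: fun_diff_def)
    then show "cmod (f T) \<le> M.dnorm (fun_diff f (hatM f)) + M.dnorm (hatM f)"
      using M.dnorm_upper[OF h T] M.dnorm_upper[OF d T] by linarith
  qed
  have "M.dnorm (hatM f) \<le> M.dnorm f - M.dnorm (fun_diff f (hatM f))"
  proof (rule M.dnorm_least)
    fix S assume S: "S \<in> Mspace" "opnorm S \<le> 1"
    have "M.dnorm (fun_diff f (hatM f)) \<le> M.dnorm f - cmod (hatM f S)"
    proof (rule M.dnorm_least)
      fix T assume T: "T \<in> Mspace" "opnorm T \<le> 1"
      show "cmod (fun_diff f (hatM f) T) \<le> M.dnorm f - cmod (hatM f S)"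
      proof -
        have "cmod (hat f S) + cmod (f T - hat f T) \<le> M.dnorm f"
          by (rule norm_hat_plus_rest[OF f M.dnorm_bound[OF f] M.dnorm_nonneg[OF f] S(1) T(1) S(2) T(2)])
        moreover have "hatM f S = hat f S" "fun_diff f (hatM f) T = f T - hat f T"
          using S T by (simp_all add: fun_diff_def hatM_def)
        ultimately show ?thesis by (simp only: le_diff_eq add.commute)
      qed
    qed
    then show "cmod (hatM f S) \<le> M.dnorm f - M.dnorm (fun_diff f (hatM f))" by simp
  qed
  then show "M.dnorm (fun_diff f (hatM f)) + M.dnorm (hatM f) \<le> M.dnorm f" by simp
qed

lemma M0space_closed:
  assumes s: "\<And>k. s k \<in> M0space" and w: "w \<in> Mspace"
    and lim: "(\<lambda>k. opnorm (op_add (s k) (op_scale (-1) w))) \<longlonglongrightarrow> 0"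
  shows "w \<in> M0space"
proof -
  have "opnorm (op_add (s k) (op_scale (-1) w)) = norm (mat (s k) - mat w)" for k
  proof -
    have "mat (op_add (s k) (op_scale (-1) w)) = mat (s k) - mat w"
      using s w by (intro bmat_eqI) (simp add: mat_op_add mat_op_scale op_scale_Mspace M0_Mspace)
    then show ?thesis
      using s w norm_mat[of "op_add (s k) (op_scale (-1) w)"] by (simp add: op_add_Mspace op_scale_Mspace M0_Mspace)
  qed
  then show ?thesis using cpt_limit[of "\<lambda>k. mat (s k)" "mat w"] s w lim by (simp add: M0space_iff)
qed

text \<open>The projection takes the singular part. It fixes the annihilator because functionals
  vanishing on \<open>M0space\<close> have normal part 0, and maps into it because
  \<open>hat f\<close> agrees with \<open>f\<close> on \<open>M0space\<close>.\<close>

lemma M_ideal_M0space: "M_ideal M0space Mspace op_add op_scale opnorm"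
proof -
  let ?P = "\<lambda>f. fun_diff f (hatM f)"
  let ?Ann = "{f \<in> M.dual. \<forall>z\<in>M0space. f z = 0}"
  have ann: "?P f z = 0" if "f \<in> M.dual" "z \<in> M0space" for f z
    using M_hat_M0space[OF that] that by (simp add: fun_diff_def hatM_def M0_Mspace)
  have P_ann: "?P f = f" if "f \<in> ?Ann" for f
  proof -
    have "hatM f = (\<lambda>_. 0)" using that by (intro hatM_annihilator) blast
    then show ?thesis by (simp add: fun_diff_def)
  qed
  have P1: "?P f \<in> ?Ann" if "f \<in> M.dual" for f
    using ann[OF that] M.fun_diff_dual[OF that hatM_dual[OF that]] by blast
  have proj: "\<exists>P. (\<forall>f\<in>M.dual. P f \<in> M.dual) \<and>
      (\<forall>f\<in>M.dual. \<forall>g\<in>M.dual. P (fun_add f g) = fun_add (P f) (P g)) \<and>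
      (\<forall>c. \<forall>f\<in>M.dual. P (fun_scale c f) = fun_scale c (P f)) \<and>
      (\<forall>f\<in>M.dual. P (P f) = P f) \<and> P ` M.dual = ?Ann \<and>
      (\<forall>f\<in>M.dual. M.dnorm f = M.dnorm (P f) + M.dnorm (fun_diff f (P f)))"
  proof (intro exI[of _ ?P] conjI ballI allI)
    fix f assume f: "f \<in> M.dual"
    show "?P f \<in> M.dual" using P1[OF f] by blast
    show "?P (fun_add f g) = fun_add (?P f) (?P g)" if "g \<in> M.dual" for g
      unfolding hatM_add[OF f that] by (auto simp: fun_diff_def fun_add_def)
    show "?P (fun_scale c f) = fun_scale c (?P f)" for c
      unfolding hatM_scale[OF f] by (auto simp: fun_diff_def fun_scale_def algebra_simps)
    show "?P (?P f) = ?P f" by (rule P_ann[OF P1[OF f]])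
    have "fun_diff f (?P f) = hatM f" by (simp add: fun_diff_def)
    then show "M.dnorm f = M.dnorm (?P f) + M.dnorm (fun_diff f (?P f))" using dnorm_split[OF f] by simp
  next
    show "?P ` M.dual = ?Ann"
    proof
      show "?P ` M.dual \<subseteq> ?Ann" using P1 by blast
      show "?Ann \<subseteq> ?P ` M.dual"
      proof
        fix f assume f: "f \<in> ?Ann"
        then have "f = ?P f" "f \<in> M.dual" using P_ann by auto
        then show "f \<in> ?P ` M.dual" by (rule image_eqI)
      qed
    qed
  qed
  show ?thesis unfolding M_ideal_def Let_def
  proof (intro conjI)
    show "M0space \<subseteq> Mspace" using M0_Mspace by blast
    show "\<forall>x\<in>M0space. \<forall>y\<in>M0space. op_add x y \<in> M0space" using op_add_M0space by blast
    show "\<forall>c. \<forall>x\<in>M0space. op_scale c x \<in> M0space" using op_scale_M0space by blast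
    show "\<forall>s w. (\<forall>k. s k \<in> M0space) \<and> w \<in> Mspace \<and>
        (\<lambda>k. opnorm (op_add (s k) (op_scale (-1) w))) \<longlonglongrightarrow> 0 \<longrightarrow> w \<in> M0space"
      using M0space_closed by blast
  qed (rule proj)
qed

theorem theorem2:
  shows "(\<exists>!U :: ((op \<Rightarrow> complex) \<Rightarrow> complex) \<Rightarrow> op.
            bij_betw U M0bidual Mspace \<and>
            (\<forall>\<Phi>\<in>M0bidual. \<forall>\<Psi>\<in>M0bidual. U (fun_add \<Phi> \<Psi>) = op_add (U \<Phi>) (U \<Psi>)) \<and>
            (\<forall>c. \<forall>\<Phi>\<in>M0bidual. U (fun_scale c \<Phi>) = op_scale c (U \<Phi>)) \<and>
            (\<forall>\<Phi>\<in>M0bidual. opnorm (U \<Phi>) = M0bidual_norm \<Phi>) \<and>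
            (\<forall>m\<in>M0space. U (iota_M0 m) = m) \<and>
            (\<forall>\<Phi>. \<Phi> \<notin> M0bidual \<longrightarrow> U \<Phi> = (\<lambda>_ _. 0)))
         \<and> M_ideal M0space Mspace op_add op_scale opnorm"
proof (intro conjI M_ideal_M0space ex1I[of _ bidual_to_op])
  show "bij_betw bidual_to_op M0bidual Mspace" by (rule bij_bidual_to_op)
  show "\<forall>\<Phi>\<in>M0bidual. \<forall>\<Psi>\<in>M0bidual. bidual_to_op (fun_add \<Phi> \<Psi>) = op_add (bidual_to_op \<Phi>) (bidual_to_op \<Psi>)"
    using bidual_to_op_linear(1) by blast
  show "\<forall>c. \<forall>\<Phi>\<in>M0bidual. bidual_to_op (fun_scale c \<Phi>) = op_scale c (bidual_to_op \<Phi>)"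
    using bidual_to_op_linear(2) by blast
  show "\<forall>\<Phi>\<in>M0bidual. opnorm (bidual_to_op \<Phi>) = M0bidual_norm \<Phi>" using opnorm_bidual_to_op by blast
  show "\<forall>m\<in>M0space. bidual_to_op (iota_M0 m) = m" by (simp add: iota_eq_op_to_bidual bidual_to_op_op_to_bidual M0_Mspace)
  show "\<forall>\<Phi>. \<Phi> \<notin> M0bidual \<longrightarrow> bidual_to_op \<Phi> = (\<lambda>_ _. 0)" by (simp add: bidual_to_op_def)
next
  fix U
  assume asm: "bij_betw U M0bidual Mspace \<and>
            (\<forall>\<Phi>\<in>M0bidual. \<forall>\<Psi>\<in>M0bidual. U (fun_add \<Phi> \<Psi>) = op_add (U \<Phi>) (U \<Psi>)) \<and>
            (\<forall>c. \<forall>\<Phi>\<in>M0bidual. U (fun_scale c \<Phi>) = op_scale c (U \<Phi>)) \<and>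
            (\<forall>\<Phi>\<in>M0bidual. opnorm (U \<Phi>) = M0bidual_norm \<Phi>) \<and>
            (\<forall>m\<in>M0space. U (iota_M0 m) = m) \<and>
            (\<forall>\<Phi>. \<Phi> \<notin> M0bidual \<longrightarrow> U \<Phi> = (\<lambda>_ _. 0))"
  then have UM: "\<And>\<Phi>. \<Phi> \<in> M0bidual \<Longrightarrow> U \<Phi> \<in> Mspace" using bij_betwE by blast
  \<comment> \<open>Composing a competitor \<open>U\<close> with the inverse of
    \<open>bidual_to_op\<close> gives a linear contraction of \<open>Mspace\<close> that fixes
    \<open>M0space\<close>, hence the identity.\<close>
  have "U (op_to_bidual T) = T" if T: "T \<in> Mspace" for T
    by (rule contraction_fixing_M0space_is_identity[of "\<lambda>T. U (op_to_bidual T)", OF _ _ _ _ _ T])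
      (use asm UM op_to_bidual_M0bidual in \<open>auto simp: op_to_bidual_linear iota_eq_op_to_bidual[symmetric]\<close>)
  then have "U \<Phi> = bidual_to_op \<Phi>" if "\<Phi> \<in> M0bidual" for \<Phi>
    using bidual_to_op_Mspace[OF that] op_to_bidual_bidual_to_op[OF that] by metis
  then show "U = bidual_to_op" using asm by (auto simp: fun_eq_iff bidual_to_op_def)
qed

end
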